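(* Let $\mathcal{L}$ be an affine subspace of $\mathbb{R}^n$, let $U\subset\mathbb{R}^d$ be open, and let $\mathbf{f}:U\to\mathcal{L}\subset\mathbb{R}^n$ be an analytic map such that for every ball $B\subset U$, $\mathbf{f}(B)$ is not contained in any proper affine subspace of $\mathcal{L}$. Let $\lambda_U$ and $\lambda_{\mathcal{L}}$ be Haar (Lebesgue) measures on $U$ and $\mathcal{L}$ respectively. Then the following are equivalent: (1) for $\lambda_U$-almost every $\mathbf{x}\in U$, $\mathbf{f}(\mathbf{x})$ is not singular; (2) for $\lambda_{\mathcal{L}}$-almost every $\mathbf{y}\in\mathcal{L}$, $\mathbf{y}$ is not singular.
   Context: $\Vert\cdot\Vert$ denotes the max norm. A vector $\mathbf{x}\in\mathbb{R}^n$ is called singular if for every $c>0$ and all sufficiently large $Q>0$ there exist $\mathbf{0}\neq\mathbf{q}\in\mathbb{Z}^n$ and $q_0\in\mathbb{Z}$ with $|\mathbf{q}\cdot\mathbf{x}+q_0|<c/Q^n$ and $\Vert\mathbf{q}\Vert\le Q$. *)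

theory Defs
  imports "HOL-Analysis.Analysis"
begin

definition int_vec :: "int ^ 'n \<Rightarrow> real ^ 'n" where
  "int_vec q = (\<chi> i. real_of_int (q $ i))"

text \<open>\<^const>\<open>infnorm\<close> is the max norm.\<close>

definition singular_vector :: "real ^ 'n \<Rightarrow> bool" where
  "singular_vector x \<longleftrightarrow>
     (\<forall>c>0. \<forall>\<^sub>F Q :: real in at_top.
        \<exists>(q :: int ^ 'n) (q0 :: int). q \<noteq> 0 \<and>
          \<bar>int_vec q \<bullet> x + real_of_int q0\<bar> < c / Q ^ CARD('n) \<and>
          infnorm (int_vec q) \<le> Q)"

text \<open>Real analyticity in several variables: near every point of \<open>U\<close> the map is the sum of a
  convergent power series, indexed by the multi-indices \<open>\<alpha> :: 'd \<Rightarrow> nat\<close>; the coefficients are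
  vectors. Convergence is unconditional, hence absolute.\<close>

definition real_analytic_on :: "(real ^ 'd \<Rightarrow> real ^ 'n) \<Rightarrow> (real ^ 'd) set \<Rightarrow> bool" where
  "real_analytic_on f U \<longleftrightarrow>
     (\<forall>a\<in>U. \<exists>(C :: ('d \<Rightarrow> nat) \<Rightarrow> real ^ 'n) r. r > 0 \<and>
        (\<forall>x\<in>ball a r.
           ((\<lambda>\<alpha>. (\<Prod>i\<in>UNIV. (x $ i - a $ i) ^ \<alpha> i) *\<^sub>R C \<alpha>) has_sum f x) UNIV))"

definition affine_orthonormal_frame :: "'a::euclidean_space set \<Rightarrow> 'a \<Rightarrow> 'a set \<Rightarrow> bool" where
  "affine_orthonormal_frame L p B \<longleftrightarrow>
     p \<in> L \<and> pairwise orthogonal B \<and> (\<forall>b\<in>B. norm b = 1) \<and> span B = (\<lambda>y. y - p) ` L"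

definition frame_map :: "'a::euclidean_space \<Rightarrow> 'a set \<Rightarrow> ('a \<Rightarrow> real) \<Rightarrow> 'a" where
  "frame_map p B t = p + (\<Sum>b\<in>B. t b *\<^sub>R b)"

text \<open>Lebesgue measure on a nonempty affine subspace \<open>L\<close>, on the Borel sets of \<open>L\<close>: the image of the
  Lebesgue measure on \<open>\<real>\<^sup>B\<close> under the isometry \<open>t \<mapsto> p + (\<Sum>b\<in>B. t b *\<^sub>R b)\<close> given by a base point
  \<open>p \<in> L\<close> and an orthonormal basis \<open>B\<close> of the direction space of \<open>L\<close>. It does not depend on the frame,
  since Lebesgue measure is invariant under isometries. If \<open>L\<close> is a single point, then
  \<open>B = {}\<close> and this is the unit point mass. Passing to the completion would not change the
  \<open>AE\<close> quantifier.\<close>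

definition affine_lebesgue :: "'a::euclidean_space set \<Rightarrow> 'a measure" where
  "affine_lebesgue L =
     (let (p, B) = (SOME (p, B). affine_orthonormal_frame L p B)
      in distr (\<Pi>\<^sub>M b\<in>B. lborel) (restrict_space borel L) (frame_map p B))"

text \<open>The choice of a frame succeeds, and the frame map is measurable, so that the \<^const>\<open>distr\<close>
  above is a genuine image measure.\<close>

lemma affine_orthonormal_frame_exists:
  fixes L :: "'a::euclidean_space set"
  assumes "affine L" and "L \<noteq> {}"
  shows "\<exists>p B. affine_orthonormal_frame L p B"
proof -
  obtain p where p: "p \<in> L" using assms(2) by blast
  have "subspace ((\<lambda>y. y - p) ` L)"
    using affine_diffs_subspace_subtract[OF assms(1) p] .
  then obtain B where "pairwise orthogonal B" "\<And>x. x \<in> B \<Longrightarrow> norm x = 1"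
      "span B = (\<lambda>y. y - p) ` L"
    by (rule orthonormal_basis_subspace) blast
  with p show ?thesis unfolding affine_orthonormal_frame_def by blast
qed

lemma affine_orthonormal_frame_finite:
  assumes "affine_orthonormal_frame L p B"
  shows "finite B"
  using assms pairwise_orthogonal_imp_finite unfolding affine_orthonormal_frame_def by blast

lemma frame_map_bij:
  assumes "affine_orthonormal_frame L p B"
  shows "bij_betw (frame_map p B) (\<Pi>\<^sub>E b\<in>B. UNIV) L"
proof -
  note fin = affine_orthonormal_frame_finite[OF assms]
  have orth: "b \<bullet> b' = (if b = b' then 1 else 0)" if "b \<in> B" "b' \<in> B" for b b'
    using assms that
    unfolding affine_orthonormal_frame_def pairwise_def orthogonal_def by (auto simp: norm_eq_1)
  have coord: "(\<Sum>b\<in>B. t b *\<^sub>R b) \<bullet> b' = t b'" if "b' \<in> B" for t b'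
  proof -
    have "(\<Sum>b\<in>B. t b *\<^sub>R b) \<bullet> b' = (\<Sum>b\<in>B. if b = b' then t b else 0)"
      unfolding inner_sum_left using that by (intro sum.cong) (auto simp: orth)
    then show ?thesis using that fin by simp
  qed
  have sp: "span B = (\<lambda>y. y - p) ` L"
    using assms unfolding affine_orthonormal_frame_def by blast
  show ?thesis
  proof (rule bij_betw_imageI)
    show "inj_on (frame_map p B) (\<Pi>\<^sub>E b\<in>B. UNIV)"
    proof (rule inj_onI)
      fix s t assume st: "s \<in> (\<Pi>\<^sub>E b\<in>B. UNIV)" "t \<in> (\<Pi>\<^sub>E b\<in>B. UNIV)"
        and eq: "frame_map p B s = frame_map p B t"
      have "s b = t b" if "b \<in> B" for b
        using eq coord[OF that, of s] coord[OF that, of t] unfolding frame_map_def by simp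
      then show "s = t" using st by (metis PiE_ext)
    qed
    show "frame_map p B ` (\<Pi>\<^sub>E b\<in>B. UNIV) = L"
    proof (intro equalityI subsetI)
      fix y assume "y \<in> frame_map p B ` (\<Pi>\<^sub>E b\<in>B. UNIV)"
      then obtain t where y: "y = frame_map p B t" by blast
      have "(\<Sum>b\<in>B. t b *\<^sub>R b) \<in> span B"
        by (intro span_sum span_scale span_base)
      then show "y \<in> L" unfolding sp y frame_map_def by auto
    next
      fix y assume "y \<in> L"
      then have "y - p \<in> span B" unfolding sp by blast
      then obtain u where u: "y - p = (\<Sum>b\<in>B. u b *\<^sub>R b)"
        unfolding span_finite[OF fin] by blast
      have "y = frame_map p B (restrict u B)"
        using u unfolding frame_map_def by (simp add: algebra_simps)
      moreover have "restrict u B \<in> (\<Pi>\<^sub>E b\<in>B. UNIV)" by simp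
      ultimately show "y \<in> frame_map p B ` (\<Pi>\<^sub>E b\<in>B. UNIV)"
        by (simp only: imageI)
    qed
  qed
qed

lemma frame_map_measurable:
  assumes "affine_orthonormal_frame L p B"
  shows "frame_map p B \<in> (\<Pi>\<^sub>M b\<in>B. lborel) \<rightarrow>\<^sub>M restrict_space borel L"
proof (rule measurable_restrict_space2)
  show "frame_map p B \<in> space (\<Pi>\<^sub>M b\<in>B. lborel) \<rightarrow> L"
    using frame_map_bij[OF assms] by (auto simp: space_PiM bij_betw_def)
  show "frame_map p B \<in> borel_measurable (\<Pi>\<^sub>M b\<in>B. lborel)"
    unfolding frame_map_def
  proof (intro borel_measurable_add borel_measurable_const borel_measurable_sum
      borel_measurable_scaleR)
    fix b assume "b \<in> B"
    then have "(\<lambda>t. t b) \<in> (\<Pi>\<^sub>M b\<in>B. lborel) \<rightarrow>\<^sub>M lborel"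
      by (rule measurable_component_singleton)
    then show "(\<lambda>t. t b) \<in> borel_measurable (\<Pi>\<^sub>M b\<in>B. lborel)"
      by simp
  qed
qed

end

theory Submission
  imports Defs
begin

text \<open>The theorem is a zero-one law: either every point of \<open>L\<close> is singular, or almost every
  \<open>f x\<close> is nonsingular, for every nondegenerate analytic \<open>f\<close>; the second statement is the case where
  \<open>f\<close> parametrizes \<open>L\<close> affinely.

  Singularity of \<open>y\<close> says that the lattices \<open>g\<^sub>t u\<^sub>y \<int>\<^sup>n\<^sup>+\<^sup>1\<close> contain arbitrarily short vectors for all large
  \<open>t\<close>. If some \<open>y\<close> in \<open>L\<close> is nonsingular, Minkowski's theorem bounds the covolumes of all rational
  subspaces under \<open>g\<^sub>t u\<^sub>y\<close> from below, for an unbounded set of \<open>t\<close>. The coordinates of these covolumes are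
  affine functions of \<open>y\<close>, so their suprema over any piece of \<open>f U\<close> are bounded below as well. The
  Kleinbock--Margulis nondivergence argument then makes the set of \<open>x\<close> with a short vector at time \<open>t\<close>
  small, uniformly in these \<open>t\<close>. It needs that an affine function of \<open>f\<close> is rarely much smaller than its
  supremum on a small cube. Here any rate suffices, and a pigeonhole argument on
  translates along the direction in which the dominant Taylor part is largest gives one.\<close>

section \<open>Divided differences\<close>

text \<open>Singularity asks for short vectors at all large times, so the singular set lies in the
  liminf of the sets with a short vector at times \<open>t n\<close>, for any sequence
  \<open>t n\<close> tending to infinity. Its measure is at most a common bound for these sets, so
  the unbounded set of times supplied by one nonsingular point suffices and no sum over times
  arises. The bound has a free factor \<open>\<eta>\<close>. The length threshold shrinks with
  \<open>\<eta>\<close>, which is harmless because singular points have vectors shorter than any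
  threshold; this is why no rate is required. The price is uniformity: for given
  \<open>\<eta>\<close>, one scale and one ratio \<open>\<epsilon>\<close> must serve all subspaces
  and all times, hence all affine functions. Dividing by the coefficients does not help when
  \<open>L\<close> is a proper subspace, since a normalized function may be tiny on
  \<open>L\<close>. Each function is instead divided by its supremum over a cube and replaced by one
  with the same values on \<open>L\<close> and bounded coefficients. The same replacement carries a
  bound from the image of a cell to the nonsingular point, which may be anywhere in
  \<open>L\<close>.\<close>

definition divdiff :: "real set \<Rightarrow> (real \<Rightarrow> real) \<Rightarrow> real" where
  "divdiff T g = (\<Sum>t\<in>T. g t / (\<Prod>s\<in>T - {t}. t - s))"

lemma divdiff_add: "divdiff T (\<lambda>t. f t + g t) = divdiff T f + divdiff T g"
  by (simp add: divdiff_def add_divide_distrib sum.distrib)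

lemma divdiff_cmult: "divdiff T (\<lambda>t. c * g t) = c * divdiff T g"
  by (simp add: divdiff_def sum_distrib_left)

lemma divdiff_sum: "divdiff T (\<lambda>t. \<Sum>i\<in>I. g i t) = (\<Sum>i\<in>I. divdiff T (g i))"
  unfolding divdiff_def by (simp add: sum_divide_distrib) (rule sum.swap)

lemma divdiff_mult_linear:
  assumes "finite T" "a \<in> T"
  shows "divdiff T (\<lambda>t. (t - a) * g t) = divdiff (T - {a}) g"
proof -
  have "divdiff T (\<lambda>t. (t - a) * g t) = (\<Sum>t\<in>T - {a}. (t - a) * g t / (\<Prod>s\<in>T - {t}. t - s))"
    unfolding divdiff_def using assms by (subst sum.remove[of _ a]) auto
  also have "\<dots> = (\<Sum>t\<in>T - {a}. g t / (\<Prod>s\<in>T - {a} - {t}. t - s))"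
  proof (rule sum.cong)
    fix t assume t: "t \<in> T - {a}"
    have "(\<Prod>s\<in>T - {t}. t - s) = (t - a) * (\<Prod>s\<in>T - {t} - {a}. t - s)"
      using assms t by (subst prod.remove[of _ a]) auto
    moreover have "T - {t} - {a} = T - {a} - {t}" by auto
    ultimately show "(t - a) * g t / (\<Prod>s\<in>T - {t}. t - s) = g t / (\<Prod>s\<in>T - {a} - {t}. t - s)"
      using t by simp
  qed simp
  finally show ?thesis by (simp add: divdiff_def)
qed

text \<open>The difference of \<open>t - a\<close> and \<open>t - b\<close> is the constant
  \<open>b - a\<close>. Hence \<open>b - a\<close> times the divided difference equals the
  difference of those over \<open>T\<close> without \<open>a\<close> and over \<open>T\<close>
  without \<open>b\<close>; these two sets have the same size, so both values are 0 or both are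
  1.\<close>

lemma divdiff_one:
  assumes "finite T" "T \<noteq> {}"
  shows "divdiff T (\<lambda>t. 1) = (if card T = 1 then 1 else 0)"
  using assms
proof (induction "card T" arbitrary: T rule: less_induct)
  case less
  show ?case
  proof (cases "card T = 1")
    case True
    then obtain a where "T = {a}" by (auto simp: card_1_singleton_iff)
    then show ?thesis by (simp add: divdiff_def)
  next
    case False
    with less.prems obtain a b where ab: "a \<in> T" "b \<in> T" "a \<noteq> b"
      by (metis card_1_singleton_iff card_0_eq is_singletonI' is_singleton_altdef)
    have "card T \<noteq> 0" using less.prems by simp
    have "(b - a) * divdiff T (\<lambda>t. 1) = divdiff T (\<lambda>t. (t - a) * 1) + divdiff T (\<lambda>t. (-1) * ((t - b) * 1))"
      by (subst divdiff_add[symmetric], subst divdiff_cmult[symmetric]) simp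
    also have "\<dots> = divdiff (T - {a}) (\<lambda>t. 1) - divdiff (T - {b}) (\<lambda>t. 1)"
      using divdiff_mult_linear[OF less.prems(1) ab(1), of "\<lambda>t. 1"]
        divdiff_mult_linear[OF less.prems(1) ab(2), of "\<lambda>t. 1"] divdiff_cmult[of T "-1" "\<lambda>t. (t - b) * 1"] by simp
    also have "\<dots> = 0"
    proof -
      have "card T - 1 < card T" using \<open>card T \<noteq> 0\<close> by linarith
      moreover have "card (T - {a}) = card T - 1" "card (T - {b}) = card T - 1"
        "T - {a} \<noteq> {}" "T - {b} \<noteq> {}"
        using ab less.prems \<open>card T \<noteq> 0\<close> by auto
      ultimately have c: "card (T - {a}) = card T - 1" "card (T - {b}) = card T - 1"
        "card T - 1 < card T" "T - {a} \<noteq> {}" "T - {b} \<noteq> {}" by blast+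
      show ?thesis
        using less.hyps[of "T - {a}"] less.hyps[of "T - {b}"] c less.prems by simp
    qed
    finally show ?thesis using ab False by simp
  qed
qed

text \<open>A divided difference over \<open>m + 1\<close> nodes is the leading coefficient of the
  interpolation polynomial. Synthetic division by \<open>t - a\<close> removes the node
  \<open>a\<close> and lowers the degree by one, while the remaining constant is
  annihilated.\<close>

lemma divdiff_poly:
  assumes "finite T" "card T = Suc m" "degree p \<le> m"
  shows "divdiff T (poly p) = coeff p m"
  using assms
proof (induction m arbitrary: T p)
  case 0
  then obtain c where "p = [:c:]" by (metis degree_eq_zeroE le_zero_eq)
  moreover have "T \<noteq> {}" using 0 by auto
  ultimately show ?case
    using divdiff_cmult[of T c "\<lambda>t. 1"] divdiff_one[of T] 0 by (simp add: fun_eq_iff)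
next
  case (Suc m)
  then obtain a where a: "a \<in> T" by fastforce
  define q where "q = synthetic_div p a"
  have p: "p = [:poly p a:] + [:-a, 1:] * q"
    using synthetic_div_correct'[of a p] by (simp add: q_def add.commute)
  have "poly p = (\<lambda>t. poly p a * 1 + (t - a) * poly q t)"
  proof
    fix t
    show "poly p t = poly p a * 1 + (t - a) * poly q t"
      by (subst p) (simp add: algebra_simps)
  qed
  then have "divdiff T (poly p) = divdiff T (\<lambda>t. poly p a * 1 + (t - a) * poly q t)" by simp
  also have "\<dots> = poly p a * divdiff T (\<lambda>t. 1) + divdiff (T - {a}) (poly q)"
    using a Suc.prems by (simp only: divdiff_add divdiff_cmult divdiff_mult_linear)
  also have "divdiff T (\<lambda>t. 1) = 0"
    using divdiff_one[of T] Suc.prems by (metis One_nat_def a empty_iff nat.distinct(1) nat.inject)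
  also have "divdiff (T - {a}) (poly q) = coeff q m"
    using Suc.prems a by (intro Suc.IH) (auto simp: q_def degree_synthetic_div)
  also have "coeff q m = coeff p (Suc m)"
  proof -
    have "degree q \<le> m" using Suc.prems by (auto simp: q_def degree_synthetic_div)
    then have "coeff q (Suc m) = 0" by (simp add: coeff_eq_0)
    then show ?thesis by (subst p) simp
  qed
  finally show ?case by simp
qed

lemma abs_divdiff_le:
  assumes "finite T" "card T = Suc m" "N > 0"
    and "\<And>s t. s \<in> T \<Longrightarrow> t \<in> T \<Longrightarrow> s \<noteq> t \<Longrightarrow> 1 / N \<le> \<bar>t - s\<bar>"
    and "\<And>t. t \<in> T \<Longrightarrow> \<bar>g t\<bar> \<le> B"
  shows "\<bar>divdiff T g\<bar> \<le> (m + 1) * N ^ m * B"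
proof -
  have "\<bar>g t / (\<Prod>s\<in>T - {t}. t - s)\<bar> \<le> N ^ m * B" if t: "t \<in> T" for t
  proof -
    have "(1 / N) ^ m = (\<Prod>s\<in>T - {t}. 1 / N)" using assms t by simp
    also have "\<dots> \<le> (\<Prod>s\<in>T - {t}. \<bar>t - s\<bar>)"
      using assms t by (intro prod_mono) auto
    finally have *: "(1 / N) ^ m \<le> \<bar>\<Prod>s\<in>T - {t}. t - s\<bar>" by (simp add: abs_prod)
    have "B \<ge> 0" using assms(5)[OF t] by linarith
    have "\<bar>g t\<bar> / \<bar>\<Prod>s\<in>T - {t}. t - s\<bar> \<le> B / (1 / N) ^ m"
      using assms(3,5) t * \<open>B \<ge> 0\<close> by (intro frac_le) auto
    then show ?thesis using assms(3) by (simp add: power_one_over field_simps)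
  qed
  then have "\<bar>divdiff T g\<bar> \<le> (\<Sum>t\<in>T. N ^ m * B)"
    unfolding divdiff_def by (intro order_trans[OF sum_abs] sum_mono) auto
  then show ?thesis using assms by (simp add: algebra_simps)
qed

section \<open>Taylor parts of power series\<close>

text \<open>The monomial with exponent \<open>\<alpha>\<close> at \<open>b + t x\<close>, as a
  polynomial in \<open>t\<close>. Its \<open>j\<close>-th coefficient is the homogeneous part of
  degree \<open>j\<close> in \<open>x\<close> of that monomial re-expanded around
  \<open>b\<close>.\<close>

definition shift_poly :: "('d::finite \<Rightarrow> nat) \<Rightarrow> real ^ 'd \<Rightarrow> real ^ 'd \<Rightarrow> real poly" where
  "shift_poly \<alpha> b x = (\<Prod>i\<in>UNIV. [:b $ i, x $ i:] ^ \<alpha> i)"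

lemma poly_shift_poly: "poly (shift_poly \<alpha> b x) t = (\<Prod>i\<in>UNIV. (b $ i + t * x $ i) ^ \<alpha> i)"
  by (simp add: shift_poly_def poly_prod)

lemma degree_shift_poly: "degree (shift_poly \<alpha> b x) \<le> sum \<alpha> UNIV"
proof -
  have "degree ([:b $ i, x $ i:] ^ \<alpha> i) \<le> \<alpha> i" for i
    using degree_power_le[of "[:b $ i, x $ i:]" "\<alpha> i"]
    by (metis degree_pCons_le degree_pCons_0 le_trans mult_le_mono1 mult.commute nat_mult_1 One_nat_def)
  then show ?thesis
    unfolding shift_poly_def
    by (intro order_trans[OF degree_prod_sum_le]) (auto intro!: sum_mono)
qed

lemma shift_poly_scale: "shift_poly \<alpha> b (s *\<^sub>R x) = pcompose (shift_poly \<alpha> b x) [:0, s:]"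
  by (subst poly_eq_poly_eq_iff[symmetric]) (simp add: fun_eq_iff poly_shift_poly poly_pcompose mult_ac)

lemma coeff_shift_poly_scale:
  "coeff (shift_poly \<alpha> b (s *\<^sub>R x)) j = s ^ j * coeff (shift_poly \<alpha> b x) j"
  by (simp add: shift_poly_scale coeff_pcompose_linear)

text \<open>The \<open>j\<close>-th coefficient of \<open>G x\<close> behaves like a homogeneous polynomial of degree \<open>j\<close> in \<open>x\<close>,
  up to terms of lower degree, along every line.\<close>

definition graded :: "(real ^ 'd \<Rightarrow> real poly) \<Rightarrow> bool" where
  "graded G \<longleftrightarrow> (\<forall>j x v. \<exists>p. degree p \<le> j \<and> coeff p j = coeff (G v) j \<and>
     (\<forall>t. coeff (G (x + t *\<^sub>R v)) j = poly p t))"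

lemma graded_one: "graded (\<lambda>x. 1)"
  unfolding graded_def
proof (intro allI)
  fix j :: nat and x v :: "real ^ 'd"
  show "\<exists>p. degree p \<le> j \<and> coeff p j = coeff (1::real poly) j \<and> (\<forall>t::real. coeff (1::real poly) j = poly p t)"
    by (rule exI[of _ "if j = 0 then 1 else 0"]) simp
qed

lemma graded_linear:
  fixes b :: "real ^ 'd"
  shows "graded (\<lambda>x. [:b $ i, x $ i:])"
  unfolding graded_def
proof (intro allI)
  fix j :: nat and x v :: "real ^ 'd"
  show "\<exists>p. degree p \<le> j \<and> coeff p j = coeff [:b $ i, v $ i:] j \<and>
     (\<forall>t. coeff [:b $ i, (x + t *\<^sub>R v) $ i:] j = poly p t)"
    by (rule exI[of _ "if j = 0 then [:b $ i:] else if j = 1 then [:x $ i, v $ i:] else 0"])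
      (auto simp: coeff_pCons split: nat.split)
qed

lemma graded_mult:
  fixes G H :: "real ^ 'd \<Rightarrow> real poly"
  assumes "graded G" "graded H"
  shows "graded (\<lambda>x. G x * H x)"
  unfolding graded_def
proof (intro allI)
  fix j :: nat and x v :: "real ^ 'd"
  obtain p where p: "\<And>i. degree (p i) \<le> i" "\<And>i. coeff (p i) i = coeff (G v) i"
      "\<And>i t. coeff (G (x + t *\<^sub>R v)) i = poly (p i) t"
    using assms(1)[unfolded graded_def, rule_format, of _ v x] by metis
  obtain q where q: "\<And>i. degree (q i) \<le> i" "\<And>i. coeff (q i) i = coeff (H v) i"
      "\<And>i t. coeff (H (x + t *\<^sub>R v)) i = poly (q i) t"
    using assms(2)[unfolded graded_def, rule_format, of _ v x] by metis
  \<comment> \<open>Of the convolution only \<open>l = i\<close> survives: for \<open>l > i\<close>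
    the first factor vanishes, and for \<open>l < i\<close> the index \<open>j - l\<close> exceeds
    the degree of the second.\<close>
  have top: "coeff (p i * q (j - i)) j = coeff (p i) i * coeff (q (j - i)) (j - i)" if "i \<le> j" for i
  proof -
    have "coeff (p i * q (j - i)) j = (\<Sum>l\<le>j. coeff (p i) l * coeff (q (j - i)) (j - l))"
      by (rule coeff_mult)
    also have "\<dots> = (\<Sum>l\<in>{i}. coeff (p i) l * coeff (q (j - i)) (j - l))"
    proof (rule sum.mono_neutral_right)
      show "\<forall>l\<in>{..j} - {i}. coeff (p i) l * coeff (q (j - i)) (j - l) = 0"
      proof
        fix l assume "l \<in> {..j} - {i}"
        then consider "i < l" | "j - i < j - l" using \<open>i \<le> j\<close> by fastforce
        then show "coeff (p i) l * coeff (q (j - i)) (j - l) = 0"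
          by cases (metis coeff_eq_0 p(1) q(1) le_less_trans mult_eq_0_iff)+
      qed
    qed (use that in auto)
    finally show ?thesis by simp
  qed
  show "\<exists>r. degree r \<le> j \<and> coeff r j = coeff (G v * H v) j \<and>
     (\<forall>t. coeff (G (x + t *\<^sub>R v) * H (x + t *\<^sub>R v)) j = poly r t)"
  proof (intro exI conjI allI)
    let ?r = "\<Sum>i\<le>j. p i * q (j - i)"
    show "degree ?r \<le> j"
    proof (rule degree_sum_le)
      fix i assume "i \<in> {..j}"
      then show "degree (p i * q (j - i)) \<le> j"
        using degree_mult_le[of "p i" "q (j - i)"] p(1)[of i] q(1)[of "j - i"] by simp
    qed simp
    show "coeff ?r j = coeff (G v * H v) j"
    proof -
      have "coeff ?r j = (\<Sum>i\<le>j. coeff (p i) i * coeff (q (j - i)) (j - i))"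
        unfolding coeff_sum by (rule sum.cong) (auto simp: top)
      then show ?thesis by (simp add: coeff_mult p q)
    qed
    show "coeff (G (x + t *\<^sub>R v) * H (x + t *\<^sub>R v)) j = poly ?r t" for t
      by (simp add: coeff_mult p q poly_sum)
  qed
qed

lemma graded_power: "graded G \<Longrightarrow> graded (\<lambda>x. G x ^ n)"
  by (induction n) (auto intro: graded_one graded_mult)

lemma graded_prod: "finite I \<Longrightarrow> (\<And>i. i \<in> I \<Longrightarrow> graded (G i)) \<Longrightarrow> graded (\<lambda>x. \<Prod>i\<in>I. G i x)"
  by (induction I rule: finite_induct) (auto intro: graded_one graded_mult)

lemma graded_shift_poly: "graded (shift_poly \<alpha> b)"
  unfolding shift_poly_def[abs_def] by (intro graded_prod graded_power graded_linear) simp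

text \<open>Along the line \<open>x + t v\<close> the part of degree \<open>j\<close> is a
  polynomial in \<open>t\<close> of degree at most \<open>j\<close> whose coefficient of
  \<open>t ^ j\<close> is its value at \<open>v\<close>. Over \<open>m + 1\<close> nodes the parts
  below \<open>m\<close> are therefore annihilated, and part \<open>m\<close> yields its value at
  \<open>v\<close>, wherever the line starts.\<close>

lemma divdiff_shift_poly:
  assumes "finite T" "card T = Suc m" "j \<le> m"
  shows "divdiff T (\<lambda>t. coeff (shift_poly \<alpha> b (x + t *\<^sub>R v)) j)
    = (if j = m then coeff (shift_poly \<alpha> b v) m else 0)"
proof -
  obtain p where p: "degree p \<le> j" "coeff p j = coeff (shift_poly \<alpha> b v) j"
      "\<And>t. coeff (shift_poly \<alpha> b (x + t *\<^sub>R v)) j = poly p t"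
    using graded_shift_poly[of \<alpha> b] unfolding graded_def by metis
  have "divdiff T (\<lambda>t. coeff (shift_poly \<alpha> b (x + t *\<^sub>R v)) j) = coeff p m"
    using divdiff_poly[OF assms(1,2), of p] assms p by simp
  then show ?thesis using p assms by (auto simp: coeff_eq_0)
qed

section \<open>Majorants, Taylor parts and remainders\<close>

definition coeffs_dominated :: "real poly \<Rightarrow> real poly \<Rightarrow> bool" where
  "coeffs_dominated p q \<longleftrightarrow> (\<forall>j. \<bar>coeff p j\<bar> \<le> coeff q j)"

lemma coeffs_dominated_mult:
  assumes "coeffs_dominated p p'" "coeffs_dominated q q'"
  shows "coeffs_dominated (p * q) (p' * q')"
  unfolding coeffs_dominated_def
proof
  fix j
  have "\<bar>coeff (p * q) j\<bar> \<le> (\<Sum>i\<le>j. \<bar>coeff p i\<bar> * \<bar>coeff q (j - i)\<bar>)"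
    unfolding coeff_mult abs_mult[symmetric] by (rule sum_abs)
  also have "\<dots> \<le> coeff (p' * q') j"
    unfolding coeff_mult using assms unfolding coeffs_dominated_def
    by (intro sum_mono mult_mono) (auto intro: order_trans[OF abs_ge_zero])
  finally show "\<bar>coeff (p * q) j\<bar> \<le> coeff (p' * q') j" .
qed

lemma coeffs_dominated_one: "coeffs_dominated 1 1"
  by (simp add: coeffs_dominated_def)

lemma coeffs_dominated_power: "coeffs_dominated p q \<Longrightarrow> coeffs_dominated (p ^ n) (q ^ n)"
  by (induction n) (auto intro: coeffs_dominated_one coeffs_dominated_mult)

lemma coeffs_dominated_prod:
  "finite I \<Longrightarrow> (\<And>i. i \<in> I \<Longrightarrow> coeffs_dominated (p i) (q i)) \<Longrightarrow>
    coeffs_dominated (\<Prod>i\<in>I. p i) (\<Prod>i\<in>I. q i)"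
  by (induction I rule: finite_induct) (auto intro: coeffs_dominated_one coeffs_dominated_mult)

text \<open>Majorization by powers of \<open>r / 2 + s t\<close> reduces the monomial to a power of
  one linear polynomial. The binomial coefficients cost at most a factor 2 per degree, which is
  absorbed by keeping \<open>b\<close> within \<open>r / 2\<close> instead of
  \<open>r\<close>.\<close>

lemma abs_coeff_shift_poly:
  assumes "\<And>i. \<bar>b $ i\<bar> \<le> r / 2" "\<And>i. \<bar>x $ i\<bar> \<le> s" "r > 0"
  shows "\<bar>coeff (shift_poly \<alpha> b x) j\<bar> \<le> r ^ sum \<alpha> UNIV * (2 * s / r) ^ j"
proof -
  let ?n = "sum \<alpha> UNIV"
  have s: "s \<ge> 0" using assms(2) by (meson abs_ge_zero order_trans)
  have "coeffs_dominated (shift_poly \<alpha> b x) (\<Prod>i\<in>UNIV. [:r / 2, s:] ^ \<alpha> i)"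
    unfolding shift_poly_def
    using assms by (intro coeffs_dominated_prod coeffs_dominated_power)
      (auto simp: coeffs_dominated_def coeff_pCons split: nat.split)
  then have "coeffs_dominated (shift_poly \<alpha> b x) ([:r / 2, s:] ^ ?n)"
    by (simp add: power_sum)
  then have le: "\<bar>coeff (shift_poly \<alpha> b x) j\<bar> \<le> coeff ([:r / 2, s:] ^ ?n) j"
    by (auto simp: coeffs_dominated_def)
  show ?thesis
  proof (cases "j \<le> ?n")
    case True
    have "real (?n choose j) \<le> 2 ^ ?n"
      using binomial_le_pow2[of ?n j] by (metis of_nat_le_iff of_nat_numeral of_nat_power)
    have "coeff ([:r / 2, s:] ^ ?n) j = real (?n choose j) * (s ^ j * (r / 2) ^ (?n - j))"
      using True by (simp add: coeff_linear_poly_power)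
    also have "\<dots> \<le> 2 ^ ?n * (s ^ j * (r / 2) ^ (?n - j))"
      using \<open>real (?n choose j) \<le> 2 ^ ?n\<close> s assms by (intro mult_right_mono) auto
    also have "\<dots> = r ^ ?n * (2 * s / r) ^ j"
    proof -
      have "(r / 2) ^ ?n = (r / 2) ^ j * (r / 2) ^ (?n - j)"
        using True by (simp flip: power_add)
      then have "r ^ ?n = 2 ^ ?n * (r / 2) ^ j * (r / 2) ^ (?n - j)"
        by (simp add: power_divide field_simps)
      moreover have "(r / 2) ^ j * (2 * s / r) ^ j = s ^ j"
        using assms by (simp flip: power_mult_distrib)
      ultimately show ?thesis by (simp add: mult_ac)
    qed
    finally show ?thesis using le by simp
  next
    case False
    then have "coeff (shift_poly \<alpha> b x) j = 0"
      using degree_shift_poly[of \<alpha> b x] by (intro coeff_eq_0) simp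
    then show ?thesis using s assms by simp
  qed
qed

lemma poly_1_eq_sum_coeff:
  assumes "degree p \<le> n"
  shows "poly p (1::real) = (\<Sum>j\<le>n. coeff p j)"
  using assms by (simp add: poly_altdef) (rule sum.mono_neutral_left, auto simp: coeff_eq_0)

lemma sum_power_tail_le:
  fixes q :: real
  assumes "0 \<le> q" "q \<le> 1 / 2"
  shows "(\<Sum>j\<in>{k..<n}. q ^ j) \<le> 2 * q ^ k"
proof -
  \<comment> \<open>The subtracted term makes the bound inductive.\<close>
  have "(\<Sum>j\<in>{k..<n}. q ^ j) \<le> 2 * q ^ k - 2 * q ^ n" if "k \<le> n"
    using that
  proof (induction n rule: dec_induct)
    case (step n)
    have "q ^ n * q \<le> q ^ n * (1 / 2)" using assms by (intro mult_left_mono) auto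
    then show ?case using step by (simp add: mult.commute)
  qed simp
  moreover have "0 \<le> q ^ n" "0 \<le> q ^ k" using assms by auto
  ultimately show ?thesis by (cases "k \<le> n") auto
qed

lemma abs_shift_poly_remainder:
  assumes "\<And>i. \<bar>b $ i\<bar> \<le> r / 2" "\<And>i. \<bar>x $ i\<bar> \<le> s" "r > 0" "s \<le> r / 4"
  shows "\<bar>(\<Prod>i\<in>UNIV. (b $ i + x $ i) ^ \<alpha> i) - (\<Sum>j\<le>M. coeff (shift_poly \<alpha> b x) j)\<bar>
    \<le> r ^ sum \<alpha> UNIV * (2 * (2 * s / r) ^ Suc M)"
proof -
  \<comment> \<open>\<open>M\<close> may exceed the degree of the monomial; with the maximum, the
    tail is then simply empty.\<close>
  let ?n = "max M (sum \<alpha> UNIV)" and ?p = "shift_poly \<alpha> b x"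
  have s: "s \<ge> 0" using assms(2) by (meson abs_ge_zero order_trans)
  have "(\<Prod>i\<in>UNIV. (b $ i + x $ i) ^ \<alpha> i) = poly ?p 1" by (simp add: poly_shift_poly)
  also have "\<dots> = (\<Sum>j\<le>?n. coeff ?p j)"
    using degree_shift_poly[of \<alpha> b x] by (intro poly_1_eq_sum_coeff) simp
  also have "\<dots> = (\<Sum>j\<le>M. coeff ?p j) + (\<Sum>j\<in>{Suc M..<Suc ?n}. coeff ?p j)"
    by (subst sum.union_disjoint[symmetric]) (auto intro!: sum.cong)
  finally have "\<bar>(\<Prod>i\<in>UNIV. (b $ i + x $ i) ^ \<alpha> i) - (\<Sum>j\<le>M. coeff ?p j)\<bar>
      = \<bar>\<Sum>j\<in>{Suc M..<Suc ?n}. coeff ?p j\<bar>" by simp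
  also have "\<dots> \<le> (\<Sum>j\<in>{Suc M..<Suc ?n}. r ^ sum \<alpha> UNIV * (2 * s / r) ^ j)"
    using abs_coeff_shift_poly[OF assms(1-3)] by (intro order_trans[OF sum_abs] sum_mono) auto
  also have "\<dots> = r ^ sum \<alpha> UNIV * (\<Sum>j\<in>{Suc M..<Suc ?n}. (2 * s / r) ^ j)"
    by (rule sum_distrib_left[symmetric])
  also have "\<dots> \<le> r ^ sum \<alpha> UNIV * (2 * (2 * s / r) ^ Suc M)"
    using assms s by (intro mult_left_mono sum_power_tail_le) (auto simp: field_simps)
  finally show ?thesis .
qed

text \<open>For the power series with coefficients \<open>c\<close>, this is the homogeneous part of
  degree \<open>j\<close> of its expansion around the point with displacement \<open>b\<close> from
  the centre. Monomials are re-expanded one at a time, which avoids rearranging a double series into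
  multi-indices.\<close>

definition taylor_part ::
    "(('d::finite \<Rightarrow> nat) \<Rightarrow> real) \<Rightarrow> real ^ 'd \<Rightarrow> nat \<Rightarrow> real ^ 'd \<Rightarrow> real" where
  "taylor_part c b j x = (\<Sum>\<^sub>\<infinity>\<alpha>. c \<alpha> * coeff (shift_poly \<alpha> b x) j)"

lemma abs_summable_dominated:
  fixes c w :: "'a \<Rightarrow> real"
  assumes "(\<lambda>\<alpha>. \<bar>c \<alpha>\<bar> * w \<alpha>) summable_on UNIV" "infsum (\<lambda>\<alpha>. \<bar>c \<alpha>\<bar> * w \<alpha>) UNIV \<le> A"
    and "\<And>\<alpha>. \<bar>h \<alpha>\<bar> \<le> w \<alpha> * B" "B \<ge> 0"
  shows "(\<lambda>\<alpha>. c \<alpha> * h \<alpha>) summable_on UNIV" "\<bar>\<Sum>\<^sub>\<infinity>\<alpha>. c \<alpha> * h \<alpha>\<bar> \<le> A * B"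
proof -
  have s: "(\<lambda>\<alpha>. \<bar>c \<alpha>\<bar> * w \<alpha> * B) summable_on UNIV"
    using assms(1) by (rule summable_on_cmult_left)
  have le: "\<bar>c \<alpha> * h \<alpha>\<bar> \<le> \<bar>c \<alpha>\<bar> * w \<alpha> * B" for \<alpha>
    using mult_left_mono[OF assms(3), of "\<bar>c \<alpha>\<bar>"] by (simp add: abs_mult mult.assoc)
  show *: "(\<lambda>\<alpha>. c \<alpha> * h \<alpha>) summable_on UNIV"
    by (subst summable_on_iff_abs_summable_on_real, rule Infinite_Sum.abs_summable_on_comparison_test'[OF s]) (simp only: real_norm_def le)
  have "norm (\<Sum>\<^sub>\<infinity>\<alpha>. c \<alpha> * h \<alpha>) \<le> (\<Sum>\<^sub>\<infinity>\<alpha>. \<bar>c \<alpha>\<bar> * w \<alpha> * B)"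
    by (rule norm_infsum_le[OF has_sum_infsum[OF *] has_sum_infsum[OF s]]) (simp only: real_norm_def le)
  also have "\<dots> = (\<Sum>\<^sub>\<infinity>\<alpha>. \<bar>c \<alpha>\<bar> * w \<alpha>) * B" by (rule infsum_cmult_left')
  also have "\<dots> \<le> A * B" using assms by (intro mult_right_mono)
  finally show "\<bar>\<Sum>\<^sub>\<infinity>\<alpha>. c \<alpha> * h \<alpha>\<bar> \<le> A * B" by simp
qed

lemma has_sum_sum:
  fixes f :: "'i \<Rightarrow> 'a \<Rightarrow> 'b::topological_comm_monoid_add"
  assumes "finite I" "\<And>i. i \<in> I \<Longrightarrow> (f i has_sum s i) A"
  shows "((\<lambda>x. \<Sum>i\<in>I. f i x) has_sum (\<Sum>i\<in>I. s i)) A"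
  using assms
proof (induction I rule: finite_induct)
  case (insert i I)
  have "((\<lambda>x. f i x + (\<Sum>i\<in>I. f i x)) has_sum (s i + (\<Sum>i\<in>I. s i))) A"
    using insert.prems by (intro has_sum_add insert.IH) auto
  then show ?case using insert.hyps by simp
qed simp

lemma infsum_sum_real:
  fixes f :: "'i \<Rightarrow> 'a \<Rightarrow> real"
  assumes "finite I" "\<And>i. i \<in> I \<Longrightarrow> (f i) summable_on UNIV"
  shows "(\<Sum>\<^sub>\<infinity>x. \<Sum>i\<in>I. f i x) = (\<Sum>i\<in>I. infsum (f i) UNIV)"
  using assms by (intro infsumI has_sum_sum has_sum_infsum)

text \<open>The estimates see the coefficients only through \<open>r\<close> and \<open>A\<close>.
  Constants built from these two numbers are therefore uniform over all affine functions of
  \<open>f\<close> with bounded coefficients.\<close>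

locale scaled_series =
  fixes c :: "('d::finite \<Rightarrow> nat) \<Rightarrow> real" and r A :: real
  assumes r_pos: "r > 0"
    and summ: "(\<lambda>\<alpha>. \<bar>c \<alpha>\<bar> * r ^ sum \<alpha> UNIV) summable_on UNIV"
    and A_ge: "(\<Sum>\<^sub>\<infinity>\<alpha>. \<bar>c \<alpha>\<bar> * r ^ sum \<alpha> UNIV) \<le> A"
begin

lemma A_nonneg: "A \<ge> 0"
proof -
  have "0 \<le> (\<Sum>\<^sub>\<infinity>\<alpha>. \<bar>c \<alpha>\<bar> * r ^ sum \<alpha> UNIV)"
    using r_pos by (intro infsum_nonneg) simp
  then show ?thesis using A_ge by linarith
qed

lemma taylor_part_summable:
  assumes "\<And>i. \<bar>b $ i\<bar> \<le> r / 2"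
  shows "(\<lambda>\<alpha>. c \<alpha> * coeff (shift_poly \<alpha> b x) j) summable_on UNIV"
proof -
  have "\<bar>x $ i\<bar> \<le> infnorm x" for i by (rule component_le_infnorm_cart)
  then show ?thesis
    using abs_coeff_shift_poly[OF assms, of x "infnorm x"] r_pos
    by (intro abs_summable_dominated(1)[OF summ A_ge, of _ "(2 * infnorm x / r) ^ j"])
      (auto simp: infnorm_pos_le)
qed

lemma abs_taylor_part:
  assumes "\<And>i. \<bar>b $ i\<bar> \<le> r / 2" "\<And>i. \<bar>x $ i\<bar> \<le> s"
  shows "\<bar>taylor_part c b j x\<bar> \<le> A * (2 * s / r) ^ j"
proof -
  have "s \<ge> 0" using assms(2) by (meson abs_ge_zero order_trans)
  then show ?thesis
    unfolding taylor_part_def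
    using abs_coeff_shift_poly[OF assms] r_pos
    by (intro abs_summable_dominated(2)[OF summ A_ge]) auto
qed

lemma taylor_part_scale: "taylor_part c b j (s *\<^sub>R x) = s ^ j * taylor_part c b j x"
proof -
  have "taylor_part c b j (s *\<^sub>R x) = (\<Sum>\<^sub>\<infinity>\<alpha>. s ^ j * (c \<alpha> * coeff (shift_poly \<alpha> b x) j))"
    unfolding taylor_part_def by (simp add: coeff_shift_poly_scale mult_ac)
  then show ?thesis by (simp add: taylor_part_def infsum_cmult_right')
qed

lemma taylor_part_0_scale: "taylor_part c b 0 x = taylor_part c b 0 0"
  using taylor_part_scale[of b 0 0 x] by simp

lemma divdiff_taylor_part:
  assumes "\<And>i. \<bar>b $ i\<bar> \<le> r / 2" "finite T" "card T = Suc m" "j \<le> m"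
  shows "divdiff T (\<lambda>t. taylor_part c b j (x + t *\<^sub>R v)) = (if j = m then taylor_part c b m v else 0)"
proof -
  let ?g = "\<lambda>\<alpha> t. coeff (shift_poly \<alpha> b (x + t *\<^sub>R v)) j"
  have "divdiff T (\<lambda>t. taylor_part c b j (x + t *\<^sub>R v))
      = (\<Sum>t\<in>T. \<Sum>\<^sub>\<infinity>\<alpha>. c \<alpha> * ?g \<alpha> t / (\<Prod>s\<in>T - {t}. t - s))"
    unfolding divdiff_def taylor_part_def
    by (simp add: divide_inverse infsum_cmult_left')
  also have "\<dots> = (\<Sum>\<^sub>\<infinity>\<alpha>. \<Sum>t\<in>T. c \<alpha> * ?g \<alpha> t / (\<Prod>s\<in>T - {t}. t - s))"
    using assms(2) taylor_part_summable[OF assms(1)]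
    by (intro infsum_sum_real[symmetric]) (auto simp: divide_inverse intro: summable_on_cmult_left)
  also have "\<dots> = (\<Sum>\<^sub>\<infinity>\<alpha>. c \<alpha> * divdiff T (?g \<alpha>))"
    by (simp add: divdiff_def sum_distrib_left)
  also have "\<dots> = (if j = m then taylor_part c b m v else 0)"
    using assms by (simp add: divdiff_shift_poly taylor_part_def)
  finally show ?thesis .
qed

lemma taylor_remainder:
  assumes "\<And>i. \<bar>b $ i\<bar> \<le> r / 2" "\<And>i. \<bar>x $ i\<bar> \<le> s" "s \<le> r / 4"
    and F: "((\<lambda>\<alpha>. c \<alpha> * (\<Prod>i\<in>UNIV. (b $ i + x $ i) ^ \<alpha> i)) has_sum F) UNIV"
  shows "\<bar>F - (\<Sum>j\<le>M. taylor_part c b j x)\<bar> \<le> A * (2 * (2 * s / r) ^ Suc M)"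
proof -
  let ?h = "\<lambda>\<alpha>. (\<Prod>i\<in>UNIV. (b $ i + x $ i) ^ \<alpha> i) - (\<Sum>j\<le>M. coeff (shift_poly \<alpha> b x) j)"
  have s: "s \<ge> 0" using assms(2) by (meson abs_ge_zero order_trans)
  have "((\<lambda>\<alpha>. \<Sum>j\<le>M. c \<alpha> * coeff (shift_poly \<alpha> b x) j) has_sum
      (\<Sum>j\<le>M. taylor_part c b j x)) UNIV"
    unfolding taylor_part_def using taylor_part_summable[OF assms(1)]
    by (intro has_sum_sum has_sum_infsum) simp
  from has_sum_add[OF F has_sum_uminusI[OF this]]
  have "((\<lambda>\<alpha>. c \<alpha> * ?h \<alpha>) has_sum (F - (\<Sum>j\<le>M. taylor_part c b j x))) UNIV"
    by (simp add: right_diff_distrib sum_distrib_left)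
  then have "F - (\<Sum>j\<le>M. taylor_part c b j x) = (\<Sum>\<^sub>\<infinity>\<alpha>. c \<alpha> * ?h \<alpha>)"
    by (simp add: infsumI)
  also have "\<bar>\<dots>\<bar> \<le> A * (2 * (2 * s / r) ^ Suc M)"
    using abs_shift_poly_remainder[OF assms(1,2) r_pos assms(3)] s r_pos
    by (intro abs_summable_dominated(2)[OF summ A_ge]) auto
  finally show ?thesis .
qed

end

section \<open>Nondivergence on dyadic cells\<close>

text \<open>The half-open dyadic cube of side \<open>(1 / 2) ^ l\<close>, named by any of its
  points. The cells of one level partition the space and each level refines the previous one, so two
  cells are nested or disjoint.\<close>

definition dcell :: "nat \<Rightarrow> real ^ 'd \<Rightarrow> (real ^ 'd) set" where
  "dcell l x = {y. \<forall>i. \<lfloor>2 ^ l * y $ i\<rfloor> = \<lfloor>2 ^ l * x $ i\<rfloor>}"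

lemma dcell_self [simp]: "x \<in> dcell l x"
  by (simp add: dcell_def)

lemma dcell_eq: "y \<in> dcell l x \<Longrightarrow> dcell l y = dcell l x"
  by (auto simp: dcell_def)

lemma dcell_Suc_subset: "dcell (Suc l) x \<subseteq> dcell l x"
proof
  fix y assume y: "y \<in> dcell (Suc l) x"
  \<comment> \<open>The floor of \<open>2 * u\<close> determines the floor of \<open>u\<close>; the
    inequality is used in both directions.\<close>
  have "\<lfloor>u\<rfloor> \<le> \<lfloor>v\<rfloor>" if "\<lfloor>2 * u\<rfloor> = \<lfloor>2 * v\<rfloor>" for u v :: real
  proof -
    have "2 * \<lfloor>u\<rfloor> \<le> \<lfloor>2 * u\<rfloor>" by (simp add: le_floor_iff)
    then have "2 * \<lfloor>u\<rfloor> \<le> \<lfloor>2 * v\<rfloor>" using that by simp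
    then show ?thesis by (simp add: le_floor_iff)
  qed
  then have fl: "\<lfloor>u\<rfloor> = \<lfloor>v\<rfloor>" if "\<lfloor>2 * u\<rfloor> = \<lfloor>2 * v\<rfloor>" for u v :: real
    using that that[symmetric] by (intro order_antisym) blast+
  show "y \<in> dcell l x"
    unfolding dcell_def
  proof (intro CollectI allI, rule fl)
    fix i
    have "\<lfloor>2 ^ Suc l * y $ i\<rfloor> = \<lfloor>2 ^ Suc l * x $ i\<rfloor>" using y unfolding dcell_def by blast
    then show "\<lfloor>2 * (2 ^ l * y $ i)\<rfloor> = \<lfloor>2 * (2 ^ l * x $ i)\<rfloor>"
      by (simp only: power_Suc mult.assoc)
  qed
qed

lemma dcell_mono: "l \<le> m \<Longrightarrow> dcell m x \<subseteq> dcell l x"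
  by (induction m rule: dec_induct) (use dcell_Suc_subset in blast)+

lemma dcell_close:
  assumes "y \<in> dcell l x"
  shows "\<bar>y $ i - x $ i\<bar> \<le> (1 / 2) ^ l"
proof -
  have "\<lfloor>2 ^ l * y $ i\<rfloor> = \<lfloor>2 ^ l * x $ i\<rfloor>" using assms by (simp add: dcell_def)
  then have "\<bar>2 ^ l * y $ i - 2 ^ l * x $ i\<bar> \<le> 1" by linarith
  then have "2 ^ l * \<bar>y $ i - x $ i\<bar> \<le> 1" by (simp add: abs_mult flip: right_diff_distrib)
  then show ?thesis by (simp add: power_one_over field_simps)
qed

lemma dcell_borel [measurable]: "dcell l (x :: real ^ 'd) \<in> sets borel"
proof -
  have "{y :: real ^ 'd \<in> space borel. \<forall>i. \<lfloor>2 ^ l * y $ i\<rfloor> = \<lfloor>2 ^ l * x $ i\<rfloor>} \<in> sets borel"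
    by measurable
  then show ?thesis by (simp add: dcell_def)
qed

lemma dcell_lebesgue [measurable]: "dcell l x \<in> sets lebesgue"
  by (simp add: sets_completionI_sets)

text \<open>The half-open cell lies between an open and a closed box of equal measure.\<close>

lemma emeasure_dcell:
  "emeasure lebesgue (dcell l (x :: real ^ 'd)) = ennreal ((1 / 2) ^ (l * CARD('d)))"
proof -
  define a b :: "real ^ 'd" where "a = (\<chi> i. of_int \<lfloor>2 ^ l * x $ i\<rfloor> / 2 ^ l)"
    and "b = (\<chi> i. (of_int \<lfloor>2 ^ l * x $ i\<rfloor> + 1) / 2 ^ l)"
  have ab: "a $ i < b $ i" "b $ i - a $ i = (1 / 2) ^ l" for i
    by (auto simp: a_def b_def field_simps)
  have sub: "box a b \<subseteq> dcell l x" "dcell l x \<subseteq> cbox a b"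
  proof -
    show "box a b \<subseteq> dcell l x"
    proof
      fix y assume "y \<in> box a b"
      then have "a $ i < y $ i" "y $ i < b $ i" for i by (auto simp: mem_box_cart)
      then have "of_int \<lfloor>2 ^ l * x $ i\<rfloor> < 2 ^ l * y $ i \<and> 2 ^ l * y $ i < of_int \<lfloor>2 ^ l * x $ i\<rfloor> + 1" for i
        by (auto simp: a_def b_def field_simps)
      then show "y \<in> dcell l x"
        unfolding dcell_def by (intro CollectI allI) (simp add: floor_eq_iff less_imp_le)
    qed
    show "dcell l x \<subseteq> cbox a b"
    proof
      fix y assume "y \<in> dcell l x"
      then have "of_int \<lfloor>2 ^ l * x $ i\<rfloor> \<le> 2 ^ l * y $ i \<and> 2 ^ l * y $ i \<le> of_int \<lfloor>2 ^ l * x $ i\<rfloor> + 1" for i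
        unfolding dcell_def by (auto simp: floor_eq_iff less_imp_le dest!: spec[of _ i])
      then show "y \<in> cbox a b"
        by (auto simp: mem_box_cart a_def b_def field_simps)
    qed
  qed
  have c: "emeasure lebesgue (cbox a b) = ennreal ((1 / 2) ^ (l * CARD('d)))"
  proof -
    have "emeasure lborel (cbox a b) = ennreal (measure lborel (cbox a b))"
      by (simp add: emeasure_eq_measure2 fmeasurable_cbox emeasure_lborel_cbox_finite less_top[symmetric])
    moreover have "measure lborel (cbox a b) = (\<Prod>i\<in>UNIV. b $ i - a $ i)"
      using ab by (intro content_cbox_cart) (simp add: interval_ne_empty_cart less_imp_le)
    ultimately show ?thesis by (simp add: ab power_mult)
  qed
  have d: "emeasure lebesgue (box a b) = emeasure lebesgue (cbox a b)"
    by (simp add: emeasure_lborel_box_eq emeasure_lborel_cbox_eq)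
  show ?thesis
    using emeasure_mono[OF sub(1), of lebesgue] emeasure_mono[OF sub(2), of lebesgue] c d
    by (simp add: sets_completionI_sets)
qed

lemma emeasure_dcell_parent:
  "emeasure lebesgue (dcell l (x :: real ^ 'd))
    = ennreal (2 ^ CARD('d)) * emeasure lebesgue (dcell (Suc l) (y :: real ^ 'd))"
  by (simp add: emeasure_dcell power_add power_one_over field_simps flip: ennreal_mult)

lemma countable_dcells: "countable (range (\<lambda>(l, x :: real ^ 'd). dcell l x))"
proof (rule countable_subset)
  show "range (\<lambda>(l, x :: real ^ 'd). dcell l x)
      \<subseteq> range (\<lambda>(l, z :: 'd \<Rightarrow> int). {y. \<forall>i. \<lfloor>2 ^ l * y $ i\<rfloor> = z i})"
    by (force simp: dcell_def)
qed (rule countable_image, simp)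

text \<open>Disjointness lets a relative bound on each piece add up, without loss, to the same
  relative bound on the set containing them all.\<close>

lemma emeasure_pieces_le:
  assumes "countable \<C>" "disjoint \<C>" "Q \<in> sets M" "\<Union>\<C> \<subseteq> Q"
    and "\<And>C. C \<in> \<C> \<Longrightarrow> C \<in> sets M" "\<And>C. C \<in> \<C> \<Longrightarrow> B C \<in> sets M"
    and "\<And>C. C \<in> \<C> \<Longrightarrow> emeasure M (B C \<inter> C) \<le> K * emeasure M C"
  shows "(\<Union>C\<in>\<C>. B C \<inter> C) \<in> sets M" "emeasure M (\<Union>C\<in>\<C>. B C \<inter> C) \<le> K * emeasure M Q"
proof -
  have disj: "disjoint_family_on (\<lambda>C. C) \<C>" "disjoint_family_on (\<lambda>C. B C \<inter> C) \<C>"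
    using assms(2) by (auto simp: disjoint_family_on_def disjoint_def)
  show "(\<Union>C\<in>\<C>. B C \<inter> C) \<in> sets M"
    using assms by (intro sets.countable_UN') auto
  have "emeasure M (\<Union>C\<in>\<C>. B C \<inter> C) = (\<integral>\<^sup>+C. emeasure M (B C \<inter> C) \<partial>count_space \<C>)"
    using assms disj by (intro emeasure_UN_countable) auto
  also have "\<dots> \<le> (\<integral>\<^sup>+C. K * emeasure M C \<partial>count_space \<C>)"
    using assms by (intro nn_integral_mono) auto
  also have "\<dots> = K * (\<integral>\<^sup>+C. emeasure M C \<partial>count_space \<C>)"
    by (rule nn_integral_cmult) simp
  also have "(\<integral>\<^sup>+C. emeasure M C \<partial>count_space \<C>) = emeasure M (\<Union>C\<in>\<C>. C)"
    using assms disj by (intro emeasure_UN_countable[symmetric]) auto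
  also have "K * emeasure M (\<Union>C\<in>\<C>. C) \<le> K * emeasure M Q"
    using assms by (intro mult_left_mono emeasure_mono) auto
  finally show "emeasure M (\<Union>C\<in>\<C>. B C \<inter> C) \<le> K * emeasure M Q" .
qed

text \<open>The loss factor when \<open>s\<close> more members may be added to the flag. On a parent
  cell the bad set is the one for \<open>s\<close> steps together with one sublevel set, hence the
  summand 1; \<open>D\<close> is the measure of a parent cell relative to its child.\<close>

primrec nondiv_const :: "real \<Rightarrow> nat \<Rightarrow> real" where
  "nondiv_const D 0 = 0"
| "nondiv_const D (Suc s) = D * (nondiv_const D s + 1)"

lemma nondiv_const_nonneg: "D \<ge> 0 \<Longrightarrow> nondiv_const D s \<ge> 0"
  by (induction s) auto

text \<open>Abstract flags: in the application \<open>P\<close> consists of the nonzero rational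
  subspaces, \<open>cmp\<close> is comparability under inclusion, and the completions are the
  subspaces by which a flag can be refined.\<close>

definition clique :: "('w \<Rightarrow> 'w \<Rightarrow> bool) \<Rightarrow> 'w set \<Rightarrow> 'w set \<Rightarrow> bool" where
  "clique cmp P T \<longleftrightarrow> T \<subseteq> P \<and> (\<forall>a\<in>T. \<forall>b\<in>T. cmp a b)"

definition completions :: "('w \<Rightarrow> 'w \<Rightarrow> bool) \<Rightarrow> 'w set \<Rightarrow> 'w set \<Rightarrow> 'w set" where
  "completions cmp P T = {a \<in> P - T. \<forall>b\<in>T. cmp a b}"

text \<open>The Kleinbock--Margulis marking argument; instead of a Besicovitch cover it uses the maximal
  dyadic cells on which some \<open>\<psi> a\<close> stays below \<open>\<rho>\<close>.\<close>

lemma dyadic_nondivergence: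
  fixes \<psi> :: "'w \<Rightarrow> real ^ 'd \<Rightarrow> real"
  assumes refl: "\<And>a. cmp a a" and sym: "\<And>a b. cmp a b \<Longrightarrow> cmp b a"
    and fin: "\<And>T. clique cmp P T \<Longrightarrow> finite T \<and> card T \<le> k"
    and cont: "\<And>a x. a \<in> P \<Longrightarrow> x \<in> R \<Longrightarrow> \<psi> a x < \<rho> \<Longrightarrow> \<exists>l. \<forall>y\<in>dcell l x. \<psi> a y < \<rho>"
    and good: "\<And>a l x. a \<in> P \<Longrightarrow> l0 \<le> l \<Longrightarrow> dcell l x \<subseteq> R \<Longrightarrow> \<exists>y\<in>dcell l x. \<rho> \<le> \<psi> a y \<Longrightarrow>
      \<exists>E\<in>sets lebesgue. {y \<in> dcell l x. \<psi> a y < \<delta>} \<subseteq> E \<and>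
        emeasure lebesgue E \<le> ennreal \<eta> * emeasure lebesgue (dcell l x)"
    and "\<eta> \<ge> 0"
    and "clique cmp P T" "card T + s = k" "l0 \<le> l" "dcell l x \<subseteq> R"
    and "\<And>a. a \<in> completions cmp P T \<Longrightarrow> \<exists>y\<in>dcell l x. \<rho> \<le> \<psi> a y"
  shows "\<exists>N\<in>sets lebesgue.
    emeasure lebesgue N \<le> ennreal (\<eta> * nondiv_const (2 ^ CARD('d)) s) * emeasure lebesgue (dcell l x) \<and>
    (\<forall>y\<in>dcell l x - N. \<exists>T'. T \<subseteq> T' \<and> clique cmp P T' \<and>
      (\<forall>a\<in>T' - T. \<delta> \<le> \<psi> a y \<and> \<psi> a y \<le> \<rho>) \<and> (\<forall>a\<in>completions cmp P T'. \<rho> \<le> \<psi> a y))"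
  using assms(7-)
proof (induction s arbitrary: T l x)
  case 0
  \<comment> \<open>A clique with \<open>k\<close> elements is maximal, so \<open>T\<close> itself
    satisfies the marking conditions and nothing is discarded.\<close>
  have "a \<notin> completions cmp P T" for a
  proof
    assume a: "a \<in> completions cmp P T"
    then have "clique cmp P (insert a T)"
      using 0(1) refl sym by (auto simp: clique_def completions_def)
    then have "card (insert a T) \<le> k" using fin by blast
    moreover have "card (insert a T) = Suc (card T)"
      using a fin[OF 0(1)] by (auto simp: completions_def)
    ultimately show False using 0(2) by simp
  qed
  then show ?case using 0(1) by (intro bexI[of _ "{}"]) auto
next
  case (Suc s)
  let ?Q = "dcell l x" and ?c = "nondiv_const (2 ^ CARD('d)) s" and ?D = "2 ^ CARD('d) :: real"
  let ?marked = "\<lambda>y. \<exists>T'. T \<subseteq> T' \<and> clique cmp P T' \<and>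
      (\<forall>a\<in>T' - T. \<delta> \<le> \<psi> a y \<and> \<psi> a y \<le> \<rho>) \<and> (\<forall>a\<in>completions cmp P T'. \<rho> \<le> \<psi> a y)"
  define E where "E = {y \<in> ?Q. \<exists>a\<in>completions cmp P T. \<psi> a y < \<rho>}"
  define low where "low = (\<lambda>m y. \<exists>a\<in>completions cmp P T. \<forall>z\<in>dcell m y. \<psi> a z < \<rho>)"
  \<comment> \<open>The coarsest level at which some completion stays below \<open>\<rho>\<close> on
    the whole cell of \<open>y\<close>. By minimality, on the parent of that cell every completion
    reaches \<open>\<rho>\<close> somewhere.\<close>
  define lev where "lev = (\<lambda>y. LEAST m. low m y)"
  have low_cong: "low m z = low m y" if "z \<in> dcell m y" for m y z
    using dcell_eq[OF that] by (simp add: low_def)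
  have low_lev: "low (lev y) y" if y: "y \<in> E" for y
  proof -
    obtain a where a: "a \<in> completions cmp P T" "\<psi> a y < \<rho>" using y by (auto simp: E_def)
    then obtain m where "\<forall>z\<in>dcell m y. \<psi> a z < \<rho>"
      using cont[of a y] y Suc.prems(4) by (auto simp: E_def completions_def)
    then have "low m y" using a by (auto simp: low_def)
    then show ?thesis unfolding lev_def by (rule LeastI)
  qed
  have not_low: "\<not> low m y" if "m < lev y" for m y
    using that not_less_Least unfolding lev_def by blast
  have lev_gt: "l < lev y" if y: "y \<in> E" for y
  \<comment> \<open>On \<open>?Q\<close> every completion reaches \<open>\<rho>\<close>, so a low
    cell is strictly finer than \<open>?Q\<close> and its parent still lies in
    \<open>?Q\<close>.\<close>
  proof (rule ccontr)
    assume "\<not> l < lev y"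
    then have "?Q \<subseteq> dcell (lev y) y"
      using dcell_mono[of "lev y" l y] dcell_eq[of y l x] y by (auto simp: E_def)
    then show False
      using low_lev[OF y] Suc.prems(5) by (fastforce simp: low_def not_less[symmetric])
  qed
  have cell_sub: "dcell (lev y) y \<subseteq> E" if y: "y \<in> E" for y
  proof
    fix z assume z: "z \<in> dcell (lev y) y"
    then have "z \<in> ?Q"
      using dcell_mono[of l "lev y" y] dcell_eq[of y l x] y lev_gt[OF y] by (auto simp: E_def)
    then show "z \<in> E" using low_lev[OF y] z by (auto simp: E_def low_def)
  qed
  have lev_const: "lev z = lev y" if y: "y \<in> E" and z: "z \<in> dcell (lev y) y" for y z
  proof -
    have "low (lev y) z" using low_cong[OF z] low_lev[OF y] by simp
    moreover have "\<not> low m z" if "m < lev y" for m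
    proof -
      have "z \<in> dcell m y" using z dcell_mono[of m "lev y" y] that by auto
      then show ?thesis using low_cong not_low[OF that] by blast
    qed
    ultimately have "(LEAST m. low m z) = lev y"
      by (intro Least_equality) (metis not_le)+
    then show ?thesis by (simp add: lev_def)
  qed
  define \<C> where "\<C> = (\<lambda>y. dcell (lev y) y) ` E"
  have count: "countable \<C>"
    by (rule countable_subset[OF _ countable_dcells]) (auto simp: \<C>_def)
  have disj: "disjoint \<C>"
  proof (rule disjointI)
    fix C C' assume CC: "C \<in> \<C>" "C' \<in> \<C>" "C \<noteq> C'"
    show "C \<inter> C' = {}"
    proof (rule ccontr)
      assume "C \<inter> C' \<noteq> {}"
      with CC obtain y y' z where *: "y \<in> E" "y' \<in> E" "C = dcell (lev y) y" "C' = dcell (lev y') y'"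
        "z \<in> dcell (lev y) y" "z \<in> dcell (lev y') y'" by (auto simp: \<C>_def)
      then have "C = dcell (lev z) z" "C' = dcell (lev z) z"
        using lev_const dcell_eq by metis+
      with CC show False by simp
    qed
  qed
  have "\<exists>B. B \<in> sets lebesgue \<and> emeasure lebesgue (B \<inter> C) \<le> ennreal (\<eta> * nondiv_const ?D (Suc s)) * emeasure lebesgue C
      \<and> (\<forall>z\<in>C - B. ?marked z)" if C: "C \<in> \<C>" for C
  proof -
    obtain y where y: "y \<in> E" "C = dcell (lev y) y" using C by (auto simp: \<C>_def)
    \<comment> \<open>Level \<open>m\<close> is that of the parent. There every completion of
      \<open>T\<close>, the chosen \<open>a\<close> included, reaches \<open>\<rho>\<close>, so both
      the induction hypothesis for \<open>insert a T\<close> and the sublevel estimate for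
      \<open>a\<close> apply; on \<open>C\<close> itself \<open>a\<close> stays below
      \<open>\<rho>\<close>, as marking demands.\<close>
    obtain m where m: "lev y = Suc m" "l \<le> m" using lev_gt[OF y(1)] by (metis less_Suc_eq_le lessE less_imp_le_nat)
    obtain a where a: "a \<in> completions cmp P T" "\<forall>z\<in>C. \<psi> a z < \<rho>"
      using low_lev[OF y(1)] y(2) by (auto simp: low_def)
    have big: "\<exists>z\<in>dcell m y. \<rho> \<le> \<psi> b z" if "b \<in> completions cmp P T" for b
      using not_low[of m y] m that by (auto simp: low_def not_less)
    have sub: "dcell m y \<subseteq> R"
      using dcell_mono[OF m(2), of y] dcell_eq[of y l x] y Suc.prems(4) by (auto simp: E_def)
    have cl: "clique cmp P (insert a T)"
      using Suc.prems(1) a refl sym by (auto simp: clique_def completions_def)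
    have cardT: "card (insert a T) + s = k"
      using a fin[OF Suc.prems(1)] Suc.prems(2) by (auto simp: completions_def)
    have "\<exists>N\<in>sets lebesgue. emeasure lebesgue N \<le> ennreal (\<eta> * ?c) * emeasure lebesgue (dcell m y) \<and>
      (\<forall>z\<in>dcell m y - N. \<exists>T'. insert a T \<subseteq> T' \<and> clique cmp P T' \<and>
      (\<forall>a\<in>T' - insert a T. \<delta> \<le> \<psi> a z \<and> \<psi> a z \<le> \<rho>) \<and> (\<forall>a\<in>completions cmp P T'. \<rho> \<le> \<psi> a z))"
      using m Suc.prems(3) sub cl cardT
      by (intro Suc.IH big) (auto simp: completions_def)
    then obtain N where N: "N \<in> sets lebesgue"
      "emeasure lebesgue N \<le> ennreal (\<eta> * ?c) * emeasure lebesgue (dcell m y)"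
      "\<And>z. z \<in> dcell m y - N \<Longrightarrow> \<exists>T'. insert a T \<subseteq> T' \<and> clique cmp P T' \<and>
      (\<forall>a\<in>T' - insert a T. \<delta> \<le> \<psi> a z \<and> \<psi> a z \<le> \<rho>) \<and> (\<forall>a\<in>completions cmp P T'. \<rho> \<le> \<psi> a z)"
      by blast
    obtain S where S: "S \<in> sets lebesgue" "{z \<in> dcell m y. \<psi> a z < \<delta>} \<subseteq> S"
        "emeasure lebesgue S \<le> ennreal \<eta> * emeasure lebesgue (dcell m y)"
      using good[of a m y] a m Suc.prems(3) sub big[OF a(1)] by (auto simp: completions_def)
    have "emeasure lebesgue ((N \<union> S) \<inter> C) \<le> emeasure lebesgue (N \<union> S)"
      using N S by (intro emeasure_mono) auto
    also have "\<dots> \<le> emeasure lebesgue N + emeasure lebesgue S"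
      using N S by (intro emeasure_subadditive) auto
    also have "\<dots> \<le> ennreal (\<eta> * ?c) * emeasure lebesgue (dcell m y) + ennreal \<eta> * emeasure lebesgue (dcell m y)"
      using N S by (intro add_mono) auto
    also have "\<dots> = ennreal (\<eta> * ?c + \<eta>) * emeasure lebesgue (dcell m y)"
      using \<open>\<eta> \<ge> 0\<close> nondiv_const_nonneg[of ?D s] by (simp add: distrib_right)
    also have "\<dots> = ennreal ((\<eta> * ?c + \<eta>) * ?D) * emeasure lebesgue C"
      unfolding y(2) m(1) emeasure_dcell_parent[of m y y]
      using \<open>\<eta> \<ge> 0\<close> nondiv_const_nonneg[of ?D s] by (simp add: ennreal_mult mult.assoc)
    also have "(\<eta> * ?c + \<eta>) * ?D = \<eta> * nondiv_const ?D (Suc s)" by (simp add: algebra_simps)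
    finally have "emeasure lebesgue ((N \<union> S) \<inter> C)
        \<le> ennreal (\<eta> * nondiv_const ?D (Suc s)) * emeasure lebesgue C" .
    moreover have "?marked z" if z: "z \<in> C - (N \<union> S)" for z
    proof -
      have zm: "z \<in> dcell m y" using z y m dcell_Suc_subset[of m y] by auto
      then obtain T' where T': "insert a T \<subseteq> T'" "clique cmp P T'"
        "\<forall>a\<in>T' - insert a T. \<delta> \<le> \<psi> a z \<and> \<psi> a z \<le> \<rho>" "\<forall>a\<in>completions cmp P T'. \<rho> \<le> \<psi> a z"
        using N(3)[of z] z by auto
      have "\<delta> \<le> \<psi> a z" using S(2) zm z by force
      moreover have "\<psi> a z \<le> \<rho>" using a(2) z by (auto intro: less_imp_le)
      ultimately have "\<forall>b\<in>T' - T. \<delta> \<le> \<psi> b z \<and> \<psi> b z \<le> \<rho>" using T'(3) by blast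
      then show ?thesis using T' by blast
    qed
    ultimately show ?thesis using N S by (intro exI[of _ "N \<union> S"]) auto
  qed
  then have "\<exists>B. \<forall>C\<in>\<C>. B C \<in> sets lebesgue \<and>
      emeasure lebesgue (B C \<inter> C) \<le> ennreal (\<eta> * nondiv_const ?D (Suc s)) * emeasure lebesgue C
      \<and> (\<forall>z\<in>C - B C. ?marked z)" by (intro bchoice ballI)
  then obtain B where B: "\<forall>C\<in>\<C>. B C \<in> sets lebesgue \<and>
      emeasure lebesgue (B C \<inter> C) \<le> ennreal (\<eta> * nondiv_const ?D (Suc s)) * emeasure lebesgue C
      \<and> (\<forall>z\<in>C - B C. ?marked z)" by (rule exE)
  define N where "N = (\<Union>C\<in>\<C>. B C \<inter> C)"
  have "\<Union>\<C> \<subseteq> ?Q" using cell_sub by (auto simp: \<C>_def E_def)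
  note pieces = emeasure_pieces_le[OF count disj dcell_lebesgue[of l x] this, of B
      "ennreal (\<eta> * nondiv_const ?D (Suc s))"]
  have meas: "\<And>C. C \<in> \<C> \<Longrightarrow> C \<in> sets lebesgue" by (auto simp: \<C>_def)
  have B': "\<And>C. C \<in> \<C> \<Longrightarrow> B C \<in> sets lebesgue"
    "\<And>C. C \<in> \<C> \<Longrightarrow> emeasure lebesgue (B C \<inter> C) \<le>
      ennreal (\<eta> * nondiv_const ?D (Suc s)) * emeasure lebesgue C"
    using bspec[OF B] by (simp_all only:)
  have "N \<in> sets lebesgue"
    "emeasure lebesgue N \<le> ennreal (\<eta> * nondiv_const ?D (Suc s)) * emeasure lebesgue ?Q"
    unfolding N_def by (rule pieces[OF meas B'], assumption+)+
  moreover have "?marked y" if y: "y \<in> ?Q - N" for y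
  proof (cases "y \<in> E")
    case True
    then have "dcell (lev y) y \<in> \<C>" by (auto simp: \<C>_def)
    moreover from this have "y \<in> dcell (lev y) y - B (dcell (lev y) y)"
      using y dcell_self[of y "lev y"] unfolding N_def by blast
    ultimately show ?thesis using bspec[OF B, of "dcell (lev y) y"] by blast
  next
    case False
    \<comment> \<open>Outside \<open>E\<close> no completion drops below \<open>\<rho>\<close>, so
      \<open>T\<close> needs no further members.\<close>
    then have "\<forall>a\<in>completions cmp P T. \<rho> \<le> \<psi> a y" using y by (auto simp: E_def not_less)
    then show ?thesis using Suc.prems(1) by (intro exI[of _ T]) auto
  qed
  ultimately show ?case by blast
qed

section \<open>Sublevel sets on small cells\<close>

text \<open>Integrate the number of translates of \<open>E\<close> that cover a point: the integral
  is \<open>N\<close> times the measure of \<open>E\<close>, and the integrand is at most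
  \<open>m\<close> on \<open>Q\<close> and zero elsewhere.\<close>

lemma translates_overlap:
  fixes E Q :: "'a::euclidean_space set" and w :: "nat \<Rightarrow> 'a"
  assumes "E \<in> lmeasurable" "Q \<in> lmeasurable"
    and "\<And>i z. i < N \<Longrightarrow> z + w i \<in> E \<Longrightarrow> z \<in> Q"
    and "\<And>z. card {i. i < N \<and> z + w i \<in> E} \<le> m"
  shows "real N * measure lebesgue E \<le> real m * measure lebesgue Q"
proof -
  define T where "T = (\<lambda>i. (+) (- w i) ` E)"
  have T: "z \<in> T i \<longleftrightarrow> z + w i \<in> E" for z i
    unfolding T_def by (force simp: image_iff algebra_simps)
  have Tm: "T i \<in> lmeasurable" "measure lebesgue (T i) = measure lebesgue E" for i
    unfolding T_def by (rule measurable_translation[OF assms(1)], rule measure_translation)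
  have int: "integrable lebesgue (indicat_real (T i))" "integrable lebesgue (indicat_real Q)" for i
    using Tm assms(2) by (auto simp: lmeasurable_iff_integrable[symmetric])
  have "real N * measure lebesgue E = (\<Sum>i<N. measure lebesgue (T i))" by (simp add: Tm)
  also have "\<dots> = (\<Sum>i<N. integral\<^sup>L lebesgue (indicat_real (T i)))"
    by simp
  also have "\<dots> = integral\<^sup>L lebesgue (\<lambda>z. \<Sum>i<N. indicat_real (T i) z)"
    using int by (intro Bochner_Integration.integral_sum[symmetric]) auto
  also have "\<dots> \<le> integral\<^sup>L lebesgue (\<lambda>z. real m * indicat_real Q z)"
  proof (rule integral_mono)
    fix z
    have "(\<Sum>i<N. indicat_real (T i) z) = real (card {i. i < N \<and> z + w i \<in> E})"
      by (simp add: indicator_def T sum.If_cases Int_def)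
    also have "\<dots> \<le> real m * indicat_real Q z"
    proof (cases "z \<in> Q")
      case True
      then show ?thesis using assms(4)[of z] by simp
    next
      case False
      then have "{i. i < N \<and> z + w i \<in> E} = {}" using assms(3) by blast
      then show ?thesis using False by (simp only: card.empty) simp
    qed
    finally show "(\<Sum>i<N. indicat_real (T i) z) \<le> real m * indicat_real Q z" .
  qed (use int in auto)
  also have "\<dots> = real m * measure lebesgue Q" by simp
  finally show ?thesis .
qed

definition cube :: "real ^ 'd \<Rightarrow> real \<Rightarrow> (real ^ 'd) set" where
  "cube a s = {x. \<forall>i. \<bar>x $ i - a $ i\<bar> \<le> s}"

definition power_series_on ::
    "(('d::finite \<Rightarrow> nat) \<Rightarrow> real) \<Rightarrow> real ^ 'd \<Rightarrow> real \<Rightarrow> (real ^ 'd \<Rightarrow> real) \<Rightarrow> bool" where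
  "power_series_on c a r F \<longleftrightarrow> (\<forall>x\<in>cube a r.
     ((\<lambda>\<alpha>. c \<alpha> * (\<Prod>i\<in>UNIV. (x $ i - a $ i) ^ \<alpha> i)) has_sum F x) UNIV)"

text \<open>Goodness of a function without a rate: \<open>\<rho>\<close> will be a value that
  \<open>F\<close> reaches on \<open>Q\<close>, and the ratio \<open>\<epsilon>\<close> depends in
  an unspecified way on the allowed proportion \<open>\<eta>\<close>.\<close>

definition small_sublevel :: "real \<Rightarrow> real \<Rightarrow> real \<Rightarrow> (real ^ 'd \<Rightarrow> real) \<Rightarrow> (real ^ 'd) set \<Rightarrow> bool" where
  "small_sublevel \<eta> \<epsilon> \<rho> F Q \<longleftrightarrow> {y \<in> Q. \<bar>F y\<bar> < \<epsilon> * \<rho>} \<in> sets lebesgue \<and>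
     emeasure lebesgue {y \<in> Q. \<bar>F y\<bar> < \<epsilon> * \<rho>} \<le> ennreal \<eta> * emeasure lebesgue Q"

text \<open>Along the direction \<open>v\<close> the part \<open>P m\<close> dominates \<open>F\<close>, so \<open>F\<close> cannot be small at \<open>m + 1\<close>
  well-spaced points of one line.\<close>

lemma card_sublevel_on_line:
  fixes P :: "nat \<Rightarrow> real ^ 'd \<Rightarrow> real" and b :: "nat \<Rightarrow> real" and N M m :: nat
  assumes dd: "\<And>T j z. finite T \<Longrightarrow> card T = Suc m \<Longrightarrow> j \<le> m \<Longrightarrow>
      divdiff T (\<lambda>t. P j (z + t *\<^sub>R v)) = (if j = m then P m v else 0)"
    and rem: "\<And>y. y \<in> E \<Longrightarrow> \<bar>F y - (\<Sum>j\<le>M. P j (y - x))\<bar> \<le> b m / K"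
    and bound: "\<And>j y. y \<in> E \<Longrightarrow> j \<le> M \<Longrightarrow> \<bar>P j (y - x)\<bar> \<le> b j"
    and small: "\<And>y. y \<in> E \<Longrightarrow> \<bar>F y\<bar> \<le> b m / K"
    and m: "m \<le> M" "b m / 2 \<le> \<bar>P m v\<bar>" "b m > 0"
    and decay: "\<And>j. m < j \<Longrightarrow> j \<le> M \<Longrightarrow> b j \<le> b m / K"
    and N: "N > 0" and K: "2 * (real M + 1) * (real M + 2) * real N ^ M < K"
  shows "card {i. i < N \<and> z + (real i / real N) *\<^sub>R v \<in> E} \<le> m"
proof (rule ccontr)
  assume "\<not> ?thesis"
  then have "Suc m \<le> card {i. i < N \<and> z + (real i / real N) *\<^sub>R v \<in> E}" by simp
  then obtain I where I: "I \<subseteq> {i. i < N \<and> z + (real i / real N) *\<^sub>R v \<in> E}" "card I = Suc m" "finite I"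
    by (rule obtain_subset_with_card_n)
  define T where "T = (\<lambda>i. real i / real N) ` I"
  have inj: "inj_on (\<lambda>i. real i / real N) I" using N by (auto intro: inj_onI)
  have T: "finite T" "card T = Suc m" using I inj by (auto simp: T_def card_image)
  have TE: "z + t *\<^sub>R v \<in> E" if "t \<in> T" for t using that I by (auto simp: T_def)
  have K0: "K > 0"
    by (rule le_less_trans[OF _ K]) simp
  define g where "g = (\<lambda>t. \<Sum>j\<le>m. P j (z - x + t *\<^sub>R v))"
  have "divdiff T g = (\<Sum>j\<le>m. divdiff T (\<lambda>t. P j (z - x + t *\<^sub>R v)))"
    unfolding g_def by (rule divdiff_sum)
  also have "\<dots> = (\<Sum>j\<le>m. if j = m then P m v else 0)"
    using dd T by (intro sum.cong) auto
  also have "\<dots> = P m v" by simp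
  finally have top: "divdiff T g = P m v" .
  \<comment> \<open>The parts above degree \<open>m\<close> contribute at most \<open>M\<close>
    terms of size \<open>b m / K\<close>; the Taylor remainder and the value of \<open>F\<close>
    contribute one more each.\<close>
  have gb: "\<bar>g t\<bar> \<le> (real M + 2) * (b m / K)" if t: "t \<in> T" for t
  proof -
    let ?y = "z + t *\<^sub>R v"
    have y: "?y \<in> E" "?y - x = z - x + t *\<^sub>R v" using TE[OF t] by auto
    have split: "(\<Sum>j\<le>M. P j (?y - x)) = g t + (\<Sum>j\<in>{m<..M}. P j (?y - x))"
      unfolding g_def y(2) using m(1)
      by (subst sum.union_disjoint[symmetric]) (auto intro!: sum.cong)
    have "\<bar>\<Sum>j\<in>{m<..M}. P j (?y - x)\<bar> \<le> (\<Sum>j\<in>{m<..M}. b m / K)"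
      using bound[OF y(1)] decay by (intro order_trans[OF sum_abs] sum_mono) (force intro: order_trans)
    also have "\<dots> = real (M - m) * (b m / K)" by simp
    also have "\<dots> \<le> real M * (b m / K)"
      using m K0 by (intro mult_right_mono) auto
    finally have "\<bar>g t\<bar> \<le> real M * (b m / K) + b m / K + b m / K"
      using rem[OF y(1)] small[OF y(1)] split by linarith
    then show ?thesis by (simp add: algebra_simps)
  qed
  have "\<bar>divdiff T g\<bar> \<le> (real m + 1) * real N ^ m * ((real M + 2) * (b m / K))"
  proof (rule abs_divdiff_le[OF T])
    fix s t assume "s \<in> T" "t \<in> T" "s \<noteq> t"
    then obtain i j where ij: "s = real i / real N" "t = real j / real N" "i \<noteq> j" by (auto simp: T_def)
    then have "1 \<le> \<bar>real j - real i\<bar>" by linarith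
    then show "1 / real N \<le> \<bar>t - s\<bar>"
      using N ij by (simp add: diff_divide_distrib[symmetric] divide_right_mono)
  qed (use N gb in auto)
  also have "\<dots> \<le> (real M + 1) * real N ^ M * ((real M + 2) * (b m / K))"
    using m N K0 by (intro mult_right_mono mult_mono power_increasing) auto
  \<comment> \<open>\<open>K\<close> exceeds twice the loss in the divided difference; this
    contradicts the choice of \<open>v\<close>, where part \<open>m\<close> is at least
    \<open>b m / 2\<close>.\<close>
  also have "\<dots> < b m / 2"
  proof -
    have "(2 * (real M + 1) * (real M + 2) * real N ^ M) * b m < K * b m"
      using K m by (intro mult_strict_right_mono)
    then show ?thesis using K0 by (simp add: field_simps)
  qed
  finally show False using top m by simp
qed

text \<open>The remainder estimate of order zero around \<open>x\<close> is a Lipschitz bound: it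
  compares \<open>F y\<close> with the constant Taylor part, and displacement 0 identifies that part
  with \<open>F x\<close>.\<close>

lemma (in scaled_series) continuous_on_has_sum:
  assumes F: "power_series_on c a r F"
  shows "continuous_on (cube a (r / 8)) F"
  unfolding continuous_on_iff
proof (intro ballI allI impI)
  fix x and e :: real assume "x \<in> cube a (r / 8)" and e: "e > 0"
  then have x: "\<bar>x $ i - a $ i\<bar> \<le> r / 8" for i by (simp add: cube_def)
  define d where "d = min (r / 4) (e * r / (8 * (A + 1)))"
  have d: "d > 0" using r_pos e A_nonneg by (simp add: d_def)
  have lip: "\<bar>F y - F x\<bar> < e" if y: "\<And>i. \<bar>y $ i - a $ i\<bar> \<le> r / 8" and yx: "norm (y - x) < d" for y
  proof -
    have b: "\<bar>(x - a) $ i\<bar> \<le> r / 2" for i using x[of i] r_pos by simp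
    have P: "taylor_part c (x - a) 0 z = taylor_part c (x - a) 0 0" for z by (rule taylor_part_0_scale)
    have "\<bar>F y - (\<Sum>j\<le>0. taylor_part c (x - a) j (y - x))\<bar> \<le> A * (2 * (2 * norm (y - x) / r) ^ Suc 0)"
    proof (rule taylor_remainder[OF b])
      show "\<bar>(y - x) $ i\<bar> \<le> norm (y - x)" for i by (rule component_le_norm_cart)
      show "norm (y - x) \<le> r / 4" using yx by (simp add: d_def)
      have "\<bar>y $ i - a $ i\<bar> \<le> r" for i using y[of i] r_pos by simp
      then show "((\<lambda>\<alpha>. c \<alpha> * (\<Prod>i\<in>UNIV. ((x - a) $ i + (y - x) $ i) ^ \<alpha> i)) has_sum F y) UNIV"
        using F by (simp add: power_series_on_def cube_def)
    qed
    moreover have "\<bar>F x - (\<Sum>j\<le>0. taylor_part c (x - a) j 0)\<bar> \<le> A * (2 * (2 * 0 / r) ^ Suc 0)"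
    proof (rule taylor_remainder[OF b])
      have "\<bar>x $ i - a $ i\<bar> \<le> r" for i using x[of i] r_pos by simp
      then show "((\<lambda>\<alpha>. c \<alpha> * (\<Prod>i\<in>UNIV. ((x - a) $ i + 0 $ i) ^ \<alpha> i)) has_sum F x) UNIV"
        using F by (simp add: power_series_on_def cube_def)
    qed (use r_pos in auto)
    ultimately have "\<bar>F y - F x\<bar> \<le> A * (4 * norm (y - x) / r)"
      using P[of "y - x"] by simp
    also have "\<dots> \<le> (A + 1) * (4 * norm (y - x) / r)"
      using r_pos by (intro mult_right_mono) auto
    also have "\<dots> < e"
    proof -
      have "norm (y - x) < e * r / (8 * (A + 1))" using yx by (simp add: d_def)
      then have "norm (y - x) * (8 * (A + 1)) < e * r"
        using A_nonneg by (subst pos_less_divide_eq[symmetric]) auto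
      moreover have "8 * ((A + 1) * norm (y - x)) = norm (y - x) * (8 * (A + 1))"
        by (simp add: algebra_simps)
      moreover have "0 \<le> (A + 1) * norm (y - x)" using A_nonneg by simp
      ultimately have "4 * ((A + 1) * norm (y - x)) < e * r" by linarith
      then show ?thesis using r_pos by (simp add: pos_divide_less_eq mult_ac)
    qed
    finally show ?thesis .
  qed
  show "\<exists>d>0. \<forall>y\<in>cube a (r / 8). dist y x < d \<longrightarrow> dist (F y) (F x) < e"
    using d lip by (intro exI[of _ d]) (auto simp: dist_norm cube_def)
qed

lemma sublevel_measurable:
  fixes F :: "real ^ 'd \<Rightarrow> real"
  assumes "continuous_on (cube a s) F" "dcell l x \<subseteq> cube a s"
  shows "{y \<in> dcell l x. \<bar>F y\<bar> < c} \<in> sets lebesgue"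
proof -
  let ?S = "cube a s"
  have "{x :: real ^ 'd \<in> space borel. \<forall>i. \<bar>x $ i - a $ i\<bar> \<le> s} \<in> sets borel" by measurable
  then have S: "?S \<in> sets borel" by (simp add: cube_def)
  have [measurable]: "(\<lambda>x. indicator ?S x *\<^sub>R F x) \<in> borel_measurable borel"
    using assms(1) S by (rule borel_measurable_continuous_on_indicator[rotated])
  have "{y \<in> space borel. y \<in> dcell l x \<and> \<bar>indicator ?S y *\<^sub>R F y\<bar> < c} \<in> sets borel" by measurable
  moreover have "{y \<in> space borel. y \<in> dcell l x \<and> \<bar>indicator ?S y *\<^sub>R F y\<bar> < c}
      = {y \<in> dcell l x. \<bar>F y\<bar> < c}"
    using assms(2) by auto
  ultimately show ?thesis by (simp add: sets_completionI_sets)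
qed

text \<open>Let \<open>b j\<close> bound the Taylor part of degree \<open>j\<close> on the cell, and let \<open>m\<close> maximize \<open>K ^ j * b j\<close>.
  For large \<open>K\<close> the parts of degree above \<open>m\<close> are negligible against \<open>P m\<close>, whatever the cell. If
  \<open>P m\<close> is large at \<open>v\<close>, then among \<open>N\<close> translates of the sublevel set along \<open>v\<close> at most \<open>m\<close>
  meet in any point.\<close>

lemma dcell_sublevel_small:
  fixes a :: "real ^ 'd" and r A \<eta> :: real
  assumes r: "r > 0" and A: "A \<ge> 0" and \<eta>: "\<eta> > 0"
  shows "\<exists>\<epsilon> l0. 0 < \<epsilon> \<and> \<epsilon> \<le> 1 \<and> (\<forall>c F l x \<rho>. scaled_series c r A \<longrightarrow>
    power_series_on c a r F \<longrightarrow> (\<exists>x\<in>cube a (r / 8). 1 / 2 \<le> \<bar>F x\<bar>) \<longrightarrow> l0 \<le> l \<longrightarrow>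
    dcell l x \<subseteq> cube a (r / 8) \<longrightarrow> (\<exists>y\<in>dcell l x. \<rho> \<le> \<bar>F y\<bar>) \<longrightarrow>
    small_sublevel \<eta> \<epsilon> \<rho> F (dcell l x))"
proof -
  \<comment> \<open>At displacement at most \<open>r / 4\<close> the ratio \<open>2 * s / r\<close>
    is at most 1/2, so this order makes the Taylor remainder at most 1/4. Where \<open>F\<close> is
    at least 1/2, the Taylor polynomial then keeps at least 1/4.\<close>
  obtain M :: nat where M: "2 * A * (1 / 2) ^ Suc M \<le> 1 / 4"
  proof -
    obtain M :: nat where "(1 / 2 :: real) ^ M < 1 / (4 * (A + 1))"
      using real_arch_pow_inv[of "1 / (4 * (A + 1))" "1 / 2"] A by auto
    then have "(A + 1) * (1 / 2) ^ M < 1 / 4" using A by (simp add: field_simps)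
    moreover have "A * (1 / 2) ^ M \<le> (A + 1) * (1 / 2) ^ M" by (intro mult_right_mono) auto
    moreover have "2 * A * (1 / 2) ^ Suc M = A * (1 / 2) ^ M" by simp
    ultimately show ?thesis by (intro that[of M]) linarith
  qed
  \<comment> \<open>\<open>N\<close> translates with at most \<open>M\<close> overlaps inside a cube
    \<open>4 ^ CARD('d)\<close> times as large as the cell leave the proportion
    \<open>M * 4 ^ CARD('d) / N\<close>, which has to be below \<open>\<eta>\<close>.\<close>
  obtain N :: nat where N: "real M * 4 ^ CARD('d) / \<eta> < real N" using reals_Archimedean2 by blast
  then have "N > 0" using \<eta> by (cases N) (auto simp: divide_less_0_iff mult_less_0_iff)
  \<comment> \<open>\<open>K\<close> beats the loss of a divided difference over nodes of spacing
    \<open>1 / N\<close>. \<open>K'\<close> will bound \<open>F\<close> on the cell by a multiple of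
    \<open>b m\<close>, so that \<open>\<epsilon> = 1 / (K * K')\<close> puts the sublevel threshold
    below \<open>b m / K\<close>.\<close>
  define K where "K = 2 * (real M + 1) * (real M + 2) * real N ^ M + 1"
  have K: "K \<ge> 1" "2 * (real M + 1) * (real M + 2) * real N ^ M < K" by (auto simp: K_def)
  define K' where "K' = (real M + 1) * K ^ M + 1"
  have K': "K' \<ge> 1" using K by (simp add: K'_def)
  \<comment> \<open>With \<open>q\<close> the ratio of the cell side to \<open>r / 4\<close>, the
    remainder is at most \<open>2 * (A + 1) * q ^ Suc M\<close>, while \<open>b m\<close> is at
    least \<open>q ^ M / (4 * (M + 1) * K ^ M)\<close>. The extra power of \<open>q\<close> wins
    once \<open>q\<close> is at most \<open>\<theta>\<close>, and the remainder drops to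
    \<open>b m / K\<close>.\<close>
  define \<theta> where "\<theta> = 1 / (8 * (A + 1) * (real M + 1) * K ^ Suc M)"
  have \<theta>: "\<theta> > 0" "\<theta> \<le> 1"
  proof -
    have "1 * 1 \<le> (real M + 1) * K ^ Suc M"
      using one_le_power[OF K(1), of "Suc M"] by (intro mult_mono) auto
    then have D: "1 * 1 \<le> (A + 1) * ((real M + 1) * K ^ Suc M)"
      using A by (intro mult_mono) auto
    have "\<theta> = 1 / (8 * ((A + 1) * ((real M + 1) * K ^ Suc M)))"
      by (simp only: \<theta>_def mult.assoc)
    then show "\<theta> > 0" "\<theta> \<le> 1" using D by (simp_all add: divide_le_eq_1 del: power_Suc)
  qed
  obtain l0 :: nat where l0: "(1 / 2 :: real) ^ l0 < r / 4 * \<theta>"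
    using real_arch_pow_inv[of "r / 4 * \<theta>" "1 / 2"] r \<theta> by auto
  define \<epsilon> where "\<epsilon> = 1 / (K * K')"
  have "1 \<le> K * K'" using K K' by (metis mult_mono mult_1 order_trans zero_le_one)
  then have \<epsilon>: "\<epsilon> > 0" "\<epsilon> \<le> 1" by (auto simp: \<epsilon>_def divide_simps)
  show ?thesis
  proof (intro exI[of _ \<epsilon>] exI[of _ l0] conjI allI impI)
    fix c F l x \<rho>
    assume ss: "scaled_series c r A" and F: "power_series_on c a r F"
      and "\<exists>x\<in>cube a (r / 8). 1 / 2 \<le> \<bar>F x\<bar>"
      and l: "l0 \<le> l" and Q: "dcell l x \<subseteq> cube a (r / 8)"
      and "\<exists>y\<in>dcell l x. \<rho> \<le> \<bar>F y\<bar>"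
    then obtain x1 y1 where x1: "\<And>i. \<bar>x1 $ i - a $ i\<bar> \<le> r / 8" "1 / 2 \<le> \<bar>F x1\<bar>"
      and y1: "y1 \<in> dcell l x" "\<rho> \<le> \<bar>F y1\<bar>" by (auto simp: cube_def)
    interpret scaled_series c r A by fact
    define h where "h = (1 / 2 :: real) ^ l"
    have h: "h > 0" by (simp add: h_def)
    have "h \<le> (1 / 2) ^ l0" unfolding h_def using l by (intro power_decreasing) auto
    then have h\<theta>: "h \<le> r / 4 * \<theta>" using l0 by linarith
    moreover have "r / 4 * \<theta> \<le> r / 4 * 1" using \<theta> r by (intro mult_left_mono) auto
    ultimately have hs: "h \<le> r / 4" by simp
    define P where "P = taylor_part c (x - a)"
    have cell8: "\<bar>y $ i - a $ i\<bar> \<le> r / 8" if "y \<in> dcell l x" for y i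
      using Q that by (auto simp: cube_def)
    note xa = cell8[OF dcell_self]
    have b0: "\<bar>(x - a) $ i\<bar> \<le> r / 2" for i using xa[of i] r by simp
    have rem: "\<bar>F y - (\<Sum>j\<le>M. P j (y - x))\<bar> \<le> A * (2 * (2 * s / r) ^ Suc M)"
      if "\<And>i. \<bar>y $ i - x $ i\<bar> \<le> s" "s \<le> r / 4" "\<And>i. \<bar>y $ i - a $ i\<bar> \<le> r" for y s
    proof -
      have "((\<lambda>\<alpha>. c \<alpha> * (\<Prod>i\<in>UNIV. ((x - a) $ i + (y - x) $ i) ^ \<alpha> i)) has_sum F y) UNIV"
        using F that(3) by (simp add: power_series_on_def cube_def)
      then show ?thesis unfolding P_def using that by (intro taylor_remainder b0) auto
    qed
    define Box where "Box = {y :: real ^ 'd. \<forall>i. \<bar>y $ i\<bar> \<le> h}"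
    define b where "b = (\<lambda>j. SUP y\<in>Box. \<bar>P j y\<bar>)"
    have bdd: "bdd_above ((\<lambda>y. \<bar>P j y\<bar>) ` Box)" for j
      unfolding P_def
      by (intro bdd_aboveI2[where M = "A * (2 * h / r) ^ j"] abs_taylor_part b0) (auto simp: Box_def)
    have "0 \<in> Box" using h by (simp add: Box_def)
    then have ne: "Box \<noteq> {}" by blast
    have Pb: "\<bar>P j y\<bar> \<le> b j" if "y \<in> Box" for j y
      unfolding b_def using that by (intro cSUP_upper bdd)
    have b_nn: "b j \<ge> 0" for j using Pb[OF \<open>0 \<in> Box\<close>, of j] by linarith
    have cellBox: "y - x \<in> Box" if "y \<in> dcell l x" for y
      using dcell_close[OF that] by (simp add: Box_def h_def)
    define q where "q = h / (r / 4)"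
    have q: "0 < q" "q \<le> 1" "q \<le> \<theta>" using h hs h\<theta> r by (auto simp: q_def field_simps)
    \<comment> \<open>At \<open>x1\<close> the Taylor polynomial is at least 1/4, so one of its
      \<open>M + 1\<close> parts is at least \<open>1 / (4 * (M + 1))\<close>. Homogeneity moves
      this into \<open>Box\<close>: shrinking the displacement from \<open>r / 4\<close> to
      \<open>h\<close> costs at most \<open>q ^ M\<close>.\<close>
    obtain j0 where j0: "j0 \<le> M" "q ^ M / (4 * (real M + 1)) \<le> b j0"
    proof -
      have x1x: "\<bar>x1 $ i - x $ i\<bar> \<le> r / 4" for i using x1(1)[of i] xa[of i] by linarith
      have x1r: "\<bar>x1 $ i - a $ i\<bar> \<le> r" for i using x1(1)[of i] r by linarith
      have "\<bar>F x1 - (\<Sum>j\<le>M. P j (x1 - x))\<bar> \<le> A * (2 * (2 * (r / 4) / r) ^ Suc M)"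
        by (intro rem x1x x1r order_refl)
      also have "\<dots> = 2 * A * (1 / 2) ^ Suc M" using r by simp
      finally have "1 / 4 \<le> \<bar>\<Sum>j\<le>M. P j (x1 - x)\<bar>" using M x1(2) by linarith
      also have "\<dots> \<le> (\<Sum>j\<le>M. \<bar>P j (x1 - x)\<bar>)" by (rule sum_abs)
      finally have le: "1 / 4 \<le> (\<Sum>j\<le>M. \<bar>P j (x1 - x)\<bar>)" .
      have "\<exists>j\<le>M. 1 / (4 * (real M + 1)) \<le> \<bar>P j (x1 - x)\<bar>"
      proof (rule ccontr)
        assume "\<not> ?thesis"
        then have "\<bar>P j (x1 - x)\<bar> < 1 / (4 * (real M + 1))" if "j \<in> {..M}" for j
          using that by (meson atMost_iff not_le)
        then have "(\<Sum>j\<le>M. \<bar>P j (x1 - x)\<bar>) < (\<Sum>j\<le>M. 1 / (4 * (real M + 1)))"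
          by (intro sum_strict_mono) simp_all
        also have "\<dots> = 1 / 4" by (simp add: field_simps)
        finally show False using le by simp
      qed
      then obtain j where j: "j \<le> M" "1 / (4 * (real M + 1)) \<le> \<bar>P j (x1 - x)\<bar>" by blast
      have "q *\<^sub>R (x1 - x) \<in> Box"
      proof -
        have "q * \<bar>x1 $ i - x $ i\<bar> \<le> q * (r / 4)" for i using x1x q by (intro mult_left_mono) auto
        then show ?thesis using q r h by (simp add: Box_def abs_mult q_def)
      qed
      then have "\<bar>P j (q *\<^sub>R (x1 - x))\<bar> \<le> b j" by (rule Pb)
      moreover have "P j (q *\<^sub>R (x1 - x)) = q ^ j * P j (x1 - x)"
        unfolding P_def by (rule taylor_part_scale)
      ultimately have "q ^ j * \<bar>P j (x1 - x)\<bar> \<le> b j" using q by (simp add: abs_mult)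
      moreover have "q ^ M * (1 / (4 * (real M + 1))) \<le> q ^ j * \<bar>P j (x1 - x)\<bar>"
        using q j by (intro mult_mono power_decreasing) auto
      ultimately show ?thesis using j by (intro that[of j]) auto
    qed
    obtain m where m: "m \<le> M" "\<And>j. j \<le> M \<Longrightarrow> K ^ j * b j \<le> K ^ m * b m"
    proof -
      let ?X = "(\<lambda>j. K ^ j * b j) ` {..M}"
      have X: "finite ?X" "?X \<noteq> {}" by auto
      from Max_in[OF X] obtain m where m: "Max ?X = K ^ m * b m" "m \<in> {..M}" by (rule imageE)
      have "K ^ j * b j \<le> K ^ m * b m" if "j \<le> M" for j
        unfolding m(1)[symmetric] using that by (intro Max_ge[OF X(1)]) auto
      then show ?thesis using m by (intro that[of m]) auto
    qed
    have bm_ge: "q ^ M / (4 * (real M + 1)) \<le> K ^ M * b m"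
    proof -
      have "b j0 \<le> K ^ j0 * b j0" using K b_nn[of j0] by (simp add: mult_le_cancel_right1)
      also have "\<dots> \<le> K ^ m * b m" using m j0 by blast
      also have "\<dots> \<le> K ^ M * b m" using m K b_nn by (intro mult_right_mono power_increasing) auto
      finally show ?thesis using j0 by linarith
    qed
    have bm: "b m > 0"
    proof -
      have "0 < q ^ M / (4 * (real M + 1))" using q by simp
      then have "0 < K ^ M * b m" using bm_ge by linarith
      then show ?thesis using K b_nn[of m] by (simp add: zero_less_mult_iff)
    qed
    have tail: "A * (2 * (2 * h / r) ^ Suc M) \<le> b m / K"
    proof -
      have gen: "B * 2 * (1 / (8 * B * C * D)) * X = X / (4 * C) / D" if "B > 0" "C > 0" "D > 0"
        for B C D X :: real using that by (simp add: field_simps)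
      have "2 * h / r \<le> q" using h r by (simp add: q_def field_simps)
      then have "A * (2 * (2 * h / r) ^ Suc M) \<le> (A + 1) * (2 * q ^ Suc M)"
        using A h r by (intro mult_mono power_mono) auto
      also have "\<dots> = (A + 1) * 2 * q * q ^ M" by simp
      also have "\<dots> \<le> (A + 1) * 2 * \<theta> * q ^ M"
        using q A by (intro mult_right_mono mult_left_mono) auto
      also have "\<dots> = q ^ M / (4 * (real M + 1)) / K ^ Suc M"
        unfolding \<theta>_def using A K by (intro gen) auto
      also have "\<dots> \<le> K ^ M * b m / K ^ Suc M"
        using bm_ge K by (intro divide_right_mono) auto
      also have "\<dots> = b m / K" using K by simp
      finally show ?thesis .
    qed
    have decay: "b j \<le> b m / K" if "m < j" "j \<le> M" for j
    proof -
      have "K ^ m * (K * b j) = K ^ Suc m * b j" by simp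
      also have "\<dots> \<le> K ^ j * b j" using that K b_nn by (intro mult_right_mono power_increasing) auto
      also have "\<dots> \<le> K ^ m * b m" using m that by blast
      finally have "K * b j \<le> b m" using K by simp
      then show ?thesis using K by (simp add: field_simps)
    qed
    have bj: "b j \<le> K ^ M * b m" if "j \<le> M" for j
    proof -
      have "b j \<le> K ^ j * b j" using K b_nn[of j] by (simp add: mult_le_cancel_right1)
      also have "\<dots> \<le> K ^ m * b m" using m that by blast
      also have "\<dots> \<le> K ^ M * b m" using m K b_nn by (intro mult_right_mono power_increasing) auto
      finally show ?thesis .
    qed
    have rem_cell: "\<bar>F y - (\<Sum>j\<le>M. P j (y - x))\<bar> \<le> b m / K" if y: "y \<in> dcell l x" for y
    proof -
      have ya: "\<bar>y $ i - a $ i\<bar> \<le> r" for i using cell8[OF y, of i] r by linarith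
      have "\<bar>y $ i - x $ i\<bar> \<le> h" for i using dcell_close[OF y] by (simp add: h_def)
      then have "\<bar>F y - (\<Sum>j\<le>M. P j (y - x))\<bar> \<le> A * (2 * (2 * h / r) ^ Suc M)"
        by (intro rem hs ya)
      then show ?thesis using tail by linarith
    qed
    have "\<rho> \<le> K' * b m"
    proof -
      have "\<bar>\<Sum>j\<le>M. P j (y1 - x)\<bar> \<le> (\<Sum>j\<le>M. K ^ M * b m)"
        using Pb[OF cellBox[OF y1(1)]] bj by (intro order_trans[OF sum_abs] sum_mono) (force intro: order_trans)
      moreover have "b m / K \<le> b m" using K bm by (simp add: field_simps)
      ultimately have "\<bar>F y1\<bar> \<le> (real M + 1) * (K ^ M * b m) + b m"
        using rem_cell[OF y1(1)] by (simp add: add.commute)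
      then show ?thesis using y1(2) by (simp add: K'_def algebra_simps)
    qed
    then have "\<epsilon> * \<rho> \<le> \<epsilon> * (K' * b m)" using \<epsilon> by (intro mult_left_mono) auto
    also have "\<dots> = b m / K" using K' by (simp add: \<epsilon>_def)
    finally have \<rho>: "\<epsilon> * \<rho> \<le> b m / K" .
    define E where "E = {y \<in> dcell l x. \<bar>F y\<bar> < \<epsilon> * \<rho>}"
    have E_meas: "E \<in> sets lebesgue"
      unfolding E_def by (rule sublevel_measurable[OF continuous_on_has_sum[OF F] Q])
    \<comment> \<open>Half of the supremum is enough, so no maximizer on \<open>Box\<close> has to
      be found.\<close>
    obtain v where v: "v \<in> Box" "b m / 2 < \<bar>P m v\<bar>"
    proof -
      have "b m / 2 < (SUP y\<in>Box. \<bar>P m y\<bar>)" using bm by (simp add: b_def)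
      then show ?thesis using less_cSUP_iff[OF ne bdd] that by blast
    qed
    have cardE: "card {i. i < N \<and> z + (real i / real N) *\<^sub>R v \<in> E} \<le> m" for z
    proof (rule card_sublevel_on_line[where P = P and F = F and x = x and b = b and K = K and M = M])
      show "divdiff T (\<lambda>t. P j (z + t *\<^sub>R v)) = (if j = m then P m v else 0)"
        if "finite T" "card T = Suc m" "j \<le> m" for T j z
        unfolding P_def using divdiff_taylor_part[OF b0 that] .
    qed (use E_def rem_cell Pb cellBox \<rho> m v bm decay \<open>N > 0\<close> K in auto)
    \<comment> \<open>Points of \<open>E\<close> are within \<open>h\<close> of \<open>x\<close>,
      and the translations are fractions of \<open>v\<close>, hence at most \<open>h\<close> in each
      coordinate.\<close>
    define Q' where "Q' = cbox (x - (\<chi> i. 2 * h)) (x + (\<chi> i. 2 * h))"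
    have Q'm: "measure lebesgue Q' = 4 ^ CARD('d) * h ^ CARD('d)"
    proof -
      have "measure lebesgue Q' = (\<Prod>i\<in>UNIV. (x + (\<chi> i. 2 * h)) $ i - (x - (\<chi> i. 2 * h)) $ i)"
        unfolding Q'_def using h by (subst measure_completion, simp, intro content_cbox_cart)
          (simp add: interval_ne_empty_cart)
      also have "\<dots> = (4 * h) ^ CARD('d)" by simp
      finally show ?thesis by (simp add: power_mult_distrib)
    qed
    have cellm: "emeasure lebesgue (dcell l x) = ennreal (h ^ CARD('d))"
      by (simp add: emeasure_dcell h_def power_mult)
    have E_lm: "E \<in> lmeasurable"
    proof (rule fmeasurableI[OF E_meas])
      have "emeasure lebesgue E \<le> emeasure lebesgue (dcell l x)"
        by (intro emeasure_mono) (auto simp: E_def)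
      then show "emeasure lebesgue E < \<infinity>" using cellm by (auto simp: top.not_eq_extremum intro: le_less_trans)
    qed
    have "real N * measure lebesgue E \<le> real m * measure lebesgue Q'"
    proof (rule translates_overlap[OF E_lm _ _ cardE])
      show "Q' \<in> lmeasurable" unfolding Q'_def by simp
      fix i z assume i: "i < N" and z: "z + (real i / real N) *\<^sub>R v \<in> E"
      have tri: "\<bar>p - q\<bar> \<le> 2 * h" if "\<bar>p + s - q\<bar> \<le> h" "\<bar>s\<bar> \<le> 1 * h" for p q s
        using that by linarith
      have "\<bar>z $ k - x $ k\<bar> \<le> 2 * h" for k
      proof -
        have "\<bar>(z + (real i / real N) *\<^sub>R v) $ k - x $ k\<bar> \<le> h"
          using z dcell_close[of "z + (real i / real N) *\<^sub>R v" l x k] by (simp add: E_def h_def)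
        moreover have "\<bar>(real i / real N) * v $ k\<bar> \<le> 1 * h"
          unfolding abs_mult using v(1) i by (intro mult_mono) (auto simp: Box_def)
        ultimately show ?thesis
          unfolding vector_add_component vector_scaleR_component real_scaleR_def by (rule tri)
      qed
      then have "x $ k - 2 * h \<le> z $ k \<and> z $ k \<le> x $ k + 2 * h" for k
        by (simp add: abs_le_iff algebra_simps)
      then show "z \<in> Q'" by (simp add: Q'_def mem_box_cart)
    qed
    also have "\<dots> \<le> real M * (4 ^ CARD('d) * h ^ CARD('d))"
      using m h by (simp add: Q'm mult_right_mono)
    also have "\<dots> \<le> real N * (\<eta> * h ^ CARD('d))"
    proof -
      have "real M * 4 ^ CARD('d) \<le> real N * \<eta>" using N \<eta> by (simp add: field_simps)
      then have "real M * 4 ^ CARD('d) * h ^ CARD('d) \<le> real N * \<eta> * h ^ CARD('d)"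
        using h by (intro mult_right_mono) auto
      then show ?thesis by (simp add: mult.assoc)
    qed
    finally have "measure lebesgue E \<le> \<eta> * h ^ CARD('d)" using \<open>N > 0\<close> by simp
    then have "emeasure lebesgue E \<le> ennreal (\<eta> * h ^ CARD('d))"
      using E_lm by (simp add: emeasure_eq_measure2 ennreal_leI)
    also have "\<dots> = ennreal \<eta> * emeasure lebesgue (dcell l x)"
      using \<eta> h by (simp add: cellm ennreal_mult)
    finally show "small_sublevel \<eta> \<epsilon> \<rho> F (dcell l x)"
      using E_meas unfolding small_sublevel_def E_def by blast
  qed (use \<epsilon> in auto)
qed

section \<open>Minors and covolumes of rational subspaces\<close>

definition integral_vec :: "real ^ 'k \<Rightarrow> bool" where
  "integral_vec v \<longleftrightarrow> (\<forall>i. v $ i \<in> \<int>)"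

lemma integral_vec_diff: "integral_vec u \<Longrightarrow> integral_vec v \<Longrightarrow> integral_vec (u - v)"
  by (simp add: integral_vec_def)

lemma integral_vec_lincomb:
  assumes "\<And>l. l \<in> S \<Longrightarrow> t l \<in> \<int>" "\<And>l. l \<in> S \<Longrightarrow> integral_vec (a l)"
  shows "integral_vec (\<Sum>l\<in>S. t l *\<^sub>R a l)"
  using assms by (auto simp: integral_vec_def intro!: Ints_sum Ints_mult)

lemma det_row_lincomb:
  fixes a c :: "_ \<Rightarrow> real ^ 'k"
  assumes "finite S"
  shows "det (\<chi> i. if i = k then (\<Sum>l\<in>S. t l *\<^sub>R a l) else c i)
    = (\<Sum>l\<in>S. t l * det (\<chi> i. if i = k then a l else c i))"
proof -
  have "det (\<chi> i. if i = k then (\<Sum>l\<in>S. t l *\<^sub>R a l) else c i)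
      = (\<Sum>l\<in>S. det (\<chi> i. if i = k then t l *s a l else c i))"
    unfolding scalar_mult_eq_scaleR[symmetric]
    using det_linear_row_sum[OF assms, where a = "\<lambda>_ l. t l *s a l" and k = k and c = c] by simp
  also have "\<dots> = (\<Sum>l\<in>S. t l * det (\<chi> i. if i = k then a l else c i))"
    by (intro sum.cong refl) (rule det_row_mul[where a = "\<lambda>_. a _"])
  finally show ?thesis .
qed

lemma det_Ints:
  fixes M :: "real ^ 'k ^ 'k"
  assumes "\<And>i j. M $ i $ j \<in> \<int>"
  shows "det M \<in> \<int>"
  unfolding det_def using assms by (intro Ints_sum Ints_mult Ints_prod) auto

text \<open>An arbitrary numbering of the index type. It singles out \<open>j\<close> rows for each
  \<open>j\<close>, so that tuples of every length are functions on the full index type and minors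
  are full determinants.\<close>

definition finite_index :: "'k::finite \<Rightarrow> nat" where
  "finite_index = (SOME f. bij_betw f UNIV {..<CARD('k)})"

abbreviation below :: "nat \<Rightarrow> 'k::finite set" where
  "below j \<equiv> {i. finite_index i < j}"

lemma finite_index_bij: "bij_betw (finite_index :: 'k::finite \<Rightarrow> nat) UNIV {..<CARD('k)}"
proof -
  have "\<exists>f. bij_betw (f :: 'k \<Rightarrow> nat) UNIV {..<CARD('k)}"
    using ex_bij_betw_finite_nat[of "UNIV :: 'k set"] by (simp add: lessThan_atLeast0)
  then show ?thesis unfolding finite_index_def by (rule someI_ex)
qed

lemma card_below:
  assumes "j \<le> CARD('k::finite)"
  shows "card (below j :: 'k set) = j"
proof -
  have "bij_betw (finite_index :: 'k \<Rightarrow> nat) (below j) {..<j}"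
    using finite_index_bij[where 'k = 'k] assms
    by (auto simp: bij_betw_def inj_on_def image_iff set_eq_iff) (metis le_trans not_le)
  then show ?thesis using bij_betw_same_card by fastforce
qed

lemma finite_index_eqD: "finite_index i = finite_index i' \<Longrightarrow> i = i'"
  using finite_index_bij by (meson UNIV_I bij_betw_def inj_onD)

text \<open>Up to sign, these are the \<open>j \<times> j\<close> minors of the tuple \<open>h (w i)\<close>, \<open>i \<in> below j\<close>, i.e. the
  coordinates of its exterior product: the remaining rows are filled up with unit vectors.\<close>

definition minor :: "nat \<Rightarrow> ('k \<Rightarrow> real ^ 'k) \<Rightarrow> (real ^ 'k \<Rightarrow> real ^ 'k) \<Rightarrow> ('k::finite \<Rightarrow> 'k) \<Rightarrow> real" where
  "minor j w h \<sigma> = det (\<chi> i. if finite_index i < j then h (w i) else axis (\<sigma> i) 1)"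

text \<open>The max norm of the exterior product. With this norm an upper or lower bound for the
  volume is a statement about single minors, which are affine in \<open>y\<close> for the maps
  considered later.\<close>

definition vol :: "nat \<Rightarrow> ('k \<Rightarrow> real ^ 'k) \<Rightarrow> (real ^ 'k \<Rightarrow> real ^ 'k) \<Rightarrow> real" where
  "vol j w h = Max (range (\<lambda>\<sigma> :: 'k::finite \<Rightarrow> 'k. \<bar>minor j w h \<sigma>\<bar>))"

lemma abs_minor_le_vol: "\<bar>minor j w h \<sigma>\<bar> \<le> vol j w h"
  unfolding vol_def by (intro Max_ge) auto

lemma vol_attained: "\<exists>\<sigma>. vol j w h = \<bar>minor j w h \<sigma>\<bar>"
proof -
  have "vol j w h \<in> range (\<lambda>\<sigma>. \<bar>minor j w h \<sigma>\<bar>)"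
    unfolding vol_def by (rule Max_in) auto
  then show ?thesis by blast
qed

lemma vol_le: "(\<And>\<sigma>. \<bar>minor j w h \<sigma>\<bar> \<le> B) \<Longrightarrow> vol j w h \<le> B"
  using vol_attained by metis

lemma vol_nonneg: "vol j w h \<ge> 0"
  using vol_attained abs_ge_zero by metis

text \<open>For the empty tuple all rows are unit vectors: the matrix is a permutation matrix or has
  two equal rows. This provides the covolume of the zero subspace at the bottom of a flag.\<close>

lemma vol_0_le_1: "vol 0 w h \<le> 1"
proof (rule vol_le)
  fix \<sigma> :: "'a \<Rightarrow> 'a"
  let ?M = "\<chi> i. (axis (\<sigma> i) 1 :: real ^ 'a)"
  have "\<bar>det ?M\<bar> \<le> 1"
  proof (cases "inj \<sigma>")
    case True
    then have "\<sigma> permutes UNIV"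
      by (intro bij_imp_permutes bijI finite_UNIV_inj_surj) auto
    then have "det (\<chi> i. (mat 1 :: real ^ 'a ^ 'a) $ \<sigma> i) = of_int (sign \<sigma>) * det (mat 1 :: real ^ 'a ^ 'a)"
      by (rule det_permute_rows)
    moreover have "(\<chi> i. (mat 1 :: real ^ 'a ^ 'a) $ \<sigma> i) = ?M"
      by (simp add: vec_eq_iff mat_def axis_def)
    ultimately show ?thesis by (auto simp: sign_def)
  next
    case False
    then obtain i j where "i \<noteq> j" "\<sigma> i = \<sigma> j" by (auto simp: inj_def)
    then have "det ?M = 0" by (intro det_identical_rows[of i j]) (auto simp: row_def)
    then show ?thesis by simp
  qed
  then show "\<bar>minor 0 w h \<sigma>\<bar> \<le> 1" by (simp add: minor_def)
qed

lemma span_image_coeffs: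
  assumes "x \<in> span (f ` S)" "finite S"
  shows "\<exists>t. x = (\<Sum>l\<in>S. t l *\<^sub>R f l)"
  using assms(1)
proof (induction rule: span_induct_alt)
  case base
  then show ?case by (intro exI[of _ "\<lambda>_. 0"]) simp
next
  case (step c x y)
  then obtain l t where l: "l \<in> S" "x = f l" and t: "y = (\<Sum>l\<in>S. t l *\<^sub>R f l)" by blast
  have "(\<Sum>i\<in>S. (t i + (if i = l then c else 0)) *\<^sub>R f i)
      = (\<Sum>i\<in>S. t i *\<^sub>R f i) + (\<Sum>i\<in>S. if i = l then c *\<^sub>R f i else 0)"
    by (simp add: scaleR_add_left sum.distrib if_distrib[of "\<lambda>c. c *\<^sub>R _"] cong: if_cong)
  also have "(\<Sum>i\<in>S. if i = l then c *\<^sub>R f i else 0) = c *\<^sub>R f l"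
    using assms(2) l(1) by simp
  finally show ?case using l t by (intro exI[of _ "\<lambda>i. t i + (if i = l then c else 0)"]) simp
qed

text \<open>Expressing \<open>w\<close> in terms of \<open>u\<close> is left multiplication by a
  matrix \<open>T\<close> that is the identity on the filled-up rows. The factor is
  \<open>det T\<close>, hence the same for all \<open>h\<close> and \<open>\<sigma>\<close>.\<close>

lemma minor_proportional:
  fixes u w :: "'k::finite \<Rightarrow> real ^ 'k"
  assumes "\<And>i. finite_index i < j \<Longrightarrow> w i \<in> span (u ` below j)"
  shows "\<exists>\<kappa>. \<forall>h \<sigma>. linear h \<longrightarrow> minor j w h \<sigma> = \<kappa> * minor j u h \<sigma>"
proof -
  have "\<exists>t. finite_index i < j \<longrightarrow> w i = (\<Sum>l\<in>below j. t l *\<^sub>R u l)" for i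
    using span_image_coeffs[OF assms[of i]] by auto
  then obtain t where t: "\<And>i. finite_index i < j \<Longrightarrow> w i = (\<Sum>l\<in>below j. t i l *\<^sub>R u l)"
    by metis
  define T :: "real ^ 'k ^ 'k" where
    "T = (\<chi> i l. if finite_index i < j then (if finite_index l < j then t i l else 0)
      else if i = l then 1 else 0)"
  have "minor j w h \<sigma> = det T * minor j u h \<sigma>" if h: "linear h" for h \<sigma>
  proof -
    let ?R = "\<lambda>w. \<chi> i. if finite_index i < j then h (w i) else (axis (\<sigma> i) 1 :: real ^ 'k)"
    have "?R w $ i = (T ** ?R u) $ i" for i
    proof (cases "finite_index i < j")
      case True
      then have "h (w i) = (\<Sum>l\<in>below j. t i l *\<^sub>R h (u l))"
        using h by (simp add: t linear_sum linear_scale)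
      moreover have "(\<Sum>l\<in>below j. t i l * h (u l) $ c)
          = (\<Sum>l\<in>UNIV. (if finite_index l < j then t i l else 0) * ?R u $ l $ c)" for c
        by (rule sum.mono_neutral_cong_left) auto
      ultimately show ?thesis using True
        by (simp add: vec_eq_iff matrix_matrix_mult_def T_def)
    next
      case False
      have "(\<Sum>l\<in>UNIV. (if i = l then 1 else 0) * ?R u $ l $ c) = ?R u $ i $ c" for c
        by (simp add: if_distrib[of "\<lambda>x. x * _"] cong: if_cong)
      then show ?thesis using False
        by (simp add: vec_eq_iff matrix_matrix_mult_def T_def)
    qed
    then have "?R w = T ** ?R u" by (simp add: vec_eq_iff)
    then show ?thesis by (simp add: minor_def det_mul)
  qed
  then show ?thesis by blast
qed

lemma minor_Ints:
  assumes "\<And>i. finite_index i < j \<Longrightarrow> integral_vec (w i)"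
  shows "minor j w id \<sigma> \<in> \<int>"
  unfolding minor_def using assms by (intro det_Ints) (auto simp: integral_vec_def axis_def)

text \<open>The independent vectors \<open>h (w i)\<close> can be completed to a basis by unit
  vectors; the unit vectors chosen give \<open>\<sigma>\<close>.\<close>

lemma exists_nonzero_minor:
  fixes w :: "'k::finite \<Rightarrow> real ^ 'k"
  assumes w: "inj_on w (below j)" "independent (w ` below j)" and h: "linear h" "inj h"
  shows "\<exists>\<sigma>. minor j w h \<sigma> \<noteq> 0"
proof -
  let ?B0 = "(\<lambda>i. h (w i)) ` below j" and ?E = "range (\<lambda>c :: 'k. axis c (1 :: real))"
  have inj0: "inj_on (\<lambda>i. h (w i)) (below j)"
    using w(1) h(2) by (auto simp: inj_on_def)
  have ind0: "independent ?B0"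
    using linear_independent_injective_image[OF h(1) w(2)] h(2)
    by (simp add: image_image inj_on_subset)
  obtain B where B: "?B0 \<subseteq> B" "B \<subseteq> ?B0 \<union> ?E" "independent B" "?B0 \<union> ?E \<subseteq> span B"
    using maximal_independent_subset_extend[of ?B0 "?B0 \<union> ?E"] ind0 by blast
  have "Basis \<subseteq> (?E :: (real ^ 'k) set)" by (auto simp: Basis_vec_def)
  then have "Basis \<subseteq> span B" using B(4) by blast
  then have spB: "span B = UNIV" by (metis span_Basis span_mono span_span top.extremum_uniqueI)
  have finB: "finite B" using B(3) by (simp add: independent_imp_finite)
  have cardB: "card B = CARD('k)"
    using dim_eq_card[of B UNIV] spB B(3) by simp
  have "card (- below j :: 'k set) = card (B - ?B0)"
    using B(1) finB cardB inj0 by (simp add: card_Diff_subset card_image Compl_eq_Diff_UNIV)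
  then obtain g where g: "bij_betw g (- below j :: 'k set) (B - ?B0)"
    using finB finite_same_card_bij by (metis finite finite_Diff)
  have "g i \<in> ?E" if "\<not> finite_index i < j" for i
    using g B(2) that unfolding bij_betw_def by blast
  then have "\<exists>c. \<not> finite_index i < j \<longrightarrow> g i = axis c 1" for i by blast
  then obtain \<sigma> where \<sigma>: "\<And>i. \<not> finite_index i < j \<Longrightarrow> g i = axis (\<sigma> i) 1" by metis
  let ?M = "\<chi> i. if finite_index i < j then h (w i) else (axis (\<sigma> i) 1 :: real ^ 'k)"
  have "row i ?M = (if finite_index i < j then h (w i) else g i)" for i
    by (simp add: row_def vec_eq_iff \<sigma>)
  moreover have "rows ?M = range (\<lambda>i. row i ?M)" by (auto simp: rows_def)
  ultimately have "rows ?M = (\<lambda>i. if finite_index i < j then h (w i) else g i) ` UNIV"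
    by (simp only:)
  also have "\<dots> = ?B0 \<union> g ` (- below j)" by auto
  also have "\<dots> = B" using g B(1) by (auto simp: bij_betw_def)
  finally have "rank ?M = CARD('k)"
    using cardB B(3) by (simp add: row_rank_def dim_eq_card_independent)
  then have "det ?M \<noteq> 0" by (simp add: det_eq_0_rank)
  then show ?thesis by (auto simp: minor_def)
qed

text \<open>Bases of \<open>W\<close> made of integral vectors, but not necessarily of the lattice
  of all integral points in \<open>W\<close>. Independence follows from spanning by
  \<open>dim W\<close> vectors.\<close>

definition tuples :: "(real ^ 'k) set \<Rightarrow> ('k::finite \<Rightarrow> real ^ 'k) set" where
  "tuples W = {w. (\<forall>i\<in>below (dim W). integral_vec (w i)) \<and> span (w ` below (dim W)) = W}"

definition rational_subspaces :: "(real ^ 'k::finite) set set" where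
  "rational_subspaces = {W. W \<noteq> {0} \<and> (\<exists>S. (\<forall>v\<in>S. integral_vec v) \<and> W = span S)}"

lemma dim_le_CARD: "dim (W :: (real ^ 'k) set) \<le> CARD('k)"
  by (rule dim_subset_UNIV_cart)

lemma tuples_independent:
  fixes w :: "'k::finite \<Rightarrow> real ^ 'k"
  assumes "w \<in> tuples W"
  shows "inj_on w (below (dim W))" "independent (w ` below (dim W))"
proof -
  let ?S = "below (dim W) :: 'k set"
  have sp: "span (w ` ?S) = W" using assms by (simp add: tuples_def)
  have c: "card ?S = dim W" by (intro card_below dim_le_CARD)
  have "dim W \<le> card (w ` ?S)" using sp by (intro dim_le_card) auto
  moreover have "card (w ` ?S) \<le> card ?S" by (intro card_image_le) simp
  ultimately have eq: "card (w ` ?S) = dim W" using c by simp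
  then show "inj_on w ?S" using c by (intro eq_card_imp_inj_on) auto
  show "independent (w ` ?S)"
    using sp eq by (intro card_le_dim_spanning[of _ W]) (auto intro: span_base)
qed

lemma tuples_nonempty:
  fixes S :: "(real ^ 'k::finite) set"
  assumes "\<forall>v\<in>S. integral_vec v"
  shows "tuples (span S) \<noteq> {}"
proof -
  obtain B where B: "B \<subseteq> S" "independent B" "S \<subseteq> span B" "card B = dim S"
    by (rule basis_exists)
  have "finite B" using B by (simp add: independent_imp_finite)
  moreover have "card (below (dim (span S)) :: 'k set) = card B"
    using card_below[OF dim_le_CARD[of "span S"]] B by simp
  ultimately obtain w where w: "bij_betw w (below (dim (span S)) :: 'k set) B"
    using finite_same_card_bij by (metis finite)
  have "span B = span S" using B by (metis span_mono span_span subset_antisym)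
  then have "w \<in> tuples (span S)"
    using w B assms by (force simp: tuples_def bij_betw_def)
  then show ?thesis by blast
qed

text \<open>Tuples with the same span have proportional minors, so minimizing the volume at the identity
  minimizes it for every \<open>h\<close>; this replaces the choice of a basis of the lattice points in \<open>W\<close>.\<close>

definition rep :: "(real ^ 'k) set \<Rightarrow> 'k::finite \<Rightarrow> real ^ 'k" where
  "rep W = arg_min (\<lambda>w. nat \<lfloor>vol (dim W) w id\<rfloor>) (\<lambda>w. w \<in> tuples W)"

definition covol :: "(real ^ 'k) set \<Rightarrow> (real ^ 'k \<Rightarrow> real ^ 'k::finite) \<Rightarrow> real" where
  "covol W h = vol (dim W) (rep W) h"

text \<open>At the identity the minors of integral vectors are integers. The rounding in
  \<open>rep\<close> therefore changes nothing, and a minimum over the naturals exists.\<close>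

lemma vol_id_eq_nat:
  assumes "w \<in> tuples W"
  shows "vol (dim W) w id = real (nat \<lfloor>vol (dim W) w id\<rfloor>)"
proof -
  obtain \<sigma> where "vol (dim W) w id = \<bar>minor (dim W) w id \<sigma>\<bar>" using vol_attained by blast
  moreover have "minor (dim W) w id \<sigma> \<in> \<int>"
    using assms by (intro minor_Ints) (auto simp: tuples_def)
  ultimately have "vol (dim W) w id \<in> \<int>" by simp
  then show ?thesis using vol_nonneg[of "dim W" w id] by (auto elim!: Ints_cases)
qed

lemma rep_tuples:
  assumes "tuples W \<noteq> {}"
  shows "rep W \<in> tuples W" "w \<in> tuples W \<Longrightarrow> vol (dim W) (rep W) id \<le> vol (dim W) w id"
proof -
  let ?m = "\<lambda>w. nat \<lfloor>vol (dim W) w id\<rfloor>"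
  obtain w0 where w0: "w0 \<in> tuples W" using assms by blast
  show *: "rep W \<in> tuples W"
    unfolding rep_def by (rule arg_min_natI[where P = "\<lambda>w. w \<in> tuples W", OF w0])
  assume w: "w \<in> tuples W"
  have "?m (rep W) \<le> ?m w" unfolding rep_def by (rule arg_min_nat_le[where P = "\<lambda>w. w \<in> tuples W", OF w])
  then show "vol (dim W) (rep W) id \<le> vol (dim W) w id"
    using vol_id_eq_nat[OF *] vol_id_eq_nat[OF w] by linarith
qed

lemma covol_le_vol:
  assumes w: "w \<in> tuples W" and h: "linear h"
  shows "covol W h \<le> vol (dim W) w h"
proof -
  have ne: "tuples W \<noteq> {}" using w by blast
  note rep = rep_tuples[OF ne]
  have "w i \<in> span (rep W ` below (dim W))" if "finite_index i < dim W" for i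
  proof -
    have "w i \<in> span (w ` below (dim W))" using that by (intro span_base) auto
    then show ?thesis using rep(1) w by (simp add: tuples_def)
  qed
  then obtain \<kappa> where \<kappa>: "\<And>h \<sigma>. linear h \<Longrightarrow> minor (dim W) w h \<sigma> = \<kappa> * minor (dim W) (rep W) h \<sigma>"
    using minor_proportional[of "dim W" w "rep W"] by blast
  have lid: "linear (id :: real ^ 'a \<Rightarrow> real ^ 'a)" by (rule linear_id)
  obtain \<sigma>0 where \<sigma>0: "minor (dim W) (rep W) id \<sigma>0 \<noteq> 0"
    using exists_nonzero_minor[OF tuples_independent[OF rep(1)] lid inj_on_id] by blast
  then have pos: "vol (dim W) (rep W) id > 0"
    using abs_minor_le_vol[of "dim W" "rep W" id \<sigma>0] by linarith
  obtain \<sigma>1 where "vol (dim W) w id = \<bar>minor (dim W) w id \<sigma>1\<bar>" using vol_attained by blast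
  then have "vol (dim W) (rep W) id \<le> \<bar>\<kappa>\<bar> * \<bar>minor (dim W) (rep W) id \<sigma>1\<bar>"
    using rep(2)[OF w] \<kappa>[OF lid] by (simp add: abs_mult)
  also have "\<dots> \<le> \<bar>\<kappa>\<bar> * vol (dim W) (rep W) id"
    by (intro mult_left_mono abs_minor_le_vol) simp
  finally have "\<bar>\<kappa>\<bar> \<ge> 1" using pos by simp
  show ?thesis unfolding covol_def
  proof (rule vol_le)
    fix \<sigma>
    have "\<bar>minor (dim W) (rep W) h \<sigma>\<bar> \<le> \<bar>\<kappa>\<bar> * \<bar>minor (dim W) (rep W) h \<sigma>\<bar>"
      using \<open>\<bar>\<kappa>\<bar> \<ge> 1\<close> by (simp add: mult_le_cancel_right1)
    also have "\<dots> = \<bar>minor (dim W) w h \<sigma>\<bar>" using \<kappa>[OF h] by (simp add: abs_mult)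
    also have "\<dots> \<le> vol (dim W) w h" by (rule abs_minor_le_vol)
    finally show "\<bar>minor (dim W) (rep W) h \<sigma>\<bar> \<le> vol (dim W) w h" .
  qed
qed

lemma axis_expansion: "(x :: real ^ 'k) = (\<Sum>c\<in>UNIV. x $ c *\<^sub>R axis c 1)"
  by (simp add: vec_eq_iff axis_def if_distrib cong: if_cong)

text \<open>Expanding the new row \<open>h v\<close> into unit vectors writes a minor of the longer
  tuple as a combination of minors of the shorter one with coefficients at most \<open>B\<close>.
  Adding a short vector thus produces a small covolume.\<close>

lemma vol_extend:
  fixes w :: "'k::finite \<Rightarrow> real ^ 'k" and B :: real
  assumes i0: "finite_index i0 = j" and B: "\<And>c. \<bar>h v $ c\<bar> \<le> B"
  shows "vol (Suc j) (w(i0 := v)) h \<le> CARD('k) * B * vol j w h"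
proof (rule vol_le)
  fix \<sigma> :: "'k \<Rightarrow> 'k"
  let ?R = "\<lambda>i. if finite_index i < j then h (w i) else (axis (\<sigma> i) 1 :: real ^ 'k)"
  have idx: "finite_index i < Suc j \<longleftrightarrow> finite_index i < j \<or> i = i0" for i
    using i0 finite_index_eqD[of i i0] by (auto simp: less_Suc_eq)
  have "minor (Suc j) (w(i0 := v)) h \<sigma> = det (\<chi> i. if i = i0 then h v else ?R i)"
    unfolding minor_def using i0 by (intro arg_cong[of _ _ det]) (auto simp: vec_eq_iff idx)
  also have "\<dots> = det (\<chi> i. if i = i0 then (\<Sum>c\<in>UNIV. h v $ c *\<^sub>R axis c 1) else ?R i)"
    by (subst axis_expansion[of "h v"]) (rule refl)
  also have "\<dots> = (\<Sum>c\<in>UNIV. h v $ c * det (\<chi> i. if i = i0 then axis c 1 else ?R i))"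
    by (rule det_row_lincomb) simp
  also have "\<dots> = (\<Sum>c\<in>UNIV. h v $ c * minor j w h (\<sigma>(i0 := c)))"
    unfolding minor_def using i0
    by (intro sum.cong refl arg_cong2[of _ _ _ _ "(*)"] arg_cong[of _ _ det]) (auto simp: vec_eq_iff)
  finally have "\<bar>minor (Suc j) (w(i0 := v)) h \<sigma>\<bar> = \<bar>\<Sum>c\<in>UNIV. h v $ c * minor j w h (\<sigma>(i0 := c))\<bar>"
    by simp
  also have "\<dots> \<le> (\<Sum>c\<in>(UNIV :: 'k set). B * vol j w h)"
    using B abs_minor_le_vol[of j w h]
    by (intro order_trans[OF sum_abs] sum_mono) (auto simp: abs_mult intro!: mult_mono intro: order_trans[OF abs_ge_zero])
  finally show "\<bar>minor (Suc j) (w(i0 := v)) h \<sigma>\<bar> \<le> CARD('k) * B * vol j w h" by simp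
qed

section \<open>Short vectors and covolumes\<close>

text \<open>If no two points of \<open>X\<close> differed by an integral vector, the pieces of
  \<open>X\<close> in the unit cells could be translated into the cell of the origin without
  overlap, and their total measure would be at most 1.\<close>

lemma blichfeldt:
  fixes X :: "(real ^ 'k) set"
  assumes X: "X \<in> lmeasurable" "measure lebesgue X > 1"
  shows "\<exists>x\<in>X. \<exists>y\<in>X. x \<noteq> y \<and> integral_vec (x - y)"
proof (rule ccontr)
  assume no: "\<not> ?thesis"
  define fl :: "real ^ 'k \<Rightarrow> real ^ 'k" where "fl x = (\<chi> i. of_int \<lfloor>x $ i\<rfloor>)" for x
  define Z where "Z = range fl"
  have "Z \<subseteq> range (\<lambda>z :: 'k \<Rightarrow> int. \<chi> i. real_of_int (z i))"
    by (force simp: Z_def fl_def)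
  then have cZ: "countable Z" by (rule countable_subset) (rule countable_image, simp)
  have Zint: "integral_vec z" if "z \<in> Z" for z using that by (auto simp: Z_def fl_def integral_vec_def)
  have cell: "x \<in> dcell 0 z \<longleftrightarrow> fl x = z" if "z \<in> Z" for x z
    using that by (auto simp: Z_def fl_def dcell_def vec_eq_iff)
  define T where "T = (\<lambda>z. (+) (- z) ` (X \<inter> dcell 0 z))"
  have pm: "X \<inter> dcell 0 z \<in> lmeasurable" for z
    using X by (intro fmeasurable_Int_fmeasurable) auto
  have Tm: "T z \<in> lmeasurable" "emeasure lebesgue (T z) = emeasure lebesgue (X \<inter> dcell 0 z)" for z
  proof -
    show 1: "T z \<in> lmeasurable" unfolding T_def by (rule measurable_translation[OF pm])
    have "measure lebesgue (T z) = measure lebesgue (X \<inter> dcell 0 z)"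
      unfolding T_def by (rule measure_translation)
    then show "emeasure lebesgue (T z) = emeasure lebesgue (X \<inter> dcell 0 z)"
      using 1 pm[of z] by (simp add: emeasure_eq_measure2)
  qed
  have disjT: "disjoint_family_on T Z"
    unfolding disjoint_family_on_def
  proof (intro ballI impI, rule ccontr)
    fix z z' assume z: "z \<in> Z" "z' \<in> Z" "z \<noteq> z'" "T z \<inter> T z' \<noteq> {}"
    then obtain x y where xy: "x \<in> X" "y \<in> X" "x \<in> dcell 0 z" "y \<in> dcell 0 z'" "- z + x = - z' + y"
      by (auto simp: T_def)
    then have "x - y = z - z'" by (simp add: algebra_simps)
    then have "integral_vec (x - y)" using Zint z by (simp add: integral_vec_diff)
    then have "x = y" using no xy by blast
    then show False using xy z cell by metis
  qed
  have disjX: "disjoint_family_on (\<lambda>z. X \<inter> dcell 0 z) Z"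
    using cell by (fastforce simp: disjoint_family_on_def)
  have "X = (\<Union>z\<in>Z. X \<inter> dcell 0 z)"
  proof -
    have "x \<in> dcell 0 (fl x)" for x by (simp add: dcell_def fl_def)
    then show ?thesis by (auto simp: Z_def)
  qed
  then have "emeasure lebesgue X = (\<integral>\<^sup>+z. emeasure lebesgue (X \<inter> dcell 0 z) \<partial>count_space Z)"
    using emeasure_UN_countable[OF _ cZ disjX, of lebesgue] pm by (simp add: fmeasurableD)
  also have "\<dots> = (\<integral>\<^sup>+z. emeasure lebesgue (T z) \<partial>count_space Z)" by (simp add: Tm)
  also have "\<dots> = emeasure lebesgue (\<Union>z\<in>Z. T z)"
    using Tm by (intro emeasure_UN_countable[symmetric] cZ disjT) (auto simp: fmeasurableD)
  also have "\<dots> \<le> emeasure lebesgue (dcell 0 (0 :: real ^ 'k))"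
  proof (rule emeasure_mono)
    show "(\<Union>z\<in>Z. T z) \<subseteq> dcell 0 0"
    proof
      fix y assume "y \<in> (\<Union>z\<in>Z. T z)"
      then obtain z x where z: "z \<in> Z" "x \<in> dcell 0 z" "y = x - z" by (auto simp: T_def)
      then have "z = fl x" using cell[OF z(1), of x] by simp
      then have "0 \<le> y $ i \<and> y $ i < 1" for i using z by (simp add: fl_def) linarith
      then show "y \<in> dcell 0 0" by (simp add: dcell_def floor_eq_iff)
    qed
  qed simp
  also have "\<dots> = 1" by (simp add: emeasure_dcell)
  finally have "measure lebesgue X \<le> 1"
    using X(1) by (simp add: emeasure_eq_measure2)
  then show False using X by simp
qed

text \<open>The preimage of the box with sides \<open>e c\<close> under the forms has measure above
  1, so it contains two points with integral difference. The box is centred with half-sides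
  \<open>e c / 2\<close>, which makes the difference at most \<open>e c\<close>. The strict
  determinant inequality spares a compactness argument.\<close>

lemma minkowski_linear_forms:
  fixes M :: "real ^ 'k::{finite,wellorder} ^ 'k::_" and e :: "'k \<Rightarrow> real"
  assumes M: "det M \<noteq> 0" and e: "\<And>c. e c > 0" and less: "\<bar>det M\<bar> < (\<Prod>c\<in>UNIV. e c)"
  shows "\<exists>a. integral_vec a \<and> a \<noteq> 0 \<and> (\<forall>c. \<bar>\<Sum>i\<in>UNIV. a $ i * M $ i $ c\<bar> \<le> e c)"
proof -
  define N where "N = transpose M"
  have N: "det N \<noteq> 0" using M by (simp add: N_def)
  then obtain N' where inv: "N ** N' = mat 1" "N' ** N = mat 1"
    by (auto simp: invertible_det_nz[symmetric] invertible_def)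
  define Q where "Q = cbox (- (\<chi> c. e c / 2)) (\<chi> c. e c / 2)"
  define X where "X = (\<lambda>b. N' *v b) ` Q"
  have Xm: "X \<in> lmeasurable"
    unfolding X_def Q_def by (rule measurable_linear_image[OF matrix_vector_mul_linear]) simp
  have NX: "(\<lambda>a. N *v a) ` X = Q"
    unfolding X_def image_image by (simp add: matrix_vector_mul_assoc inv)
  have "measure lebesgue Q = (\<Prod>c\<in>UNIV. (\<chi> c. e c / 2) $ c - (- (\<chi> c. e c / 2)) $ c)"
    unfolding Q_def using e by (subst measure_completion, simp, intro content_cbox_cart)
      (auto simp: interval_ne_empty_cart intro: order_trans[of _ 0] less_imp_le)
  then have "measure lebesgue Q = (\<Prod>c\<in>UNIV. e c)" by simp
  moreover have "measure lebesgue Q = \<bar>det N\<bar> * measure lebesgue X"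
    unfolding NX[symmetric] using Xm by (subst measure_linear_image) auto
  ultimately have "\<bar>det M\<bar> * 1 < \<bar>det M\<bar> * measure lebesgue X" using less by (simp add: N_def)
  then have "measure lebesgue X > 1" using M by (simp add: mult_less_cancel_left_pos del: mult_1_right)
  then obtain x y where xy: "x \<in> X" "y \<in> X" "x \<noteq> y" "integral_vec (x - y)"
    using blichfeldt[OF Xm] by blast
  have "\<bar>(N *v (x - y)) $ c\<bar> \<le> e c" for c
  proof -
    have "N *v x \<in> Q" "N *v y \<in> Q" using xy NX by auto
    then have "- (e c / 2) \<le> (N *v x) $ c \<and> (N *v x) $ c \<le> e c / 2"
      "- (e c / 2) \<le> (N *v y) $ c \<and> (N *v y) $ c \<le> e c / 2"
      by (auto simp: Q_def mem_box_cart dest!: spec[of _ c])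
    then show ?thesis by (simp only: matrix_vector_mult_diff_distrib vector_minus_component) linarith
  qed
  moreover have "(N *v (x - y)) $ c = (\<Sum>i\<in>UNIV. (x - y) $ i * M $ i $ c)" for c
    by (simp add: N_def matrix_vector_mult_def transpose_def mult.commute)
  ultimately show ?thesis using xy by (intro exI[of _ "x - y"]) auto
qed

lemma minor_eq_0:
  assumes "\<not> finite_index i < j" "\<not> finite_index i' < j" "i \<noteq> i'" "\<sigma> i = \<sigma> i'"
  shows "minor j w h \<sigma> = 0"
  unfolding minor_def using assms by (intro det_identical_rows[of i i']) (auto simp: row_def)

text \<open>Cramer's rule: the determinant with \<open>u\<close> in row \<open>i\<close> vanishes, and is expanded along that row.\<close>

lemma coord_le_of_maximal_minor:
  fixes w :: "'k::finite \<Rightarrow> real ^ 'k"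
  assumes max: "vol j w h = \<bar>minor j w h \<sigma>\<bar>" "minor j w h \<sigma> \<noteq> 0"
    and i: "\<not> finite_index i < j"
    and u: "u = (\<Sum>l\<in>below j. t l *\<^sub>R h (w l))"
  shows "\<bar>u $ \<sigma> i\<bar> \<le> (\<Sum>c\<in>- \<sigma> ` (- below j). \<bar>u $ c\<bar>)"
proof -
  let ?R = "\<lambda>i. if finite_index i < j then h (w i) else (axis (\<sigma> i) 1 :: real ^ 'k)"
  let ?m = "\<lambda>c. minor j w h (\<sigma>(i := c))"
  have "det (\<chi> k. if k = i then u else ?R k) = (\<Sum>l\<in>below j. t l * det (\<chi> k. if k = i then h (w l) else ?R k))"
    unfolding u by (rule det_row_lincomb) simp
  also have "\<dots> = 0"
  proof (intro sum.neutral ballI)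
    fix l :: 'k assume l: "l \<in> below j"
    then have "l \<noteq> i" using i by auto
    then have "det (\<chi> k. if k = i then h (w l) else ?R k) = 0"
      using l by (intro det_identical_rows[of l i]) (auto simp: row_def)
    then show "t l * det (\<chi> k. if k = i then h (w l) else ?R k) = 0" by simp
  qed
  finally have "0 = det (\<chi> k. if k = i then (\<Sum>c\<in>UNIV. u $ c *\<^sub>R axis c 1) else ?R k)"
    by (subst (asm) axis_expansion[of u]) simp
  also have "\<dots> = (\<Sum>c\<in>UNIV. u $ c * det (\<chi> k. if k = i then axis c 1 else ?R k))"
    by (rule det_row_lincomb) simp
  also have "\<dots> = (\<Sum>c\<in>UNIV. u $ c * ?m c)"
    unfolding minor_def using i
    by (intro sum.cong refl arg_cong2[of _ _ _ _ "(*)"] arg_cong[of _ _ det]) (auto simp: vec_eq_iff)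
  also have "\<dots> = u $ \<sigma> i * ?m (\<sigma> i) + (\<Sum>c\<in>UNIV - {\<sigma> i}. u $ c * ?m c)"
    by (rule sum.remove) auto
  also have "(\<Sum>c\<in>UNIV - {\<sigma> i}. u $ c * ?m c) = (\<Sum>c\<in>- \<sigma> ` (- below j). u $ c * ?m c)"
  proof (rule sum.mono_neutral_right)
    show "- \<sigma> ` (- below j) \<subseteq> UNIV - {\<sigma> i}" using i by auto
    show "\<forall>c\<in>UNIV - {\<sigma> i} - (- \<sigma> ` (- below j)). u $ c * ?m c = 0"
    proof
      fix c assume "c \<in> UNIV - {\<sigma> i} - (- \<sigma> ` (- below j))"
      then obtain i' where "c = \<sigma> i'" "\<not> finite_index i' < j" "i' \<noteq> i" by auto
      then have "?m c = 0" using i by (intro minor_eq_0[of i j i']) auto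
      then show "u $ c * ?m c = 0" by simp
    qed
  qed simp
  finally have "u $ \<sigma> i * minor j w h \<sigma> = - (\<Sum>c\<in>- \<sigma> ` (- below j). u $ c * ?m c)"
    by simp
  \<comment> \<open>Maximality of the minor at \<open>\<sigma>\<close> makes every quotient in
    Cramer's rule at most 1 in absolute value.\<close>
  then have "\<bar>u $ \<sigma> i\<bar> * vol j w h = \<bar>\<Sum>c\<in>- \<sigma> ` (- below j). u $ c * ?m c\<bar>"
    using max(1) by (metis abs_minus_cancel abs_mult)
  also have "\<dots> \<le> (\<Sum>c\<in>- \<sigma> ` (- below j). \<bar>u $ c\<bar> * vol j w h)"
    by (intro order_trans[OF sum_abs] sum_mono) (auto simp: abs_mult intro!: mult_left_mono abs_minor_le_vol)
  finally have "\<bar>u $ \<sigma> i\<bar> * vol j w h \<le> (\<Sum>c\<in>- \<sigma> ` (- below j). \<bar>u $ c\<bar>) * vol j w h"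
    by (simp add: sum_distrib_right)
  moreover have "vol j w h > 0" using max by simp
  ultimately show ?thesis by simp
qed

text \<open>This is Minkowski's theorem for a lattice of lower rank, reduced to full rank by adding
  unit vectors as rows. The forms give an integral combination of all rows; its part
  \<open>u\<close> from \<open>W\<close> is small in the coordinates \<open>I\<close> avoided by the
  unit vectors, and Cramer's rule makes it small in the others. The integer coefficients of the unit
  vectors are then below 1 in absolute value, so they vanish and \<open>u\<close> is the image of a
  nonzero integral vector of \<open>W\<close>.\<close>

lemma covol_ge_of_no_short_vectors:
  fixes h :: "real ^ 'k::{finite,wellorder} \<Rightarrow> real ^ 'k::_"
  assumes h: "linear h" "inj h" and W: "tuples W \<noteq> {}"
    and c: "0 < c" "c \<le> 1"
    and short: "\<And>v. integral_vec v \<Longrightarrow> v \<noteq> 0 \<Longrightarrow> \<exists>i. c \<le> \<bar>h v $ i\<bar>"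
  shows "(c / (4 * CARD('k))) ^ CARD('k) \<le> covol W h"
proof (rule ccontr)
  let ?k = "CARD('k)" and ?j = "dim W" and ?w = "rep W"
  define \<epsilon> where "\<epsilon> = c / (4 * ?k)"
  have k: "real ?k \<ge> 1" by (simp add: Suc_leI)
  have \<epsilon>: "\<epsilon> > 0" "?k * \<epsilon> = c / 4" using c k by (auto simp: \<epsilon>_def)
  have "\<epsilon> \<le> ?k * \<epsilon>" using k \<epsilon>(1) by (simp add: mult_le_cancel_right1)
  then have \<epsilon>4: "\<epsilon> \<le> c / 4" "\<epsilon> \<le> 1 / 2" using \<epsilon> c by auto
  assume "\<not> ?thesis"
  then have less: "vol ?j ?w h < \<epsilon> ^ ?k" by (simp add: covol_def \<epsilon>_def)
  have wt: "?w \<in> tuples W" by (rule rep_tuples(1)[OF W])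
  obtain \<sigma>0 where \<sigma>0: "minor ?j ?w h \<sigma>0 \<noteq> 0"
    using exists_nonzero_minor[OF tuples_independent[OF wt] h] by blast
  obtain \<sigma> where \<sigma>: "vol ?j ?w h = \<bar>minor ?j ?w h \<sigma>\<bar>" using vol_attained by blast
  have nz: "minor ?j ?w h \<sigma> \<noteq> 0" using \<sigma> \<sigma>0 abs_minor_le_vol[of ?j ?w h \<sigma>0] by auto
  have inj\<sigma>: "\<sigma> i \<noteq> \<sigma> i'" if "\<not> finite_index i < ?j" "\<not> finite_index i' < ?j" "i \<noteq> i'" for i i'
    using minor_eq_0[OF that] nz by blast
  define M where "M = (\<chi> i. if finite_index i < ?j then h (?w i) else axis (\<sigma> i) 1)"
  define I where "I = - \<sigma> ` (- below ?j)"
  \<comment> \<open>Tolerance 1/2 suffices in the coordinates of the unit vectors: there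
    \<open>u\<close> is at most \<open>CARD('k) * \<epsilon> = c / 4\<close>, and
    \<open>1 / 2 + c / 4\<close> is less than 1.\<close>
  define e where "e = (\<lambda>c. if c \<in> I then \<epsilon> else 1 / 2)"
  have "\<epsilon> ^ ?k = (\<Prod>c\<in>(UNIV :: 'k set). \<epsilon>)" by simp
  also have "\<dots> \<le> (\<Prod>c\<in>UNIV. e c)" using \<epsilon> \<epsilon>4 by (intro prod_mono) (auto simp: e_def)
  finally have "\<bar>det M\<bar> < (\<Prod>c\<in>UNIV. e c)" using less \<sigma> by (simp add: M_def minor_def)
  moreover have "det M \<noteq> 0" using nz by (simp add: M_def minor_def)
  moreover have "e c > 0" for c using \<epsilon> by (simp add: e_def)
  ultimately obtain a where a: "integral_vec a" "a \<noteq> 0" "\<And>c. \<bar>\<Sum>i\<in>UNIV. a $ i * M $ i $ c\<bar> \<le> e c"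
    using minkowski_linear_forms[of M e] by blast
  define u where "u = (\<Sum>l\<in>below ?j. a $ l *\<^sub>R h (?w l))"
  have coord: "(\<Sum>i\<in>UNIV. a $ i * M $ i $ c) = u $ c + (\<Sum>i\<in>- below ?j. if \<sigma> i = c then a $ i else 0)" for c
  proof -
    have "(\<Sum>i\<in>UNIV. a $ i * M $ i $ c) = (\<Sum>i\<in>below ?j. a $ i * M $ i $ c) + (\<Sum>i\<in>- below ?j. a $ i * M $ i $ c)"
      by (subst sum.union_disjoint[symmetric]) (auto intro!: sum.cong)
    also have "(\<Sum>i\<in>below ?j. a $ i * M $ i $ c) = u $ c" by (simp add: u_def M_def)
    also have "(\<Sum>i\<in>- below ?j. a $ i * M $ i $ c) = (\<Sum>i\<in>- below ?j. if \<sigma> i = c then a $ i else 0)"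
      by (intro sum.cong refl) (auto simp: M_def axis_def)
    finally show ?thesis .
  qed
  have uI: "\<bar>u $ c\<bar> \<le> \<epsilon>" if "c \<in> I" for c
  proof -
    have "(\<Sum>i\<in>- below ?j. if \<sigma> i = c then a $ i else 0) = 0"
      using that by (intro sum.neutral) (auto simp: I_def)
    then show ?thesis using a(3)[of c] coord[of c] that by (simp add: e_def)
  qed
  have u\<sigma>: "\<bar>u $ \<sigma> i\<bar> \<le> c / 4" if i: "\<not> finite_index i < ?j" for i
  proof -
    have "\<bar>u $ \<sigma> i\<bar> \<le> (\<Sum>c\<in>I. \<bar>u $ c\<bar>)"
      unfolding I_def by (rule coord_le_of_maximal_minor[OF \<sigma> nz i u_def])
    also have "\<dots> \<le> (\<Sum>c\<in>I. \<epsilon>)" by (intro sum_mono uI)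
    also have "\<dots> \<le> ?k * \<epsilon>" using \<epsilon> card_mono[of UNIV I] by (simp add: mult_right_mono)
    finally show ?thesis using \<epsilon> by simp
  qed
  have a0: "a $ i = 0" if i: "\<not> finite_index i < ?j" for i
  proof -
    have "(\<Sum>i'\<in>- below ?j. if \<sigma> i' = \<sigma> i then a $ i' else 0) = (\<Sum>i'\<in>- below ?j. if i' = i then a $ i' else 0)"
      using inj\<sigma> i by (intro sum.cong refl) auto
    also have "\<dots> = a $ i" using i by simp
    finally have "\<bar>u $ \<sigma> i + a $ i\<bar> \<le> 1 / 2"
      using a(3)[of "\<sigma> i"] coord[of "\<sigma> i"] i by (simp add: e_def I_def)
    then have "\<bar>a $ i\<bar> < 1" using u\<sigma>[OF i] c by linarith
    moreover obtain z where "a $ i = of_int z" using a(1) by (auto simp: integral_vec_def elim: Ints_cases)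
    ultimately show ?thesis by simp
  qed
  define v where "v = (\<Sum>l\<in>below ?j. a $ l *\<^sub>R ?w l)"
  have hv: "h v = u" using h(1) by (simp add: v_def u_def linear_sum linear_scale)
  have "integral_vec v"
    unfolding v_def using a(1) wt by (intro integral_vec_lincomb) (auto simp: integral_vec_def tuples_def)
  moreover have "v \<noteq> 0"
  proof
    assume "v = 0"
    obtain i where i: "a $ i \<noteq> 0" using a(2) by (auto simp: vec_eq_iff)
    then have ib: "i \<in> below ?j" using a0 by blast
    note ind = tuples_independent[OF wt]
    define g where "g = inv_into (below ?j) ?w"
    have g: "g (?w l) = l" if "l \<in> below ?j" for l unfolding g_def using ind(1) that by simp
    have "(\<Sum>y\<in>?w ` below ?j. a $ g y *\<^sub>R y) = v"
      unfolding v_def by (subst sum.reindex[OF ind(1)]) (simp add: g)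
    then have "\<forall>y\<in>?w ` below ?j. a $ g y = 0"
      using ind(2)[unfolded independent_explicit, THEN conjunct2, THEN spec, of "\<lambda>y. a $ g y"]
        \<open>v = 0\<close> by (simp only: simp_thms)
    then show False using i ib g by force
  qed
  ultimately obtain i where i: "c \<le> \<bar>h v $ i\<bar>" using short by blast
  moreover have "\<bar>u $ i\<bar> \<le> c / 4"
  proof (cases "i \<in> I")
    case True
    then show ?thesis using uI[OF True] \<epsilon>4 by linarith
  next
    case False
    then obtain l where "i = \<sigma> l" "\<not> finite_index l < ?j" by (auto simp: I_def)
    then show ?thesis using u\<sigma> by simp
  qed
  ultimately show False using hv c by simp
qed

lemma tuples_insert:
  fixes w :: "'k::finite \<Rightarrow> real ^ 'k"
  assumes w: "w \<in> tuples W" and W: "subspace W" and v: "integral_vec v" "v \<notin> W"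
  shows "dim (span (insert v W)) = Suc (dim W)"
    and "finite_index i0 = dim W \<Longrightarrow> w(i0 := v) \<in> tuples (span (insert v W))"
proof -
  show d: "dim (span (insert v W)) = Suc (dim W)"
    using W v(2) by (simp add: dim_insert span_eq_iff[THEN iffD2])
  assume i0: "finite_index i0 = dim W"
  have below: "below (Suc (dim W)) = insert i0 (below (dim W) :: 'k set)"
  proof -
    have "finite_index i = dim W \<longleftrightarrow> i = i0" for i using i0 finite_index_eqD by metis
    then show ?thesis by (auto simp: less_Suc_eq)
  qed
  have ni: "i0 \<notin> below (dim W)" using i0 by simp
  have img: "w(i0 := v) ` below (Suc (dim W)) = insert v (w ` below (dim W))"
    unfolding below using ni by auto
  have "span (w ` below (dim W)) = span W" using w W by (simp add: tuples_def span_eq_iff[THEN iffD2])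
  then have "span (insert v (w ` below (dim W))) = span (insert v W)"
    by (simp only: span_insert)
  moreover have "integral_vec ((w(i0 := v)) i)" if "i \<in> below (Suc (dim W))" for i
    using that w v(1) unfolding below by (auto simp: tuples_def)
  ultimately show "w(i0 := v) \<in> tuples (span (insert v W))"
    unfolding tuples_def d mem_Collect_eq img by blast
qed

section \<open>Flags of rational subspaces and short vectors\<close>

definition comparable :: "'a set \<Rightarrow> 'a set \<Rightarrow> bool" where
  "comparable A B \<longleftrightarrow> A \<subseteq> B \<or> B \<subseteq> A"

text \<open>Comparable subspaces of equal dimension coincide, so \<open>dim\<close> maps a flag of
  nonzero subspaces injectively into the numbers from 1 to \<open>CARD('k)\<close>.\<close>

lemma rational_subspace_clique:
  fixes T :: "(real ^ 'k::finite) set set"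
  assumes "clique comparable rational_subspaces T"
  shows "finite T \<and> card T \<le> CARD('k)"
proof -
  have sub: "subspace W" "W \<noteq> {0}" if "W \<in> T" for W
    using assms that by (auto simp: clique_def rational_subspaces_def)
  have inj: "inj_on dim T"
  proof (rule inj_onI)
    fix V W assume VW: "V \<in> T" "W \<in> T" "dim V = dim W"
    then consider "V \<subseteq> W" | "W \<subseteq> V" using assms by (auto simp: clique_def comparable_def)
    then show "V = W"
      by cases (use subspace_dim_equal[of V W] subspace_dim_equal[of W V] sub VW in auto)
  qed
  have "dim W \<in> {1..CARD('k)}" if "W \<in> T" for W
  proof -
    have "dim W \<noteq> 0" using sub[OF that] subspace_0[of W] by (auto simp: dim_eq_0)
    then have "1 \<le> dim W" by linarith
    then show ?thesis using dim_le_CARD[of W] by (simp only: atLeastAtMost_iff simp_thms)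
  qed
  then have im: "dim ` T \<subseteq> {1..CARD('k)}" by blast
  then show ?thesis
    using inj card_inj_on_le[OF inj im] finite_imageD[OF finite_subset[OF im] inj] by simp
qed

text \<open>Let \<open>W\<close> be the largest member of the flag, or \<open>{0}\<close>, that does
  not contain \<open>v\<close>. Members containing \<open>v\<close> include \<open>W\<close> and
  hence \<open>W'\<close>, the span of \<open>W\<close> and \<open>v\<close>; the others lie in
  \<open>W\<close>. So \<open>W'\<close> is in the flag or completes it, and its covolume is at
  least \<open>\<delta>\<close>. But it is at most \<open>CARD('k) * B\<close> times the covolume of
  \<open>W\<close>, which is at most 1.\<close>

lemma no_short_vectors_of_marked:
  fixes h :: "real ^ 'k::finite \<Rightarrow> real ^ 'k" and \<delta> B :: real
  assumes h: "linear h" and T: "clique comparable rational_subspaces T"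
    and le1: "\<And>W. W \<in> T \<Longrightarrow> covol W h \<le> 1" and ge: "\<And>W. W \<in> T \<Longrightarrow> \<delta> \<le> covol W h"
    and compl: "\<And>W. W \<in> completions comparable rational_subspaces T \<Longrightarrow> \<delta> \<le> covol W h"
    and v: "integral_vec v" "v \<noteq> 0" and B: "\<And>i. \<bar>h v $ i\<bar> \<le> B"
  shows "\<delta> \<le> CARD('k) * B"
proof -
  define T0 where "T0 = insert {0} {W \<in> T. v \<notin> W}"
  have "finite T0" using rational_subspace_clique[OF T] by (simp add: T0_def)
  have rat: "\<exists>S. (\<forall>v\<in>S. integral_vec v) \<and> W = span S" if "W \<in> insert {0} T" for W
  proof (cases "W = {0}")
    case True
    then show ?thesis by (intro exI[of _ "{}"]) simp
  next
    case False
    then show ?thesis using that T unfolding clique_def rational_subspaces_def by blast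
  qed
  have chain: "A \<subseteq> B \<or> B \<subseteq> A" if "A \<in> insert {0} T" "B \<in> insert {0} T" for A B
  proof -
    have "0 \<in> A" "0 \<in> B" using that rat span_zero by metis+
    then show ?thesis using that T by (auto simp: clique_def comparable_def)
  qed
  obtain W where W: "W \<in> T0" "\<And>A. A \<in> T0 \<Longrightarrow> W \<subseteq> A \<Longrightarrow> W = A"
    using finite_has_maximal[OF \<open>finite T0\<close>] by (auto simp: T0_def)
  have WT: "W \<in> insert {0} T" using W by (auto simp: T0_def)
  have vW: "v \<notin> W" using W(1) v by (auto simp: T0_def)
  obtain S where S: "\<forall>v\<in>S. integral_vec v" "W = span S" using rat[OF WT] by blast
  have W1: "covol W h \<le> 1"
  proof (cases "W = {0}")
    case True
    then show ?thesis by (simp add: covol_def vol_0_le_1)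
  next
    case False
    then show ?thesis using WT le1 by blast
  qed
  define W' where "W' = span (insert v W)"
  have W'S: "W' = span (insert v S)" unfolding W'_def S(2) by (simp only: span_insert span_span)
  have W'rat: "W' \<in> rational_subspaces"
  proof -
    have "v \<in> W'" unfolding W'_def by (intro span_base) simp
    then have "W' \<noteq> {0}" using v by auto
    then show ?thesis using S(1) v(1) W'S unfolding rational_subspaces_def by blast
  qed
  have comp: "comparable A W'" if A: "A \<in> T" for A
  proof (cases "v \<in> A")
    case True
    have sA: "subspace A" using A T by (auto simp: clique_def rational_subspaces_def)
    have "W \<subseteq> A"
    proof (rule ccontr)
      assume "\<not> W \<subseteq> A"
      then have "A \<subseteq> W" using chain[of A W] A WT by blast
      then show False using True vW by blast
    qed
    then have "W' \<subseteq> A" unfolding W'_def using True sA by (intro span_minimal) auto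
    then show ?thesis by (simp add: comparable_def)
  next
    case False
    then have "A \<in> T0" using A by (simp add: T0_def)
    then have "A \<subseteq> W" using W(2)[of A] chain[of A W] A WT by blast
    then have "A \<subseteq> W'" unfolding W'_def using span_superset by blast
    then show ?thesis by (simp add: comparable_def)
  qed
  have ge': "\<delta> \<le> covol W' h"
  proof (cases "W' \<in> T")
    case True
    then show ?thesis by (rule ge)
  next
    case False
    then show ?thesis using W'rat comp
      by (intro compl) (auto simp: completions_def comparable_def)
  qed
  have ne: "tuples W \<noteq> {}" unfolding S(2) by (rule tuples_nonempty[OF S(1)])
  note rep = rep_tuples(1)[OF ne]
  have subW: "subspace W" unfolding S(2) by simp
  have "dim W < CARD('k)"
  proof -
    have "dim W' = Suc (dim W)" unfolding W'_def by (rule tuples_insert(1)[OF rep subW v(1) vW])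
    then show ?thesis using dim_le_CARD[of W'] by simp
  qed
  then obtain i0 :: 'k where i0: "finite_index i0 = dim W"
    using finite_index_bij[where 'k = 'k] by (metis bij_betw_def imageE lessThan_iff)
  have "\<delta> \<le> vol (dim W') ((rep W)(i0 := v)) h"
    using ge' covol_le_vol[OF tuples_insert(2)[OF rep subW v(1) vW i0] h] unfolding W'_def by linarith
  also have "\<dots> \<le> CARD('k) * B * covol W h"
    unfolding W'_def tuples_insert(1)[OF rep subW v(1) vW] covol_def
    by (rule vol_extend[of i0 "dim W" h v B "rep W", OF i0 B])
  also have "\<dots> \<le> CARD('k) * B * 1"
    using W1 B order_trans[OF abs_ge_zero B] by (intro mult_left_mono) auto
  finally show ?thesis by simp
qed

lemma det_affine_column:
  fixes \<alpha> :: "'k::finite \<Rightarrow> real" and \<beta> :: "'k \<Rightarrow> real ^ 'n" and r :: "'k \<Rightarrow> 'k \<Rightarrow> real"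
  shows "\<exists>a b. \<forall>y :: real ^ 'n. det (\<chi> i c. if c = c0 then \<alpha> i + \<beta> i \<bullet> y else r i c) = a + b \<bullet> y"
proof -
  let ?r = "\<lambda>c. \<chi> i. r i c" and ?\<beta> = "\<lambda>l. \<chi> i. \<beta> i $ l"
  have "det (\<chi> i c. if c = c0 then \<alpha> i + \<beta> i \<bullet> y else r i c)
      = det (\<chi> c. if c = c0 then (\<chi> i. \<alpha> i) else ?r c)
        + (\<chi> l. det (\<chi> c. if c = c0 then ?\<beta> l else ?r c)) \<bullet> y" for y :: "real ^ 'n"
  proof -
    have "(\<chi> i c. if c = c0 then \<alpha> i + \<beta> i \<bullet> y else r i c)
        = transpose (\<chi> c. if c = c0 then (\<chi> i. \<alpha> i) + (\<Sum>l\<in>UNIV. y $ l *\<^sub>R ?\<beta> l) else ?r c)"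
      by (auto simp: vec_eq_iff transpose_def inner_vec_def mult.commute)
    then have "det (\<chi> i c. if c = c0 then \<alpha> i + \<beta> i \<bullet> y else r i c)
        = det (\<chi> c. if c = c0 then (\<chi> i. \<alpha> i) + (\<Sum>l\<in>UNIV. y $ l *\<^sub>R ?\<beta> l) else ?r c)"
      by (simp only: det_transpose)
    also have "\<dots> = det (\<chi> c. if c = c0 then (\<chi> i. \<alpha> i) else ?r c)
        + det (\<chi> c. if c = c0 then (\<Sum>l\<in>UNIV. y $ l *\<^sub>R ?\<beta> l) else ?r c)"
      by (rule det_row_add[where a = "\<lambda>_. \<chi> i. \<alpha> i" and b = "\<lambda>_. \<Sum>l\<in>UNIV. y $ l *\<^sub>R ?\<beta> l"])
    also have "det (\<chi> c. if c = c0 then (\<Sum>l\<in>UNIV. y $ l *\<^sub>R ?\<beta> l) else ?r c)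
        = (\<Sum>l\<in>UNIV. y $ l * det (\<chi> c. if c = c0 then ?\<beta> l else ?r c))"
      by (rule det_row_lincomb) simp
    also have "\<dots> = (\<chi> l. det (\<chi> c. if c = c0 then ?\<beta> l else ?r c)) \<bullet> y"
      by (simp add: inner_vec_def mult.commute)
    finally show ?thesis .
  qed
  then show ?thesis by blast
qed

section \<open>The Dani correspondence\<close>

datatype 'n coord = Const | Coef 'n

lemma UNIV_coord: "UNIV = insert Const (range Coef)"
  by (auto intro: coord.exhaust)

instance coord :: (finite) finite
  by standard (simp add: UNIV_coord)

text \<open>The library computes the measure of a linear image only over a well-ordered index type; any
  order will do.\<close>

instantiation coord :: (finite) wellorder
begin

definition less_eq_coord :: "'a coord \<Rightarrow> 'a coord \<Rightarrow> bool" where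
  "less_eq_coord x y \<longleftrightarrow> finite_index x \<le> finite_index y"

definition less_coord :: "'a coord \<Rightarrow> 'a coord \<Rightarrow> bool" where
  "less_coord x y \<longleftrightarrow> finite_index x < finite_index y"

instance
proof
  fix P :: "'a coord \<Rightarrow> bool" and x
  assume step: "\<And>x. (\<And>y. y < x \<Longrightarrow> P y) \<Longrightarrow> P x"
  show "P x"
  proof (induction x rule: measure_induct_rule[of finite_index])
    case (less x)
    show ?case by (rule step) (simp add: less less_coord_def)
  qed
qed (auto simp: less_eq_coord_def less_coord_def intro: finite_index_eqD)

end

text \<open>The map \<open>g\<^sub>t u\<^sub>y\<close>, acting on \<open>(q\<^sub>0, q)\<close> with \<open>q\<^sub>0\<close> at \<open>Const\<close>; the exponent makes its
  determinant 1.\<close>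

definition dani :: "real \<Rightarrow> real ^ 'n \<Rightarrow> real ^ 'n coord \<Rightarrow> real ^ 'n coord" where
  "dani t y v = (\<chi> c. case c of
     Const \<Rightarrow> t ^ CARD('n) * (v $ Const + (\<Sum>i\<in>UNIV. v $ Coef i * y $ i))
   | Coef i \<Rightarrow> v $ Coef i / t)"

lemma dani_nth [simp]:
  fixes y :: "real ^ 'n"
  shows "dani t y v $ Const = t ^ CARD('n) * (v $ Const + (\<Sum>i\<in>UNIV. v $ Coef i * y $ i))"
    "dani t y v $ Coef i = v $ Coef i / t"
  by (simp_all add: dani_def)

lemma vec_eq_coord: "v = w \<longleftrightarrow> v $ Const = w $ Const \<and> (\<forall>i. v $ Coef i = w $ Coef i)"
  by (metis coord.exhaust vec_eq_iff)

lemma linear_dani: "linear (dani t y)"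
  by (rule linearI) (simp_all add: vec_eq_coord algebra_simps sum.distrib sum_distrib_left add_divide_distrib)

lemma inj_dani:
  assumes "t > 0"
  shows "inj (dani t y)"
proof -
  have "v = 0" if "dani t y v = 0" for v
  proof -
    have "v $ Coef i = 0" for i
      using that assms dani_nth(2)[of t y v i] by simp
    moreover from this have "v $ Const = 0"
      using that assms dani_nth(1)[of t y v] by simp
    ultimately show ?thesis by (simp add: vec_eq_coord)
  qed
  then show ?thesis using linear_injective_0[OF linear_dani] by blast
qed

text \<open>The point \<open>y\<close> enters \<open>dani t y\<close> only in the coordinate
  \<open>Const\<close>, that is, in a single column of the determinant.\<close>

lemma minor_dani_affine:
  "\<exists>a b. \<forall>y :: real ^ 'n. minor j w (dani t y) \<sigma> = a + b \<bullet> y"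
proof -
  let ?\<alpha> = "\<lambda>i. if finite_index i < j then t ^ CARD('n) * w i $ Const else axis (\<sigma> i) 1 $ Const"
  let ?\<beta> = "\<lambda>i. if finite_index i < j then (\<chi> l. t ^ CARD('n) * w i $ Coef l) else 0"
  let ?r = "\<lambda>i c. if finite_index i < j then dani t (0 :: real ^ 'n) (w i) $ c else axis (\<sigma> i) 1 $ c"
  have "minor j w (dani t y) \<sigma> = det (\<chi> i c. if c = Const then ?\<alpha> i + ?\<beta> i \<bullet> y else ?r i c)"
    for y :: "real ^ 'n"
  proof -
    have "(if finite_index i < j then dani t y (w i) else axis (\<sigma> i) 1) $ c
        = (if c = Const then ?\<alpha> i + ?\<beta> i \<bullet> y else ?r i c)" for i c
      by (cases c) (auto simp: inner_vec_def sum_distrib_left algebra_simps)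
    then show ?thesis unfolding minor_def
      by (intro arg_cong[of _ _ det]) (simp add: vec_eq_iff del: if_split)
  qed
  then show ?thesis using det_affine_column[of Const ?\<alpha> ?\<beta> ?r] by simp
qed

definition has_short_vector :: "real \<Rightarrow> real ^ 'n \<Rightarrow> real \<Rightarrow> bool" where
  "has_short_vector t y c \<longleftrightarrow> (\<exists>v. integral_vec v \<and> v \<noteq> 0 \<and> (\<forall>i. \<bar>dani t y v $ i\<bar> \<le> c))"

text \<open>Singularity is applied with \<open>Q = s * t\<close> and the constant
  \<open>c * s ^ n\<close>, where \<open>n\<close> is the dimension: the linear form is then below
  \<open>c / t ^ n\<close>, and the entries of \<open>q\<close> are at most \<open>s * t\<close>,
  hence at most \<open>c * t\<close>.\<close>

lemma singular_imp_short_vectors: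
  fixes y :: "real ^ 'n"
  assumes "singular_vector y" and c: "c > 0"
  shows "\<forall>\<^sub>F t in at_top. has_short_vector t y c"
proof -
  let ?n = "CARD('n)"
  define s where "s = min c 1"
  have s: "s > 0" "s \<le> c" using c by (auto simp: s_def)
  have "c * s ^ ?n > 0" using c s by simp
  then have "\<forall>\<^sub>F Q in at_top. \<exists>(q :: int ^ 'n) (q0 :: int). q \<noteq> 0 \<and>
      \<bar>int_vec q \<bullet> y + real_of_int q0\<bar> < c * s ^ ?n / Q ^ ?n \<and> infnorm (int_vec q) \<le> Q"
    using assms(1) unfolding singular_vector_def by blast
  moreover have "filterlim (\<lambda>t. s * t) at_top at_top"
    by (rule filterlim_tendsto_pos_mult_at_top[OF tendsto_const s(1) filterlim_ident])
  ultimately have "\<forall>\<^sub>F t in at_top. \<exists>(q :: int ^ 'n) (q0 :: int). q \<noteq> 0 \<and>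
      \<bar>int_vec q \<bullet> y + real_of_int q0\<bar> < c * s ^ ?n / (s * t) ^ ?n \<and> infnorm (int_vec q) \<le> s * t"
    by (rule eventually_compose_filterlim)
  then show ?thesis using eventually_gt_at_top[of 0]
  proof eventually_elim
    case (elim t)
    then obtain q :: "int ^ 'n" and q0 :: int where q: "q \<noteq> 0"
      "\<bar>int_vec q \<bullet> y + real_of_int q0\<bar> < c * s ^ ?n / (s * t) ^ ?n" "infnorm (int_vec q) \<le> s * t"
      by blast
    define v :: "real ^ 'n coord" where
      "v = (\<chi> c. case c of Const \<Rightarrow> of_int q0 | Coef i \<Rightarrow> of_int (q $ i))"
    have v: "v $ Const = of_int q0" "v $ Coef i = of_int (q $ i)" for i by (simp_all add: v_def)
    have "integral_vec v"
      unfolding integral_vec_def by (auto simp: v_def split: coord.split)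
    moreover have "v \<noteq> 0"
    proof
      assume "v = 0"
      then have "q $ i = 0" for i using v(2)[of i] by simp
      then show False using q(1) by (simp add: vec_eq_iff)
    qed
    moreover have "\<bar>dani t y v $ i\<bar> \<le> c" for i
    proof (cases i)
      case Const
      have "\<bar>dani t y v $ Const\<bar> = t ^ ?n * \<bar>int_vec q \<bullet> y + real_of_int q0\<bar>"
        using elim(2) by (simp add: v int_vec_def inner_vec_def abs_mult add.commute)
      also have "\<dots> \<le> t ^ ?n * (c * s ^ ?n / (s * t) ^ ?n)"
        using q(2) elim(2) by (intro mult_left_mono) auto
      also have "\<dots> = c" using s elim(2) by (simp add: power_mult_distrib)
      finally show ?thesis using Const by simp
    next
      case (Coef i)
      have "\<bar>real_of_int (q $ i)\<bar> \<le> s * t"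
        using component_le_infnorm_cart[of "int_vec q" i] q(3) by (simp add: int_vec_def)
      then have "\<bar>real_of_int (q $ i)\<bar> / t \<le> s" using elim(2) by (simp add: field_simps)
      then show ?thesis using Coef s elim(2) by (simp add: v)
    qed
    ultimately show ?case unfolding has_short_vector_def by blast
  qed
qed

text \<open>Negating a statement about all large \<open>Q\<close> leaves only arbitrarily large
  times. At such a time a nonzero integral vector has a large image: if \<open>q = 0\<close>,
  because \<open>q0\<close> is a nonzero integer; if \<open>q\<close> has norm at most
  \<open>t\<close>, by failure of the approximation; otherwise because some entry of
  \<open>q\<close> exceeds \<open>t\<close>. Halving \<open>min c 1\<close> turns these lower bounds
  into strict ones.\<close>

lemma nonsingular_imp_no_short_vectors:
  fixes y :: "real ^ 'n"
  assumes "\<not> singular_vector y"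
  shows "\<exists>c. 0 < c \<and> c \<le> 1 \<and> (\<exists>\<^sub>F t in at_top. t \<ge> 1 \<and> \<not> has_short_vector t y c)"
proof -
  let ?n = "CARD('n)"
  have "\<exists>c>0. \<exists>\<^sub>F Q in at_top. \<not> (\<exists>(q :: int ^ 'n) (q0 :: int). q \<noteq> 0 \<and>
      \<bar>int_vec q \<bullet> y + real_of_int q0\<bar> < c / Q ^ ?n \<and> infnorm (int_vec q) \<le> Q)"
    using assms unfolding singular_vector_def by (simp only: not_all not_imp not_eventually)
  then obtain c where c: "c > 0" "\<exists>\<^sub>F Q in at_top. \<not> (\<exists>(q :: int ^ 'n) (q0 :: int). q \<noteq> 0 \<and>
      \<bar>int_vec q \<bullet> y + real_of_int q0\<bar> < c / Q ^ ?n \<and> infnorm (int_vec q) \<le> Q)" by (elim exE conjE)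
  have "\<exists>\<^sub>F t in at_top. t \<ge> 1 \<and> \<not> has_short_vector t y (min c 1 / 2)"
    using c(2)
  proof (rule frequently_rev_mp)
    show "\<forall>\<^sub>F t in at_top. \<not> (\<exists>(q :: int ^ 'n) (q0 :: int). q \<noteq> 0 \<and>
        \<bar>int_vec q \<bullet> y + real_of_int q0\<bar> < c / t ^ ?n \<and> infnorm (int_vec q) \<le> t) \<longrightarrow>
      t \<ge> 1 \<and> \<not> has_short_vector t y (min c 1 / 2)"
      using eventually_ge_at_top[of 1]
    proof (eventually_elim, intro impI conjI notI)
      fix t :: real
      assume t: "1 \<le> t" and no: "\<not> (\<exists>(q :: int ^ 'n) (q0 :: int). q \<noteq> 0 \<and>
        \<bar>int_vec q \<bullet> y + real_of_int q0\<bar> < c / t ^ ?n \<and> infnorm (int_vec q) \<le> t)"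
        and "has_short_vector t y (min c 1 / 2)"
      then obtain v where v: "integral_vec v" "v \<noteq> 0" "\<And>i. \<bar>dani t y v $ i\<bar> \<le> min c 1 / 2"
        unfolding has_short_vector_def by blast
      have tn: "t ^ ?n \<ge> 1" using t by simp
      define q :: "int ^ 'n" and q0 where "q = (\<chi> i. \<lfloor>v $ Coef i\<rfloor>)" and "q0 = \<lfloor>v $ Const\<rfloor>"
      have vq: "v $ Const = of_int q0" "v $ Coef i = of_int (q $ i)" for i
        using v(1) by (auto simp: integral_vec_def q_def q0_def of_int_floor)
      have form: "dani t y v $ Const = t ^ ?n * (int_vec q \<bullet> y + real_of_int q0)"
        by (simp add: vq int_vec_def inner_vec_def)
      have "\<exists>i. min c 1 \<le> \<bar>dani t y v $ i\<bar>"
      proof (cases "q = 0")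
        case True
        then have "q0 \<noteq> 0" using v(2) vq by (auto simp: vec_eq_coord)
        then have "1 \<le> \<bar>real_of_int q0\<bar>" by linarith
        then have "1 * 1 \<le> t ^ ?n * \<bar>real_of_int q0\<bar>" using tn by (intro mult_mono) auto
        moreover have "int_vec q \<bullet> y = 0" using True by (simp add: int_vec_def inner_vec_def)
        ultimately have "1 \<le> \<bar>dani t y v $ Const\<bar>" using t unfolding form by (simp add: abs_mult)
        then show ?thesis by (intro exI[of _ Const]) linarith
      next
        case False
        show ?thesis
        proof (cases "infnorm (int_vec q) \<le> t")
          case True
          then have "c / t ^ ?n \<le> \<bar>int_vec q \<bullet> y + real_of_int q0\<bar>" using no False by (meson not_le)
          then have "c \<le> t ^ ?n * \<bar>int_vec q \<bullet> y + real_of_int q0\<bar>"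
            using tn by (simp add: field_simps)
          then have "c \<le> \<bar>dani t y v $ Const\<bar>" using t unfolding form by (simp add: abs_mult)
          then show ?thesis by (intro exI[of _ Const]) linarith
        next
          case False
          obtain i where "\<not> \<bar>int_vec q $ i\<bar> \<le> t"
            using False by (auto simp: infnorm_cart intro!: cSup_least)
          then have "1 \<le> \<bar>dani t y v $ Coef i\<bar>" using t by (simp add: vq int_vec_def field_simps)
          then show ?thesis by (intro exI[of _ "Coef i"]) linarith
        qed
      qed
      then obtain i where "min c 1 \<le> \<bar>dani t y v $ i\<bar>" by blast
      then show False using v(3)[of i] c(1) by linarith
    qed
  qed
  then show ?thesis using c(1) by (intro exI[of _ "min c 1 / 2"]) auto
qed

text \<open>An affine function with huge coefficients may be small on \<open>L\<close>; it then agrees on \<open>L\<close> with one whose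
  coefficients are of the size of its values.\<close>

lemma affine_function_renormalize:
  fixes f :: "'x \<Rightarrow> real ^ 'n"
  assumes L: "affine hull (f ` B0) = L" and ne: "B0 \<noteq> {}"
  shows "\<exists>C>0. \<forall>a b s. (\<forall>x\<in>B0. \<bar>a + b \<bullet> f x\<bar> \<le> s) \<longrightarrow>
    (\<exists>a' b'. \<bar>a'\<bar> \<le> C * s \<and> norm b' \<le> C * s \<and> (\<forall>y\<in>L. a + b \<bullet> y = a' + b' \<bullet> y))"
proof -
  obtain x0 where x0: "x0 \<in> B0" using ne by blast
  define p where "p = f x0"
  define D where "D = (\<lambda>y. - p + y) ` f ` B0"
  have hull: "L = (\<lambda>x. p + x) ` span D"
    unfolding L[symmetric] D_def using x0 by (intro affine_hull_span_gen) (simp add: p_def hull_inc)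
  obtain Bs where Bs: "Bs \<subseteq> D" "independent Bs" "D \<subseteq> span Bs"
    by (rule basis_exists[of D]) blast
  have finBs: "finite Bs" using Bs(2) by (simp add: independent_imp_finite)
  \<comment> \<open>A family dual to the basis \<open>Bs\<close> of the direction space, represented
    by vectors of the ambient space.\<close>
  have "\<exists>G. \<forall>x\<in>Bs. G \<bullet> x = (if x = \<beta> then 1 else 0)" for \<beta>
  proof -
    obtain g where g: "linear g" "\<forall>x\<in>Bs. g x = (if x = \<beta> then 1 else (0 :: real))"
      using linear_independent_extend[OF Bs(2), of "\<lambda>x. if x = \<beta> then 1 else 0"] by auto
    have "g x = adjoint g 1 \<bullet> x" for x using adjoint_works[OF g(1), of x 1] by (simp add: inner_commute)
    then show ?thesis using g(2) by (metis)
  qed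
  then obtain G where G: "\<And>\<beta> x. x \<in> Bs \<Longrightarrow> G \<beta> \<bullet> x = (if x = \<beta> then 1 else 0)" by metis
  have repr: "d = (\<Sum>\<beta>\<in>Bs. (G \<beta> \<bullet> d) *\<^sub>R \<beta>)" if "d \<in> span Bs" for d
  proof (rule linear_eq_on_span[where f = "\<lambda>d. d" and g = "\<lambda>d. \<Sum>\<beta>\<in>Bs. (G \<beta> \<bullet> d) *\<^sub>R \<beta>", OF _ _ _ that])
    show "linear (\<lambda>d. \<Sum>\<beta>\<in>Bs. (G \<beta> \<bullet> d) *\<^sub>R \<beta>)"
      by (intro linearI) (simp_all add: inner_add_right scaleR_add_left sum.distrib scaleR_sum_right)
    fix d assume "d \<in> Bs"
    then have "(\<Sum>\<beta>\<in>Bs. (G \<beta> \<bullet> d) *\<^sub>R \<beta>) = (\<Sum>\<beta>\<in>Bs. if \<beta> = d then \<beta> else 0)"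
      by (intro sum.cong refl) (auto simp: G)
    then show "d = (\<Sum>\<beta>\<in>Bs. (G \<beta> \<bullet> d) *\<^sub>R \<beta>)" using \<open>d \<in> Bs\<close> finBs by simp
  qed (rule linear_id[unfolded id_def])
  define K where "K = (\<Sum>\<beta>\<in>Bs. norm (G \<beta>))"
  have K: "K \<ge> 0" by (simp add: K_def sum_nonneg)
  define C where "C = 1 + 2 * K + 2 * K * norm p"
  show ?thesis
  proof (rule exI[of _ C], intro conjI allI impI)
    show "C > 0" using K by (simp add: C_def add_pos_nonneg)
    fix a b s assume s: "\<forall>x\<in>B0. \<bar>a + b \<bullet> f x\<bar> \<le> s"
    have sp: "\<bar>a + b \<bullet> p\<bar> \<le> s" using s x0 by (simp add: p_def)
    then have s0: "s \<ge> 0" by linarith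
    have b\<beta>: "\<bar>b \<bullet> \<beta>\<bar> \<le> 2 * s" if \<beta>: "\<beta> \<in> Bs" for \<beta>
    proof -
      obtain x where x: "x \<in> B0" "\<beta> = - p + f x" using \<beta> Bs(1) by (auto simp: D_def)
      have "b \<bullet> \<beta> = (a + b \<bullet> f x) - (a + b \<bullet> p)" by (simp add: x inner_diff_right inner_add_right)
      then show ?thesis using s x(1) sp by (smt (verit))
    qed
    define b' where "b' = (\<Sum>\<beta>\<in>Bs. (b \<bullet> \<beta>) *\<^sub>R G \<beta>)"
    define a' where "a' = a + b \<bullet> p - b' \<bullet> p"
    have nb': "norm b' \<le> 2 * s * K"
    proof -
      have "norm b' \<le> (\<Sum>\<beta>\<in>Bs. \<bar>b \<bullet> \<beta>\<bar> * norm (G \<beta>))" unfolding b'_def by (intro order_trans[OF norm_sum]) simp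
      also have "\<dots> \<le> (\<Sum>\<beta>\<in>Bs. 2 * s * norm (G \<beta>))" by (intro sum_mono mult_right_mono b\<beta>) auto
      finally show ?thesis by (simp add: K_def sum_distrib_left)
    qed
    have "\<bar>b' \<bullet> p\<bar> \<le> 2 * s * K * norm p"
      using Cauchy_Schwarz_ineq2[of b' p] mult_right_mono[OF nb', of "norm p"] by simp
    then have na': "\<bar>a'\<bar> \<le> s + 2 * s * K * norm p" using sp unfolding a'_def by linarith
    have "a + b \<bullet> y = a' + b' \<bullet> y" if y: "y \<in> L" for y
    proof -
      obtain d where d: "y = p + d" "d \<in> span D" using y hull by blast
      have "d \<in> span Bs" using d(2) Bs(3) by (metis span_mono span_span subsetD)
      then have "b \<bullet> d = b \<bullet> (\<Sum>\<beta>\<in>Bs. (G \<beta> \<bullet> d) *\<^sub>R \<beta>)" using repr by metis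
      also have "\<dots> = b' \<bullet> d" by (simp add: b'_def inner_sum_right inner_sum_left mult.commute)
      finally show ?thesis by (simp add: d a'_def inner_add_right)
    qed
    moreover have "norm b' \<le> C * s" "\<bar>a'\<bar> \<le> C * s"
    proof -
      have "C * s = s + 2 * s * K + 2 * s * K * norm p" by (simp add: C_def algebra_simps)
      moreover have "0 \<le> 2 * s * K" "0 \<le> 2 * s * K * norm p" using s0 K by auto
      ultimately show "norm b' \<le> C * s" "\<bar>a'\<bar> \<le> C * s" using nb' na' s0 by linarith+
    qed
    ultimately show "\<exists>a' b'. \<bar>a'\<bar> \<le> C * s \<and> norm b' \<le> C * s \<and> (\<forall>y\<in>L. a + b \<bullet> y = a' + b' \<bullet> y)"
      by blast
  qed
qed

section \<open>Almost every point is nonsingular\<close>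

lemma has_sum_single:
  fixes v :: "'b::{comm_monoid_add, topological_space}"
  shows "((\<lambda>x. if x = z then v else 0) has_sum v) UNIV"
proof -
  let ?f = "\<lambda>x. if x = z then v else 0"
  have "(?f has_sum v) {z}" by (rule has_sum_finiteI) auto
  moreover have "(?f has_sum v) UNIV \<longleftrightarrow> (?f has_sum v) {z}"
    by (rule has_sum_cong_neutral) auto
  ultimately show ?thesis by blast
qed

definition affine_coeffs ::
    "real \<Rightarrow> real ^ 'n \<Rightarrow> (('d \<Rightarrow> nat) \<Rightarrow> real ^ 'n) \<Rightarrow> ('d \<Rightarrow> nat) \<Rightarrow> real" where
  "affine_coeffs a1 b1 C \<alpha> = (if \<alpha> = (\<lambda>_. 0) then a1 else 0) + b1 \<bullet> C \<alpha>"

text \<open>One radius and one \<open>A\<close> serve all affine functions of \<open>f\<close>, with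
  a bound linear in their coefficients. After renormalization this linearity gives a common
  bound.\<close>

lemma analytic_local_series:
  fixes f :: "real ^ 'd \<Rightarrow> real ^ 'n"
  assumes f: "real_analytic_on f U" and "open U" "a \<in> U"
  shows "\<exists>(C :: ('d \<Rightarrow> nat) \<Rightarrow> real ^ 'n) r A. r > 0 \<and> A \<ge> 0 \<and> cube a r \<subseteq> U \<and>
    (\<forall>a1 b1. scaled_series (affine_coeffs a1 b1 C) r ((\<bar>a1\<bar> + norm b1) * (1 + A)) \<and>
      power_series_on (affine_coeffs a1 b1 C) a r (\<lambda>x. a1 + b1 \<bullet> f x))"
proof -
  obtain C :: "('d \<Rightarrow> nat) \<Rightarrow> real ^ 'n" and R where R: "R > 0"
    "\<And>x. x \<in> ball a R \<Longrightarrow> ((\<lambda>\<alpha>. (\<Prod>i\<in>UNIV. (x $ i - a $ i) ^ \<alpha> i) *\<^sub>R C \<alpha>) has_sum f x) UNIV"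
    using f \<open>a \<in> U\<close> unfolding real_analytic_on_def by blast
  obtain R' where R': "R' > 0" "ball a R' \<subseteq> U" using \<open>open U\<close> \<open>a \<in> U\<close> open_contains_ball by blast
  define r where "r = min R R' / (2 * CARD('d))"
  have r: "r > 0" using R R' by (simp add: r_def)
  have box: "x \<in> ball a R \<inter> ball a R'" if x: "\<And>i. \<bar>x $ i - a $ i\<bar> \<le> r" for x
  proof -
    have "norm (x - a) \<le> (\<Sum>i\<in>UNIV. \<bar>(x - a) $ i\<bar>)" by (rule norm_le_l1_cart)
    also have "\<dots> \<le> (\<Sum>i\<in>(UNIV :: 'd set). r)" using x by (intro sum_mono) simp
    also have "\<dots> = min R R' / 2" by (simp add: r_def)
    also have "\<dots> < min R R'"
    proof -
      have "0 < min R R'" using R(1) R'(1) by simp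
      then show ?thesis by linarith
    qed
    finally show ?thesis by (simp add: dist_norm norm_minus_commute)
  qed
  let ?w = "\<lambda>\<alpha> :: 'd \<Rightarrow> nat. r ^ sum \<alpha> UNIV"
  have w: "?w \<alpha> > 0" for \<alpha> using r by simp
  \<comment> \<open>At this corner of the cube the monomials become
    \<open>r ^ sum \<alpha> UNIV\<close>. Unconditional convergence there is absolute in each
    coordinate, which yields the weighted summability of the norms.\<close>
  define x1 :: "real ^ 'd" where "x1 = a + (\<chi> i. r)"
  have "x1 \<in> ball a R" using box[of x1] r by (simp add: x1_def)
  from R(2)[OF this] have S: "(\<lambda>\<alpha>. ?w \<alpha> *\<^sub>R C \<alpha>) summable_on UNIV"
    by (auto simp: x1_def power_sum summable_on_def)
  have comp: "(\<lambda>\<alpha>. \<bar>?w \<alpha> * C \<alpha> $ l\<bar>) summable_on UNIV" for l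
  proof -
    have "(\<lambda>\<alpha>. (?w \<alpha> *\<^sub>R C \<alpha>) $ l) summable_on UNIV"
      by (rule summable_on_bounded_linear[OF bounded_linear_vec_nth S])
    then show ?thesis by (simp add: summable_on_iff_abs_summable_on_real[of "\<lambda>\<alpha>. ?w \<alpha> * C \<alpha> $ l"])
  qed
  have "(\<lambda>\<alpha>. \<Sum>l\<in>UNIV. \<bar>?w \<alpha> * C \<alpha> $ l\<bar>) summable_on UNIV"
    by (rule has_sum_imp_summable[OF has_sum_sum[OF finite_class.finite_UNIV has_sum_infsum[OF comp]]])
  then have "(\<lambda>\<alpha>. norm (norm (C \<alpha>) * ?w \<alpha>)) summable_on UNIV"
  proof (rule Infinite_Sum.abs_summable_on_comparison_test')
    fix \<alpha> :: "'d \<Rightarrow> nat"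
    have "norm (C \<alpha>) * ?w \<alpha> \<le> (\<Sum>l\<in>UNIV. \<bar>C \<alpha> $ l\<bar>) * ?w \<alpha>"
      using w[of \<alpha>] by (intro mult_right_mono norm_le_l1_cart) auto
    then show "norm (norm (C \<alpha>) * ?w \<alpha>) \<le> (\<Sum>l\<in>UNIV. \<bar>?w \<alpha> * C \<alpha> $ l\<bar>)"
      using w[of \<alpha>] by (simp add: abs_mult sum_distrib_left mult.commute)
  qed
  then have NS: "(\<lambda>\<alpha>. norm (C \<alpha>) * ?w \<alpha>) summable_on UNIV"
    using r by (simp add: abs_mult)
  define A where "A = (\<Sum>\<^sub>\<infinity>\<alpha>. norm (C \<alpha>) * ?w \<alpha>)"
  have A: "A \<ge> 0" unfolding A_def using r by (intro infsum_nonneg) simp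
  show ?thesis
  proof (rule exI[of _ C], rule exI[of _ r], rule exI[of _ A], intro conjI allI impI)
    show "cube a r \<subseteq> U" using box R'(2) by (auto simp: cube_def)
  next
    fix a1 b1
    let ?c = "affine_coeffs a1 b1 C"
    have M: "((\<lambda>\<alpha>. (if \<alpha> = (\<lambda>_. 0) then \<bar>a1\<bar> else 0) + norm b1 * (norm (C \<alpha>) * ?w \<alpha>))
        has_sum (\<bar>a1\<bar> + norm b1 * A)) UNIV"
      unfolding A_def by (intro has_sum_add has_sum_single has_sum_cmult_right has_sum_infsum NS)
    have le: "\<bar>?c \<alpha>\<bar> * ?w \<alpha> \<le> (if \<alpha> = (\<lambda>_. 0) then \<bar>a1\<bar> else 0) + norm b1 * (norm (C \<alpha>) * ?w \<alpha>)" for \<alpha>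
    proof -
      have "\<bar>?c \<alpha>\<bar> * ?w \<alpha> \<le> (\<bar>if \<alpha> = (\<lambda>_. 0) then a1 else 0\<bar> + norm b1 * norm (C \<alpha>)) * ?w \<alpha>"
        using w[of \<alpha>] Cauchy_Schwarz_ineq2[of b1 "C \<alpha>"] unfolding affine_coeffs_def
        by (intro mult_right_mono order_trans[OF abs_triangle_ineq] add_mono) auto
      also have "\<dots> = (if \<alpha> = (\<lambda>_. 0) then \<bar>a1\<bar> else 0) + norm b1 * (norm (C \<alpha>) * ?w \<alpha>)"
        by (simp add: distrib_right mult.assoc)
      finally show ?thesis .
    qed
    show "scaled_series ?c r ((\<bar>a1\<bar> + norm b1) * (1 + A))"
    proof
      show "r > 0" by (rule r)
      have "(\<lambda>\<alpha>. norm (\<bar>?c \<alpha>\<bar> * ?w \<alpha>)) summable_on UNIV"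
        by (rule Infinite_Sum.abs_summable_on_comparison_test'[OF has_sum_imp_summable[OF M]])
          (use le r in \<open>simp add: abs_mult\<close>)
      then show *: "(\<lambda>\<alpha>. \<bar>?c \<alpha>\<bar> * ?w \<alpha>) summable_on UNIV" using r by (simp add: abs_mult)
      have "(\<Sum>\<^sub>\<infinity>\<alpha>. \<bar>?c \<alpha>\<bar> * ?w \<alpha>) \<le> \<bar>a1\<bar> + norm b1 * A"
        by (rule has_sum_mono[OF has_sum_infsum[OF *] M]) (use le in simp)
      also have "\<dots> \<le> (\<bar>a1\<bar> + norm b1) * (1 + A)" using A by (simp add: algebra_simps)
      finally show "(\<Sum>\<^sub>\<infinity>\<alpha>. \<bar>?c \<alpha>\<bar> * ?w \<alpha>) \<le> (\<bar>a1\<bar> + norm b1) * (1 + A)" .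
    qed
    show "power_series_on ?c a r (\<lambda>x. a1 + b1 \<bullet> f x)"
      unfolding power_series_on_def
    proof
      fix x assume "x \<in> cube a r"
      then have "x \<in> ball a R" using box by (auto simp: cube_def)
      from has_sum_bounded_linear[OF bounded_linear_inner_right[of b1] R(2)[OF this]]
      have "((\<lambda>\<alpha>. b1 \<bullet> ((\<Prod>i\<in>UNIV. (x $ i - a $ i) ^ \<alpha> i) *\<^sub>R C \<alpha>)) has_sum (b1 \<bullet> f x)) UNIV" .
      from has_sum_add[OF has_sum_single[of "\<lambda>_. 0" a1] this]
      have "((\<lambda>\<alpha>. (if \<alpha> = (\<lambda>_. 0) then a1 else 0) + b1 \<bullet> ((\<Prod>i\<in>UNIV. (x $ i - a $ i) ^ \<alpha> i) *\<^sub>R C \<alpha>))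
          has_sum (a1 + b1 \<bullet> f x)) UNIV" .
      moreover have "(if \<alpha> = (\<lambda>_. 0) then a1 else 0) + b1 \<bullet> ((\<Prod>i\<in>UNIV. (x $ i - a $ i) ^ \<alpha> i) *\<^sub>R C \<alpha>)
          = ?c \<alpha> * (\<Prod>i\<in>UNIV. (x $ i - a $ i) ^ \<alpha> i)" for \<alpha>
        by (auto simp: affine_coeffs_def distrib_right mult.commute)
      ultimately show "((\<lambda>\<alpha>. ?c \<alpha> * (\<Prod>i\<in>UNIV. (x $ i - a $ i) ^ \<alpha> i)) has_sum (a1 + b1 \<bullet> f x)) UNIV"
        by simp
    qed
  qed (use r A in auto)
qed

text \<open>Dividing by the supremum \<open>S\<close> over the cube and renormalizing on
  \<open>L\<close> gives coefficients bounded by \<open>K\<close>, hence one series bound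
  \<open>A'\<close>, and a value of size at least 1/2. The estimate is homogeneous in the function
  and \<open>\<rho>\<close> together, so it transfers back. The order of quantifiers matters: the
  cube does not depend on \<open>\<eta>\<close>, and \<open>\<epsilon>\<close> and \<open>l0\<close>
  do not depend on the function.\<close>

lemma affine_functions_sublevel_small:
  fixes f :: "real ^ 'd \<Rightarrow> real ^ 'n"
  assumes f: "real_analytic_on f U" and U: "open U" "a \<in> U" and fL: "f ` U \<subseteq> L" and L: "affine L"
    and nondeg: "\<forall>x r. r > 0 \<longrightarrow> ball x r \<subseteq> U \<longrightarrow> affine hull (f ` ball x r) = L"
  shows "\<exists>s>0. cube a s \<subseteq> U \<and> (\<forall>a1 b1. continuous_on (cube a s) (\<lambda>x. a1 + b1 \<bullet> f x)) \<and>
    (\<forall>\<eta>>0. \<exists>\<epsilon> l0. 0 < \<epsilon> \<and> \<epsilon> \<le> 1 \<and> (\<forall>a1 b1 l x \<rho>. l0 \<le> l \<longrightarrow> 0 < \<rho> \<longrightarrow>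
      dcell l x \<subseteq> cube a s \<longrightarrow> (\<exists>y\<in>dcell l x. \<rho> \<le> \<bar>a1 + b1 \<bullet> f y\<bar>) \<longrightarrow>
      small_sublevel \<eta> \<epsilon> \<rho> (\<lambda>y. a1 + b1 \<bullet> f y) (dcell l x)))"
proof -
  obtain C :: "('d \<Rightarrow> nat) \<Rightarrow> real ^ 'n" and r A where r: "r > 0" and A: "A \<ge> 0" and sub: "cube a r \<subseteq> U"
    and ss: "\<And>a1 b1. scaled_series (affine_coeffs a1 b1 C) r ((\<bar>a1\<bar> + norm b1) * (1 + A))"
    and hs: "\<And>a1 b1. power_series_on (affine_coeffs a1 b1 C) a r (\<lambda>x. a1 + b1 \<bullet> f x)"
    using analytic_local_series[OF f U] by blast
  define s where "s = r / 8"
  define B0 where "B0 = cube a s"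
  have s: "s > 0" "s \<le> r" using r by (auto simp: s_def)
  have "B0 \<subseteq> cube a r" using s by (auto simp: B0_def cube_def intro: order_trans)
  then have B0U: "B0 \<subseteq> U" using sub by blast
  have cont: "continuous_on B0 (\<lambda>x. a1 + b1 \<bullet> f x)" for a1 b1
    unfolding B0_def s_def by (rule scaled_series.continuous_on_has_sum[OF ss hs])
  have ball: "ball a s \<subseteq> B0"
  proof
    fix x assume "x \<in> ball a s"
    then have "norm (x - a) \<le> s" by (simp add: dist_norm norm_minus_commute)
    then have "\<bar>(x - a) $ i\<bar> \<le> s" for i using component_le_norm_cart[of "x - a" i] by linarith
    then show "x \<in> B0" by (simp add: B0_def cube_def)
  qed
  have hull: "affine hull (f ` B0) = L"
  proof
    show "affine hull (f ` B0) \<subseteq> L" using B0U fL L by (intro hull_minimal) auto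
    have "L = affine hull (f ` ball a s)" using nondeg s(1) ball B0U by blast
    also have "\<dots> \<subseteq> affine hull (f ` B0)" using ball by (intro hull_mono) auto
    finally show "L \<subseteq> affine hull (f ` B0)" .
  qed
  have aB0: "a \<in> B0" using s by (simp add: B0_def cube_def)
  have ne: "B0 \<noteq> {}" using aB0 by blast
  obtain K where K: "K > 0" "\<And>a1 b1 S. (\<forall>x\<in>B0. \<bar>a1 + b1 \<bullet> f x\<bar> \<le> S) \<Longrightarrow>
      \<exists>a' b'. \<bar>a'\<bar> \<le> K * S \<and> norm b' \<le> K * S \<and> (\<forall>y\<in>L. a1 + b1 \<bullet> y = a' + b' \<bullet> y)"
    using affine_function_renormalize[OF hull ne] by blast
  define A' where "A' = (K + K) * (1 + A)"
  have A': "A' \<ge> 0" using K A by (simp add: A'_def)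
  have good: "\<exists>\<epsilon> l0. 0 < \<epsilon> \<and> \<epsilon> \<le> 1 \<and> (\<forall>a1 b1 l x \<rho>. l0 \<le> l \<longrightarrow> 0 < \<rho> \<longrightarrow>
      dcell l x \<subseteq> B0 \<longrightarrow> (\<exists>y\<in>dcell l x. \<rho> \<le> \<bar>a1 + b1 \<bullet> f y\<bar>) \<longrightarrow>
      small_sublevel \<eta> \<epsilon> \<rho> (\<lambda>y. a1 + b1 \<bullet> f y) (dcell l x))" if \<eta>: "\<eta> > 0" for \<eta>
  proof -
    from dcell_sublevel_small[OF r A' \<eta>, of a]
    obtain \<epsilon> l0 where \<epsilon>: "0 < \<epsilon>" "\<epsilon> \<le> 1" and main: "\<forall>c F l x \<rho>. scaled_series c r A' \<longrightarrow>
      power_series_on c a r F \<longrightarrow> (\<exists>x\<in>cube a (r / 8). 1 / 2 \<le> \<bar>F x\<bar>) \<longrightarrow> l0 \<le> l \<longrightarrow>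
      dcell l x \<subseteq> cube a (r / 8) \<longrightarrow> (\<exists>y\<in>dcell l x. \<rho> \<le> \<bar>F y\<bar>) \<longrightarrow>
      small_sublevel \<eta> \<epsilon> \<rho> F (dcell l x)"
      by (elim exE conjE)
    show ?thesis
    proof (rule exI[of _ \<epsilon>], rule exI[of _ l0], intro conjI allI impI \<epsilon>)
      fix a1 b1 l x \<rho>
      assume l: "l0 \<le> l" and \<rho>: "0 < \<rho>" and cell: "dcell l x \<subseteq> B0"
        and big: "\<exists>y\<in>dcell l x. \<rho> \<le> \<bar>a1 + b1 \<bullet> f y\<bar>"
      let ?g = "\<lambda>x. \<bar>a1 + b1 \<bullet> f x\<bar>"
      obtain y1 where y1: "y1 \<in> dcell l x" "\<rho> \<le> ?g y1" using big by blast
      define S where "S = (SUP x\<in>B0. ?g x)"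
      have bdd: "bdd_above (?g ` B0)"
      proof -
        have "compact B0"
        proof -
          have "B0 = cbox (a - (\<chi> i. s)) (a + (\<chi> i. s))"
            by (auto simp: B0_def cube_def mem_box_cart abs_le_iff algebra_simps)
          then show ?thesis by simp
        qed
        moreover have "continuous_on B0 ?g" by (rule continuous_on_rabs[OF cont])
        ultimately show ?thesis
          by (intro bounded_imp_bdd_above compact_imp_bounded compact_continuous_image)
      qed
      have gS: "?g x \<le> S" if "x \<in> B0" for x unfolding S_def using that by (intro cSUP_upper bdd)
      have S: "S > 0" using gS[of y1] y1 cell \<rho> by auto
      have "S / 2 < S" using S by simp
      then obtain x1 where x1: "x1 \<in> B0" "S / 2 < ?g x1"
        unfolding S_def using less_cSUP_iff[OF ne bdd] by (metis S_def)
      have sc: "a1 / S + (b1 /\<^sub>R S) \<bullet> y = (a1 + b1 \<bullet> y) / S" for y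
        by (simp add: divide_inverse algebra_simps)
      have "\<forall>x\<in>B0. \<bar>a1 / S + (b1 /\<^sub>R S) \<bullet> f x\<bar> \<le> 1"
        unfolding sc using gS S by (simp add: abs_divide)
      then obtain a' b' where ab: "\<bar>a'\<bar> \<le> K * 1" "norm b' \<le> K * 1"
          "\<forall>y\<in>L. a1 / S + (b1 /\<^sub>R S) \<bullet> y = a' + b' \<bullet> y"
        using K(2) by blast
      define F where "F = (\<lambda>x. a' + b' \<bullet> f x)"
      have Fx: "F x = (a1 + b1 \<bullet> f x) / S" if "x \<in> B0" for x
      proof -
        have "f x \<in> L" using that B0U fL by blast
        then show ?thesis using ab(3) sc[of "f x"] by (simp add: F_def)
      qed
      have absF: "\<bar>F x\<bar> = ?g x / S" if "x \<in> B0" for x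
        unfolding Fx[OF that] using S by (simp add: abs_divide)
      have "1 / 2 \<le> \<bar>F x1\<bar>" unfolding absF[OF x1(1)] using x1(2) S by (simp add: field_simps)
      then have "\<exists>x\<in>cube a (r / 8). 1 / 2 \<le> \<bar>F x\<bar>" using x1(1) by (auto simp: B0_def s_def)
      moreover have "scaled_series (affine_coeffs a' b' C) r A'"
      proof -
        have "(\<bar>a'\<bar> + norm b') * (1 + A) \<le> A'"
          unfolding A'_def using ab A by (intro mult_right_mono add_mono) auto
        then show ?thesis using ss[of a' b'] unfolding scaled_series_def by (meson order_trans)
      qed
      moreover have "power_series_on (affine_coeffs a' b' C) a r F" unfolding F_def by (rule hs)
      moreover have "dcell l x \<subseteq> cube a (r / 8)" using cell by (simp add: B0_def s_def)
      moreover have "\<exists>y\<in>dcell l x. \<rho> / S \<le> \<bar>F y\<bar>"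
        using y1 cell S absF[of y1] by (intro bexI[of _ y1]) (auto simp: divide_right_mono)
      ultimately have "small_sublevel \<eta> \<epsilon> (\<rho> / S) F (dcell l x)"
        using main l by blast
      moreover have "\<bar>F y\<bar> < \<epsilon> * (\<rho> / S) \<longleftrightarrow> ?g y < \<epsilon> * \<rho>" if "y \<in> dcell l x" for y
        using absF[of y] that cell S by (auto simp: divide_less_cancel)
      then have "{y \<in> dcell l x. \<bar>F y\<bar> < \<epsilon> * (\<rho> / S)} = {y \<in> dcell l x. ?g y < \<epsilon> * \<rho>}" by blast
      ultimately show "small_sublevel \<eta> \<epsilon> \<rho> (\<lambda>y. a1 + b1 \<bullet> f y) (dcell l x)"
        unfolding small_sublevel_def by (simp only:)
    qed
  qed
  show ?thesis
    using s B0U cont good unfolding B0_def by (intro exI[of _ s]) blast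
qed

section \<open>Nondivergence at one time and the singular set of one cell\<close>

lemma dcell_subset_open:
  assumes "open S" "x \<in> S"
  shows "\<exists>l. dcell l x \<subseteq> S"
proof -
  obtain e where e: "e > 0" "ball x e \<subseteq> S" using assms open_contains_ball by blast
  let ?d = "real CARD('a)"
  obtain l :: nat where l: "(1 / 2 :: real) ^ l < e / ?d"
    using real_arch_pow_inv[of "e / ?d" "1 / 2"] e by auto
  have "dcell l x \<subseteq> ball x e"
  proof
    fix y assume y: "y \<in> dcell l x"
    have "norm (y - x) \<le> (\<Sum>i\<in>UNIV. \<bar>(y - x) $ i\<bar>)" by (rule norm_le_l1_cart)
    also have "\<dots> \<le> (\<Sum>i\<in>(UNIV :: 'a set). (1 / 2) ^ l)"
      using dcell_close[OF y] by (intro sum_mono) simp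
    also have "\<dots> < e" using l by (simp add: pos_less_divide_eq mult.commute)
    finally show "y \<in> ball x e" by (simp add: dist_norm norm_minus_commute)
  qed
  then show ?thesis using e by blast
qed

text \<open>The ball around the midpoint of the cell; through it, nondegeneracy on balls passes to
  cells.\<close>

lemma ball_subset_dcell:
  fixes x :: "real ^ 'd"
  shows "\<exists>z e. e > 0 \<and> ball z e \<subseteq> dcell l x"
proof -
  define z :: "real ^ 'd" where "z = (\<chi> i. (of_int \<lfloor>2 ^ l * x $ i\<rfloor> + 1 / 2) / 2 ^ l)"
  have "ball z (1 / 2 / 2 ^ l) \<subseteq> dcell l x"
  proof
    fix y assume "y \<in> ball z (1 / 2 / 2 ^ l)"
    then have n: "norm (y - z) < 1 / 2 / 2 ^ l" by (simp add: dist_norm norm_minus_commute)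
    have "\<lfloor>2 ^ l * y $ i\<rfloor> = \<lfloor>2 ^ l * x $ i\<rfloor>" for i
    proof -
      have "\<bar>y $ i - z $ i\<bar> < 1 / 2 / 2 ^ l"
        using component_le_norm_cart[of "y - z" i] n by simp
      then have "2 ^ l * \<bar>y $ i - z $ i\<bar> < 1 / 2" by (simp add: field_simps)
      moreover have "2 ^ l * \<bar>y $ i - z $ i\<bar> = \<bar>2 ^ l * y $ i - 2 ^ l * z $ i\<bar>"
        by (simp add: abs_mult flip: right_diff_distrib)
      moreover have "2 ^ l * z $ i = of_int \<lfloor>2 ^ l * x $ i\<rfloor> + 1 / 2" by (simp add: z_def)
      ultimately have "of_int \<lfloor>2 ^ l * x $ i\<rfloor> \<le> 2 ^ l * y $ i" "2 ^ l * y $ i < of_int \<lfloor>2 ^ l * x $ i\<rfloor> + 1"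
        by linarith+
      then show ?thesis by (simp add: floor_eq_iff)
    qed
    then show "y \<in> dcell l x" by (simp add: dcell_def)
  qed
  then show ?thesis by (intro exI[of _ z] exI[of _ "1 / 2 / 2 ^ l"]) auto
qed

text \<open>A covolume is the maximum of finitely many minors, each an affine and hence continuous
  function of \<open>f y\<close>.\<close>

lemma isCont_covol_less:
  fixes f :: "real ^ 'd \<Rightarrow> real ^ 'n"
  assumes "isCont f x" and less: "covol W (dani t (f x)) < \<rho>"
  shows "\<exists>l. \<forall>y\<in>dcell l x. covol W (dani t (f y)) < \<rho>"
proof -
  have "\<forall>\<^sub>F y in nhds x. \<bar>minor (dim W) (rep W) (dani t (f y)) \<sigma>\<bar> < \<rho>" for \<sigma>
  proof -
    obtain a b where ab: "\<And>y :: real ^ 'n. minor (dim W) (rep W) (dani t y) \<sigma> = a + b \<bullet> y"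
      using minor_dani_affine by blast
    have "isCont (\<lambda>y. \<bar>a + b \<bullet> f y\<bar>) x" using assms(1) by (intro continuous_intros)
    then have lim: "((\<lambda>y. \<bar>a + b \<bullet> f y\<bar>) \<longlongrightarrow> \<bar>a + b \<bullet> f x\<bar>) (nhds x)"
      using tendsto_at_iff_tendsto_nhds[of "\<lambda>y. \<bar>a + b \<bullet> f y\<bar>" x] unfolding isCont_def by blast
    have "\<bar>a + b \<bullet> f x\<bar> < \<rho>"
      using abs_minor_le_vol[of "dim W" "rep W" "dani t (f x)" \<sigma>] less unfolding covol_def ab by linarith
    from order_tendstoD(2)[OF lim this] show ?thesis unfolding ab .
  qed
  then have "\<forall>\<^sub>F y in nhds x. \<forall>\<sigma>. \<bar>minor (dim W) (rep W) (dani t (f y)) \<sigma>\<bar> < \<rho>"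
    by (intro eventually_all_finite)
  then have "\<forall>\<^sub>F y in nhds x. covol W (dani t (f y)) < \<rho>"
  proof eventually_elim
    case (elim y)
    then show ?case unfolding covol_def using vol_attained[of "dim W" "rep W" "dani t (f y)"] by auto
  qed
  then obtain S where "open S" "x \<in> S" "\<forall>y\<in>S. covol W (dani t (f y)) < \<rho>"
    unfolding eventually_nhds by blast
  then show ?thesis using dcell_subset_open[of S x] by blast
qed

lemma rational_subspace_tuples: "W \<in> rational_subspaces \<Longrightarrow> tuples W \<noteq> {}"
  unfolding rational_subspaces_def using tuples_nonempty by blast

text \<open>The marking argument for the covolumes at one time \<open>t\<close>, with lower
  threshold \<open>\<epsilon> * \<rho>\<close>. At a marked point a vector of size
  \<open>\<epsilon> * \<rho> / (2 * k)\<close> would force \<open>\<epsilon> * \<rho>\<close> to be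
  at most its own half.\<close>

lemma cell_short_vectors_small:
  fixes f :: "real ^ 'd \<Rightarrow> real ^ 'n"
  defines "k \<equiv> CARD('n coord)"
  assumes t: "t > 0" and \<rho>: "0 < \<rho>" "\<rho> \<le> 1" and \<epsilon>: "0 < \<epsilon>" "\<epsilon> \<le> 1" and "\<eta> \<ge> 0"
    and cont: "\<And>y. y \<in> dcell l x \<Longrightarrow> isCont f y"
    and good: "\<And>a b l' x'. l \<le> l' \<Longrightarrow> dcell l' x' \<subseteq> dcell l x \<Longrightarrow>
      \<exists>y\<in>dcell l' x'. \<rho> \<le> \<bar>a + b \<bullet> f y\<bar> \<Longrightarrow>
      small_sublevel \<eta> \<epsilon> \<rho> (\<lambda>y. a + b \<bullet> f y) (dcell l' x')"
    and big: "\<And>W. W \<in> rational_subspaces \<Longrightarrow> \<exists>y\<in>dcell l x. \<rho> \<le> covol W (dani t (f y))"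
  shows "\<exists>N\<in>sets lebesgue.
    emeasure lebesgue N \<le> ennreal (\<eta> * nondiv_const (2 ^ CARD('d)) k) * emeasure lebesgue (dcell l x) \<and>
    {y \<in> dcell l x. has_short_vector t (f y) (\<epsilon> * \<rho> / (2 * k))} \<subseteq> N"
proof -
  let ?P = "rational_subspaces :: (real ^ 'n coord) set set"
  have "\<exists>N\<in>sets lebesgue.
    emeasure lebesgue N \<le> ennreal (\<eta> * nondiv_const (2 ^ CARD('d)) k) * emeasure lebesgue (dcell l x) \<and>
    (\<forall>y\<in>dcell l x - N. \<exists>T'. {} \<subseteq> T' \<and> clique comparable ?P T' \<and>
      (\<forall>W\<in>T' - {}. \<epsilon> * \<rho> \<le> covol W (dani t (f y)) \<and> covol W (dani t (f y)) \<le> \<rho>) \<and>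
      (\<forall>W\<in>completions comparable ?P T'. \<rho> \<le> covol W (dani t (f y))))"
  proof (rule dyadic_nondivergence[where R = "dcell l x" and ?l0.0 = l and k = k and \<rho> = \<rho>])
    show "comparable A A" for A :: "(real ^ 'n coord) set" by (simp add: comparable_def)
    show "comparable B A" if "comparable A B" for A B :: "(real ^ 'n coord) set"
      using that by (auto simp: comparable_def)
    show "finite T \<and> card T \<le> k" if "clique comparable ?P T" for T
      unfolding k_def by (rule rational_subspace_clique[OF that])
    show "\<exists>l. \<forall>y\<in>dcell l z. covol W (dani t (f y)) < \<rho>"
      if "z \<in> dcell l x" "covol W (dani t (f z)) < \<rho>" for W z
      using isCont_covol_less[OF cont] that by blast
    show "\<exists>E\<in>sets lebesgue. {y \<in> dcell l' x'. covol W (dani t (f y)) < \<epsilon> * \<rho>} \<subseteq> E \<and>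
        emeasure lebesgue E \<le> ennreal \<eta> * emeasure lebesgue (dcell l' x')"
      if l': "l \<le> l'" "dcell l' x' \<subseteq> dcell l x" and ex: "\<exists>y\<in>dcell l' x'. \<rho> \<le> covol W (dani t (f y))"
      for W l' x'
    proof -
      obtain y where y: "y \<in> dcell l' x'" "\<rho> \<le> covol W (dani t (f y))" using ex by blast
      \<comment> \<open>The minor that attains the covolume at a point where it reaches
        \<open>\<rho>\<close>: it satisfies the hypothesis of the sublevel estimate, and its
        sublevel set contains that of the covolume.\<close>
      obtain \<sigma> where \<sigma>: "covol W (dani t (f y)) = \<bar>minor (dim W) (rep W) (dani t (f y)) \<sigma>\<bar>"
        unfolding covol_def using vol_attained by blast
      obtain a b where ab: "\<And>y :: real ^ 'n. minor (dim W) (rep W) (dani t y) \<sigma> = a + b \<bullet> y"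
        using minor_dani_affine by blast
      have "\<exists>y\<in>dcell l' x'. \<rho> \<le> \<bar>a + b \<bullet> f y\<bar>" using y \<sigma> ab by auto
      moreover have "{y \<in> dcell l' x'. covol W (dani t (f y)) < \<epsilon> * \<rho>}
          \<subseteq> {y \<in> dcell l' x'. \<bar>a + b \<bullet> f y\<bar> < \<epsilon> * \<rho>}"
        unfolding covol_def ab[symmetric] using abs_minor_le_vol le_less_trans by blast
      ultimately show ?thesis using good[OF l', of a b] unfolding small_sublevel_def by blast
    qed
    show "clique comparable ?P {}" by (simp add: clique_def)
    show "\<exists>y\<in>dcell l x. \<rho> \<le> covol W (dani t (f y))" if "W \<in> completions comparable ?P {}" for W
      using big that by (simp add: completions_def)
  qed (use \<open>\<eta> \<ge> 0\<close> in auto)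
  then obtain N where N: "N \<in> sets lebesgue"
    "emeasure lebesgue N \<le> ennreal (\<eta> * nondiv_const (2 ^ CARD('d)) k) * emeasure lebesgue (dcell l x)"
    and marked: "\<And>y. y \<in> dcell l x - N \<Longrightarrow> \<exists>T'. clique comparable ?P T' \<and>
      (\<forall>W\<in>T'. \<epsilon> * \<rho> \<le> covol W (dani t (f y)) \<and> covol W (dani t (f y)) \<le> \<rho>) \<and>
      (\<forall>W\<in>completions comparable ?P T'. \<rho> \<le> covol W (dani t (f y)))"
    by auto
  have "y \<in> N" if y: "y \<in> dcell l x" and v: "integral_vec v" "v \<noteq> 0"
    and short: "\<And>i. \<bar>dani t (f y) v $ i\<bar> \<le> \<epsilon> * \<rho> / (2 * k)" for y v
  proof (rule ccontr)
    assume "y \<notin> N"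
    then obtain T' where T': "clique comparable ?P T'"
      "\<And>W. W \<in> T' \<Longrightarrow> \<epsilon> * \<rho> \<le> covol W (dani t (f y)) \<and> covol W (dani t (f y)) \<le> \<rho>"
      "\<And>W. W \<in> completions comparable ?P T' \<Longrightarrow> \<rho> \<le> covol W (dani t (f y))"
      using marked[of y] y by blast
    have "\<epsilon> * \<rho> \<le> \<rho>" using \<epsilon> \<rho> by (simp add: mult_le_cancel_right2)
    then have "\<epsilon> * \<rho> \<le> CARD('n coord) * (\<epsilon> * \<rho> / (2 * k))"
      using T' \<rho> by (intro no_short_vectors_of_marked[OF linear_dani T'(1) _ _ _ v short])
        (blast intro: order_trans)+
    also have "\<dots> = \<epsilon> * \<rho> / 2" by (simp add: k_def)
    finally show False using \<epsilon> \<rho> by (simp add: mult_le_0_iff)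
  qed
  then show ?thesis using N unfolding has_short_vector_def by (intro bexI[of _ N]) auto
qed

text \<open>If a covolume stayed below \<open>\<rho>\<close> on the image of the cell, the minor
  attaining it at \<open>y0\<close> would be at most \<open>C1 * \<rho>\<close> there, although the
  absence of short vectors at \<open>y0\<close> keeps the covolume at least \<open>\<rho>0\<close>.
  The constant \<open>C1\<close> does not depend on the time or the subspace, so
  \<open>\<rho>\<close> and the length \<open>\<delta>\<close> serve all times at which
  \<open>y0\<close> has no short vector.\<close>

lemma cell_singular_small:
  fixes f :: "real ^ 'd \<Rightarrow> real ^ 'n"
  defines "k \<equiv> CARD('n coord)"
  assumes y0: "y0 \<in> L" "\<not> singular_vector y0" and hull: "affine hull (f ` dcell l x) = L"
    and \<epsilon>: "0 < \<epsilon>" "\<epsilon> \<le> 1" and "\<eta> \<ge> 0"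
    and cont: "\<And>y. y \<in> dcell l x \<Longrightarrow> isCont f y"
    and good: "\<And>a b l' x' \<rho>. l \<le> l' \<Longrightarrow> 0 < \<rho> \<Longrightarrow> dcell l' x' \<subseteq> dcell l x \<Longrightarrow>
      \<exists>y\<in>dcell l' x'. \<rho> \<le> \<bar>a + b \<bullet> f y\<bar> \<Longrightarrow>
      small_sublevel \<eta> \<epsilon> \<rho> (\<lambda>y. a + b \<bullet> f y) (dcell l' x')"
  shows "\<exists>N\<in>sets lebesgue.
    emeasure lebesgue N \<le> ennreal (\<eta> * nondiv_const (2 ^ CARD('d)) k) * emeasure lebesgue (dcell l x) \<and>
    {y \<in> dcell l x. singular_vector (f y)} \<subseteq> N"
proof -
  let ?Q = "dcell l x" and ?K = "ennreal (\<eta> * nondiv_const (2 ^ CARD('d)) k) * emeasure lebesgue (dcell l x)"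
  obtain c where c: "0 < c" "c \<le> 1" and freq: "\<exists>\<^sub>F t in at_top. t \<ge> 1 \<and> \<not> has_short_vector t y0 c"
    using nonsingular_imp_no_short_vectors[OF y0(2)] by blast
  have "?Q \<noteq> {}" using dcell_self by blast
  then obtain C where C: "C > 0" "\<And>a b s. (\<forall>x\<in>?Q. \<bar>a + b \<bullet> f x\<bar> \<le> s) \<Longrightarrow>
      \<exists>a' b'. \<bar>a'\<bar> \<le> C * s \<and> norm b' \<le> C * s \<and> (\<forall>y\<in>L. a + b \<bullet> y = a' + b' \<bullet> y)"
    using affine_function_renormalize[OF hull] by blast
  define C1 where "C1 = C * (1 + norm y0)"
  have C1: "C1 > 0" using C by (simp add: C1_def add_pos_nonneg)
  have at_y0: "\<bar>a + b \<bullet> y0\<bar> \<le> C1 * s" if ab_le: "\<forall>x\<in>?Q. \<bar>a + b \<bullet> f x\<bar> \<le> s" for a b s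
  proof -
    obtain a' b' where ab: "\<bar>a'\<bar> \<le> C * s" "norm b' \<le> C * s" "\<forall>y\<in>L. a + b \<bullet> y = a' + b' \<bullet> y"
      using C(2)[OF ab_le] by blast
    have "\<bar>b' \<bullet> y0\<bar> \<le> C * s * norm y0"
      using Cauchy_Schwarz_ineq2[of b' y0] mult_right_mono[OF ab(2), of "norm y0"] by simp
    then have "\<bar>a' + b' \<bullet> y0\<bar> \<le> C * s + C * s * norm y0" using ab(1) by linarith
    then show ?thesis using ab(3) y0(1) by (simp add: C1_def algebra_simps)
  qed
  define \<rho>0 where "\<rho>0 = (c / (4 * k)) ^ k"
  have \<rho>0: "\<rho>0 > 0" using c by (simp add: \<rho>0_def k_def)
  define \<rho> where "\<rho> = min 1 (\<rho>0 / (2 * C1))"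
  have \<rho>: "0 < \<rho>" "\<rho> \<le> 1" "C1 * \<rho> < \<rho>0"
  proof -
    show "0 < \<rho>" "\<rho> \<le> 1" using \<rho>0 C1 by (simp_all add: \<rho>_def)
    have "C1 * \<rho> \<le> C1 * (\<rho>0 / (2 * C1))" using C1 by (intro mult_left_mono) (auto simp: \<rho>_def)
    also have "\<dots> < \<rho>0" using C1 \<rho>0 by simp
    finally show "C1 * \<rho> < \<rho>0" .
  qed
  define \<delta> where "\<delta> = \<epsilon> * \<rho> / (2 * k)"
  have \<delta>: "\<delta> > 0" using \<epsilon> \<rho> by (simp add: \<delta>_def k_def)
  have step: "\<exists>N\<in>sets lebesgue. emeasure lebesgue N \<le> ?K \<and>
      {y \<in> ?Q. has_short_vector t (f y) \<delta>} \<subseteq> N"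
    if t: "t \<ge> 1" and long: "\<not> has_short_vector t y0 c" for t
    unfolding \<delta>_def k_def
  proof (rule cell_short_vectors_small)
    show "\<exists>y\<in>?Q. \<rho> \<le> covol W (dani t (f y))" if W: "W \<in> rational_subspaces" for W
    proof (rule ccontr)
      assume no: "\<not> ?thesis"
      have "\<rho>0 \<le> covol W (dani t y0)"
        unfolding \<rho>0_def k_def
      proof (intro covol_ge_of_no_short_vectors linear_dani inj_dani rational_subspace_tuples W c)
        show "\<exists>i. c \<le> \<bar>dani t y0 v $ i\<bar>" if "integral_vec v" "v \<noteq> 0" for v
          using long that unfolding has_short_vector_def by (meson linear)
      qed (use t in simp)
      moreover obtain \<sigma> where \<sigma>: "covol W (dani t y0) = \<bar>minor (dim W) (rep W) (dani t y0) \<sigma>\<bar>"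
        unfolding covol_def using vol_attained by blast
      moreover obtain a b where ab: "\<And>y :: real ^ 'n. minor (dim W) (rep W) (dani t y) \<sigma> = a + b \<bullet> y"
        using minor_dani_affine by blast
      moreover have "\<forall>x\<in>?Q. \<bar>a + b \<bullet> f x\<bar> \<le> \<rho>"
      proof
        fix z assume "z \<in> ?Q"
        then have "covol W (dani t (f z)) < \<rho>" using no by (meson not_le)
        then show "\<bar>a + b \<bullet> f z\<bar> \<le> \<rho>"
          using abs_minor_le_vol[of "dim W" "rep W" "dani t (f z)" \<sigma>] unfolding ab covol_def by linarith
      qed
      ultimately show False using at_y0[of a b \<rho>] \<rho>(3) by simp
    qed
    show "small_sublevel \<eta> \<epsilon> \<rho> (\<lambda>y. a + b \<bullet> f y) (dcell l' x')"
      if "l \<le> l'" "dcell l' x' \<subseteq> dcell l x" "\<exists>y\<in>dcell l' x'. \<rho> \<le> \<bar>a + b \<bullet> f y\<bar>" for a b l' x'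
      by (rule good[OF that(1) \<rho>(1) that(2,3)])
    show "isCont f y" if "y \<in> ?Q" for y by (rule cont[OF that])
    show "0 \<le> \<eta>" by fact
  qed (use t \<rho> \<epsilon> in auto)
  have "\<exists>t\<ge>real n. t \<ge> 1 \<and> \<not> has_short_vector t y0 c" for n
    using freq unfolding frequently_def eventually_at_top_linorder by blast
  then obtain t where t: "\<And>n. t n \<ge> real n" "\<And>n. t n \<ge> 1"
    "\<And>n. \<not> has_short_vector (t n) y0 c" by metis
  have "\<exists>N. \<forall>n. N n \<in> sets lebesgue \<and> emeasure lebesgue (N n) \<le> ?K \<and>
      {y \<in> ?Q. has_short_vector (t n) (f y) \<delta>} \<subseteq> N n"
  proof (rule choice, rule allI)
    fix n
    show "\<exists>N. N \<in> sets lebesgue \<and> emeasure lebesgue N \<le> ?K \<and>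
      {y \<in> ?Q. has_short_vector (t n) (f y) \<delta>} \<subseteq> N"
      using step[OF t(2,3)[of n]] by blast
  qed
  then obtain N where N0: "\<forall>n. N n \<in> sets lebesgue \<and> emeasure lebesgue (N n) \<le> ?K \<and>
      {y \<in> ?Q. has_short_vector (t n) (f y) \<delta>} \<subseteq> N n"
    by (rule exE)
  note N = N0[THEN spec, THEN conjunct1] N0[THEN spec, THEN conjunct2, THEN conjunct1]
    N0[THEN spec, THEN conjunct2, THEN conjunct2]
  \<comment> \<open>The liminf of the sets \<open>N n\<close> is the increasing union of these tail
    intersections, each of which lies in one \<open>N m\<close>. The union inherits the bound
    \<open>?K\<close>.\<close>
  define M where "M m = (\<Inter>n\<in>{m..}. N n)" for m
  have M: "M m \<in> sets lebesgue" for m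
    unfolding M_def using N(1) by (intro sets.countable_INT') auto
  show ?thesis
  proof (intro bexI[of _ "\<Union>m. M m"] conjI)
    show "(\<Union>m. M m) \<in> sets lebesgue" using M by blast
    have "incseq M" by (auto simp: incseq_def M_def)
    then have "emeasure lebesgue (\<Union>m. M m) = (SUP m. emeasure lebesgue (M m))"
      using M by (intro SUP_emeasure_incseq[symmetric]) auto
    also have "\<dots> \<le> ?K"
    proof (rule SUP_least)
      fix m
      have "emeasure lebesgue (M m) \<le> emeasure lebesgue (N m)"
        using N(1) by (intro emeasure_mono) (auto simp: M_def)
      then show "emeasure lebesgue (M m) \<le> ?K" using N(2)[of m] by (rule order_trans)
    qed
    finally show "emeasure lebesgue (\<Union>m. M m) \<le> ?K" .
    show "{y \<in> ?Q. singular_vector (f y)} \<subseteq> (\<Union>m. M m)"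
    proof
      fix y assume y: "y \<in> {y \<in> ?Q. singular_vector (f y)}"
      then have "singular_vector (f y)" by simp
      from singular_imp_short_vectors[OF this \<delta>] obtain T where
        T: "\<And>s. s \<ge> T \<Longrightarrow> has_short_vector s (f y) \<delta>"
        unfolding eventually_at_top_linorder by blast
      obtain m :: nat where m: "T \<le> real m" using real_arch_simple by blast
      have "y \<in> N n" if "n \<ge> m" for n
      proof -
        have "T \<le> t n" using m that t(1)[of n] by (meson of_nat_mono order_trans)
        from T[OF this] show ?thesis using N(3)[of n] y by blast
      qed
      then show "y \<in> (\<Union>m. M m)" unfolding M_def by blast
    qed
  qed
qed

text \<open>Near each point of the set, a grid of small cells inside one fixed cube is used. In
  every cell the singular part has proportion at most \<open>\<eta>\<close> times a dimensional
  constant, and \<open>\<eta>\<close> is arbitrary.\<close>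

lemma singular_negligible:
  fixes f :: "real ^ 'd \<Rightarrow> real ^ 'n"
  assumes f: "real_analytic_on f U" and U: "open U" and fL: "f ` U \<subseteq> L" and L: "affine L"
    and nondeg: "\<forall>x r. r > 0 \<longrightarrow> ball x r \<subseteq> U \<longrightarrow> affine hull (f ` ball x r) = L"
    and y0: "y0 \<in> L" "\<not> singular_vector y0"
  shows "negligible {x \<in> U. singular_vector (f x)}"
  unfolding locally_negligible_alt[of "{x \<in> U. singular_vector (f x)}"]
proof
  let ?S = "{x \<in> U. singular_vector (f x)}" and ?c = "nondiv_const (2 ^ CARD('d)) CARD('n coord)"
  fix a assume a: "a \<in> ?S"
  then have "a \<in> U" by simp
  obtain s where s: "s > 0" and sU: "cube a s \<subseteq> U"
    and cont: "\<forall>a1 b1. continuous_on (cube a s) (\<lambda>x. a1 + b1 \<bullet> f x)"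
    and good: "\<forall>\<eta>>0. \<exists>\<epsilon> l0. 0 < \<epsilon> \<and> \<epsilon> \<le> 1 \<and> (\<forall>a1 b1 l x \<rho>. l0 \<le> l \<longrightarrow> 0 < \<rho> \<longrightarrow>
      dcell l x \<subseteq> cube a s \<longrightarrow> (\<exists>y\<in>dcell l x. \<rho> \<le> \<bar>a1 + b1 \<bullet> f y\<bar>) \<longrightarrow>
      small_sublevel \<eta> \<epsilon> \<rho> (\<lambda>y. a1 + b1 \<bullet> f y) (dcell l x))"
    using affine_functions_sublevel_small[OF f U \<open>a \<in> U\<close> fL L nondeg] by (elim exE conjE)
  define B0 where "B0 = cbox (a - (\<chi> i. s)) (a + (\<chi> i. s))"
  define B1 where "B1 = box (a - (\<chi> i. s)) (a + (\<chi> i. s))"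
  \<comment> \<open>Cells of side below \<open>s / 2\<close> that meet the half-size box
    \<open>V\<close> stay inside the open box \<open>B1\<close>, where \<open>f\<close> is
    continuous at every point and the sublevel estimates hold.\<close>
  define V where "V = box (a - (\<chi> i. s / 2)) (a + (\<chi> i. s / 2))"
  have B0: "B0 = cube a s"
    by (auto simp: B0_def cube_def mem_box_cart abs_le_iff algebra_simps)
  have fcont: "isCont f y" if y: "y \<in> B1" for y
  proof -
    have "B1 \<subseteq> B0" by (simp add: B0_def B1_def box_subset_cbox)
    then have "continuous_on B1 (\<lambda>x. 0 + axis i 1 \<bullet> f x)" for i
      using continuous_on_subset[OF cont[THEN spec, of 0, THEN spec, of "axis i 1"]] B0 by simp
    then have "continuous_on B1 (\<lambda>x. \<chi> i. f x $ i)"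
      by (intro continuous_on_vec_lambda) (simp add: inner_axis')
    then have "continuous_on B1 f" by simp
    moreover have "open B1" unfolding B1_def by (rule open_box)
    ultimately show ?thesis using y continuous_on_eq_continuous_at[of B1 f] by blast
  qed
  have small: "negligible (?S \<inter> V)"
    unfolding negligible_outer_le
  proof (intro allI impI)
    fix e :: real assume e: "e > 0"
    define \<mu> where "\<mu> = measure lebesgue B0"
    \<comment> \<open>Chosen so that the loss of the marking argument times the measure of the cube
      is at most \<open>e\<close>; adding 1 keeps the denominator positive.\<close>
    define \<eta> where "\<eta> = e / ((?c + 1) * (\<mu> + 1))"
    have c: "?c \<ge> 0" by (rule nondiv_const_nonneg) simp
    have \<mu>: "\<mu> \<ge> 0" by (simp add: \<mu>_def)
    have \<eta>: "\<eta> > 0" using e c \<mu> by (simp add: \<eta>_def)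
    have \<eta>e: "\<eta> * ?c * \<mu> \<le> e"
    proof -
      have "\<eta> * (?c * \<mu>) \<le> \<eta> * ((?c + 1) * (\<mu> + 1))" using c \<mu> \<eta> by (intro mult_left_mono mult_mono) auto
      also have "\<dots> = e" using c \<mu> by (simp add: \<eta>_def)
      finally show ?thesis by (simp add: mult.assoc)
    qed
    obtain \<epsilon> l0 where \<epsilon>: "0 < \<epsilon>" "\<epsilon> \<le> 1" and good': "\<forall>a1 b1 l x \<rho>. l0 \<le> l \<longrightarrow> 0 < \<rho> \<longrightarrow>
      dcell l x \<subseteq> cube a s \<longrightarrow> (\<exists>y\<in>dcell l x. \<rho> \<le> \<bar>a1 + b1 \<bullet> f y\<bar>) \<longrightarrow>
      small_sublevel \<eta> \<epsilon> \<rho> (\<lambda>y. a1 + b1 \<bullet> f y) (dcell l x)"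
      using good[THEN spec, THEN mp, OF \<eta>] by (elim exE conjE)
    obtain l1 :: nat where l1: "(1 / 2 :: real) ^ l1 < s / 2"
      using real_arch_pow_inv[of "s / 2" "1 / 2"] s by auto
    define l where "l = max l0 l1"
    have l: "l0 \<le> l" by (simp add: l_def)
    have "(1 / 2 :: real) ^ l \<le> (1 / 2) ^ l1" unfolding l_def by (intro power_decreasing) auto
    then have ls: "(1 / 2 :: real) ^ l < s / 2" using l1 by linarith
    define \<C> where "\<C> = dcell l ` V"
    have sub1: "C \<subseteq> B1" if C: "C \<in> \<C>" for C
    proof
      fix y assume "y \<in> C"
      then obtain x where x: "x \<in> V" "y \<in> dcell l x" using C by (auto simp: \<C>_def)
      have "a $ i - s < y $ i \<and> y $ i < a $ i + s" for i
      proof -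
        have "a $ i - s / 2 < x $ i \<and> x $ i < a $ i + s / 2"
          using x(1) by (auto simp: V_def mem_box_cart dest: spec[of _ i])
        then show ?thesis using dcell_close[OF x(2), of i] ls unfolding abs_le_iff by linarith
      qed
      then show "y \<in> B1" by (simp add: B1_def mem_box_cart)
    qed
    have B1B0: "B1 \<subseteq> B0" by (simp add: B0_def B1_def box_subset_cbox)
    have cell: "\<exists>N. N \<in> sets lebesgue \<and> emeasure lebesgue N \<le> ennreal (\<eta> * ?c) * emeasure lebesgue C
        \<and> {y \<in> C. singular_vector (f y)} \<subseteq> N" if C: "C \<in> \<C>" for C
    proof -
      obtain x where x: "x \<in> V" "C = dcell l x" using C by (auto simp: \<C>_def)
      have CB: "dcell l x \<subseteq> B1" "dcell l x \<subseteq> cube a s"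
        using sub1[OF C] B1B0 x B0 by auto
      have hull: "affine hull (f ` dcell l x) = L"
      proof
        have "f ` dcell l x \<subseteq> L" using CB(2) sU fL by blast
        then show "affine hull (f ` dcell l x) \<subseteq> L" using L by (rule hull_minimal)
        obtain z d where zd: "d > 0" "ball z d \<subseteq> dcell l x" using ball_subset_dcell by blast
        then have "L = affine hull (f ` ball z d)" using nondeg CB(2) sU by blast
        also have "\<dots> \<subseteq> affine hull (f ` dcell l x)" using zd by (intro hull_mono) auto
        finally show "L \<subseteq> affine hull (f ` dcell l x)" .
      qed
      have "\<exists>N\<in>sets lebesgue. emeasure lebesgue N \<le> ennreal (\<eta> * ?c) * emeasure lebesgue (dcell l x) \<and>
          {y \<in> dcell l x. singular_vector (f y)} \<subseteq> N"
      proof (rule cell_singular_small[OF y0 hull \<epsilon>])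
        show "isCont f y" if "y \<in> dcell l x" for y using fcont CB(1) that by blast
        show "small_sublevel \<eta> \<epsilon> \<rho> (\<lambda>y. a1 + b1 \<bullet> f y) (dcell l' x')"
          if "l \<le> l'" "0 < \<rho>" "dcell l' x' \<subseteq> dcell l x" "\<exists>y\<in>dcell l' x'. \<rho> \<le> \<bar>a1 + b1 \<bullet> f y\<bar>"
          for a1 b1 l' x' \<rho>
          using good' order_trans[OF l that(1)] order_trans[OF that(3) CB(2)] that(2,4) by blast
      qed (use \<eta> in auto)
      then show ?thesis using x by blast
    qed
    have "\<exists>N. \<forall>C\<in>\<C>. N C \<in> sets lebesgue \<and> emeasure lebesgue (N C) \<le> ennreal (\<eta> * ?c) * emeasure lebesgue C
        \<and> {y \<in> C. singular_vector (f y)} \<subseteq> N C"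
      by (intro bchoice ballI cell)
    then obtain N where N: "\<forall>C\<in>\<C>. N C \<in> sets lebesgue \<and>
        emeasure lebesgue (N C) \<le> ennreal (\<eta> * ?c) * emeasure lebesgue C
        \<and> {y \<in> C. singular_vector (f y)} \<subseteq> N C" by (rule exE)
    have N': "\<And>C. C \<in> \<C> \<Longrightarrow> N C \<in> sets lebesgue"
      "\<And>C. C \<in> \<C> \<Longrightarrow> emeasure lebesgue (N C \<inter> C) \<le> ennreal (\<eta> * ?c) * emeasure lebesgue C"
    proof -
      fix C assume C: "C \<in> \<C>"
      show 1: "N C \<in> sets lebesgue" using N C by blast
      have "emeasure lebesgue (N C \<inter> C) \<le> emeasure lebesgue (N C)" by (rule emeasure_mono[OF _ 1]) blast
      also have "\<dots> \<le> ennreal (\<eta> * ?c) * emeasure lebesgue C" using N C by blast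
      finally show "emeasure lebesgue (N C \<inter> C) \<le> ennreal (\<eta> * ?c) * emeasure lebesgue C" .
    qed
    have cnt: "countable \<C>" by (rule countable_subset[OF _ countable_dcells]) (auto simp: \<C>_def)
    have disj: "disjoint \<C>"
    proof (rule disjointI)
      fix C C' assume CC: "C \<in> \<C>" "C' \<in> \<C>" "C \<noteq> C'"
      then obtain x x' where x: "C = dcell l x" "C' = dcell l x'" unfolding \<C>_def by blast
      have "z \<notin> C \<inter> C'" for z using CC(3) dcell_eq[of z l x] dcell_eq[of z l x'] unfolding x by blast
      then show "C \<inter> C' = {}" by blast
    qed
    have Cm: "\<And>C. C \<in> \<C> \<Longrightarrow> C \<in> sets lebesgue" by (auto simp: \<C>_def)
    have UB: "\<Union>\<C> \<subseteq> B0" using sub1 B1B0 by blast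
    have B0m: "B0 \<in> lmeasurable" by (simp add: B0_def)
    note pieces = emeasure_pieces_le[OF cnt disj fmeasurableD[OF B0m] UB Cm N']
    define T where "T = (\<Union>C\<in>\<C>. N C \<inter> C)"
    have T: "T \<in> sets lebesgue" unfolding T_def by (rule pieces(1), assumption+)
    have "emeasure lebesgue T \<le> ennreal (\<eta> * ?c) * emeasure lebesgue B0" unfolding T_def by (rule pieces(2), assumption+)
    also have "\<dots> = ennreal (\<eta> * ?c * \<mu>)"
      using B0m \<eta> c \<mu> by (simp add: emeasure_eq_measure2 \<mu>_def ennreal_mult)
    finally have Tle: "emeasure lebesgue T \<le> ennreal (\<eta> * ?c * \<mu>)" .
    then have Tm: "T \<in> lmeasurable"
      using T by (intro fmeasurableI) (auto intro: le_less_trans)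
    have "measure lebesgue T \<le> \<eta> * ?c * \<mu>"
      using Tle Tm c \<mu> \<eta> by (simp add: emeasure_eq_measure2)
    moreover have "?S \<inter> V \<subseteq> T"
    proof
      fix y assume y: "y \<in> ?S \<inter> V"
      then have C: "dcell l y \<in> \<C>" by (auto simp: \<C>_def)
      then have "{z \<in> dcell l y. singular_vector (f z)} \<subseteq> N (dcell l y)" using N by blast
      then have "y \<in> N (dcell l y)" using y dcell_self[of y l] by blast
      then show "y \<in> T" using C unfolding T_def by (intro UN_I[of "dcell l y"]) auto
    qed
    ultimately show "\<exists>T. ?S \<inter> V \<subseteq> T \<and> T \<in> lmeasurable \<and> measure lebesgue T \<le> e"
      using Tm \<eta>e by (intro exI[of _ T]) auto
  qed
  have "a \<in> V" using s by (simp add: V_def mem_box_cart)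
  moreover have "openin (top_of_set ?S) (?S \<inter> V)" unfolding V_def by (rule openin_open_Int[OF open_box])
  ultimately show "\<exists>U. openin (top_of_set ?S) U \<and> a \<in> U \<and> negligible U" using a small by blast
qed

section \<open>Lebesgue measure on an affine subspace\<close>

lemma real_analytic_on_affine_map:
  fixes p :: "real ^ 'n" and w :: "'d::finite \<Rightarrow> real ^ 'n"
  shows "real_analytic_on (\<lambda>x :: real ^ 'd. p + (\<Sum>j\<in>UNIV. x $ j *\<^sub>R w j)) U"
  unfolding real_analytic_on_def
proof (intro ballI)
  fix a :: "real ^ 'd"
  let ?g = "\<lambda>x :: real ^ 'd. p + (\<Sum>j\<in>UNIV. x $ j *\<^sub>R w j)"
  \<comment> \<open>The exponents of the linear monomials; together with the zero exponent they
    carry the whole series.\<close>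
  let ?\<delta> = "\<lambda>j i :: 'd. if i = j then 1 else 0 :: nat"
  define C where "C = (\<lambda>\<alpha>. (if \<alpha> = (\<lambda>_. 0) then ?g a else 0) + (\<Sum>j\<in>UNIV. if \<alpha> = ?\<delta> j then w j else 0))"
  have "((\<lambda>\<alpha>. (\<Prod>i\<in>UNIV. (x $ i - a $ i) ^ \<alpha> i) *\<^sub>R C \<alpha>) has_sum ?g x) UNIV" for x
  proof -
    have "((\<lambda>\<alpha>. (if \<alpha> = (\<lambda>_. 0) then ?g a else 0)
        + (\<Sum>j\<in>UNIV. if \<alpha> = ?\<delta> j then (x $ j - a $ j) *\<^sub>R w j else 0))
        has_sum (?g a + (\<Sum>j\<in>UNIV. (x $ j - a $ j) *\<^sub>R w j))) UNIV"
      by (intro has_sum_add has_sum_single has_sum_sum) simp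
    moreover have "?g a + (\<Sum>j\<in>UNIV. (x $ j - a $ j) *\<^sub>R w j) = ?g x"
      by (simp add: scaleR_diff_left sum_subtractf)
    moreover have "(if \<alpha> = (\<lambda>_. 0) then ?g a else 0)
        + (\<Sum>j\<in>UNIV. if \<alpha> = ?\<delta> j then (x $ j - a $ j) *\<^sub>R w j else 0)
        = (\<Prod>i\<in>UNIV. (x $ i - a $ i) ^ \<alpha> i) *\<^sub>R C \<alpha>" for \<alpha>
    proof -
      have pd: "(\<Prod>i\<in>UNIV. (x $ i - a $ i) ^ ?\<delta> j i) = x $ j - a $ j" for j
        by (simp add: if_distrib[of "\<lambda>k. _ ^ k"] cong: if_cong)
      show ?thesis
        unfolding C_def scaleR_add_right scaleR_sum_right
        by (intro arg_cong2[of _ _ _ _ "(+)"] sum.cong refl) (auto simp: pd)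
    qed
    ultimately show ?thesis by simp
  qed
  then show "\<exists>C r. 0 < r \<and> (\<forall>x\<in>ball a r.
      ((\<lambda>\<alpha>. (\<Prod>i\<in>UNIV. (x $ i - a $ i) ^ \<alpha> i) *\<^sub>R C \<alpha>) has_sum ?g x) UNIV)"
    by (intro exI[of _ C] exI[of _ 1]) auto
qed

text \<open>Any \<open>g y\<close> is an affine combination of \<open>g x\<close> and
  \<open>g u\<close>, where \<open>u\<close> lies on the segment from \<open>x\<close> to
  \<open>y\<close> and inside the ball.\<close>

lemma affine_hull_affine_map_ball:
  fixes g :: "'a::real_normed_vector \<Rightarrow> 'b::real_vector"
  assumes g: "\<And>x y s. g ((1 - s) *\<^sub>R x + s *\<^sub>R y) = (1 - s) *\<^sub>R g x + s *\<^sub>R g y" and r: "r > 0"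
  shows "affine hull (g ` ball x r) = range g"
proof
  have "affine (range g)"
    unfolding affine_alt using g by (metis (no_types, lifting) image_iff rangeI)
  then show "affine hull (g ` ball x r) \<subseteq> range g" by (intro hull_minimal) auto
  show "range g \<subseteq> affine hull (g ` ball x r)"
  proof
    fix z assume "z \<in> range g"
    then obtain y where y: "z = g y" by blast
    define n where "n = norm (y - x) + 1"
    have n: "n > 0" "norm (y - x) < n" by (simp_all add: n_def add_nonneg_pos)
    define s where "s = r / (2 * n)"
    have s: "s > 0" using r n by (simp add: s_def)
    have "s * norm (y - x) < s * n" using s n by simp
    also have "\<dots> = r / 2" using n by (simp add: s_def)
    finally have "s * norm (y - x) < r" using r by simp
    define u where "u = (1 - s) *\<^sub>R x + s *\<^sub>R y"
    have "u - x = s *\<^sub>R (y - x)" by (simp add: u_def algebra_simps)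
    then have "u \<in> ball x r" using s \<open>s * norm (y - x) < r\<close> by (simp add: dist_norm norm_minus_commute)
    then have gu: "g u \<in> affine hull (g ` ball x r)" by (intro hull_inc) auto
    have gx: "g x \<in> affine hull (g ` ball x r)" using r by (intro hull_inc) auto
    have "(1 - 1 / s) *\<^sub>R g x + (1 / s) *\<^sub>R g u \<in> affine hull (g ` ball x r)"
      using affine_affine_hull gx gu unfolding affine_alt by blast
    moreover have "(1 - 1 / s) *\<^sub>R g x + (1 / s) *\<^sub>R g u = g y"
      unfolding u_def g using s by (simp add: algebra_simps)
    ultimately show "z \<in> affine hull (g ` ball x r)" using y by simp
  qed
qed

text \<open>Both measures give an open box the product of its side lengths. This connects the
  product measure in the definition of the measure on \<open>L\<close> with Lebesgue measure on
  vectors.\<close>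

lemma distr_PiM_lborel_vec:
  fixes \<kappa> :: "'n::finite \<Rightarrow> 'i"
  assumes \<kappa>: "bij_betw \<kappa> UNIV I"
  shows "distr (\<Pi>\<^sub>M i\<in>I. lborel) borel (\<lambda>h. \<chi> j. h (\<kappa> j)) = (lborel :: (real ^ 'n) measure)"
    and "(\<lambda>h. \<chi> j. h (\<kappa> j)) \<in> (\<Pi>\<^sub>M i\<in>I. (lborel :: real measure)) \<rightarrow>\<^sub>M (borel :: (real ^ 'n) measure)"
proof -
  interpret product_sigma_finite "\<lambda>_ :: 'i. lborel :: real measure" by standard
  let ?P = "\<Pi>\<^sub>M i\<in>I. (lborel :: real measure)" and ?\<Phi> = "\<lambda>h. \<chi> j. h (\<kappa> j) :: real ^ 'n"
  have fin: "finite I" using bij_betw_finite[OF \<kappa>] by simp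
  have \<kappa>I: "\<kappa> j \<in> I" for j using \<kappa> by (auto simp: bij_betw_def)
  have eq: "?\<Phi> = (\<lambda>h. \<Sum>j\<in>UNIV. h (\<kappa> j) *\<^sub>R axis j 1)"
    by (auto simp: fun_eq_iff vec_eq_iff axis_def if_distrib cong: if_cong)
  have comp: "(\<lambda>h. h (\<kappa> j)) \<in> borel_measurable ?P" for j
    using measurable_component_singleton[OF \<kappa>I, of j "\<lambda>_. lborel :: real measure"] by simp
  show m: "?\<Phi> \<in> ?P \<rightarrow>\<^sub>M borel"
    unfolding eq by (intro borel_measurable_sum borel_measurable_scaleR comp borel_measurable_const)
  have "(lborel :: (real ^ 'n) measure) = distr ?P borel ?\<Phi>"
  proof (rule lborel_eqI)
    fix l u :: "real ^ 'n" assume le: "\<And>b. b \<in> Basis \<Longrightarrow> l \<bullet> b \<le> u \<bullet> b"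
    have lu: "l $ j \<le> u $ j" for j
    proof -
      have "axis j (1 :: real) \<in> Basis" by (auto simp: Basis_vec_def)
      from le[OF this] show ?thesis by (simp add: inner_axis)
    qed
    have inv: "inv_into UNIV \<kappa> (\<kappa> j) = j" for j using \<kappa> by (simp add: bij_betw_def)
    have "?\<Phi> -` box l u \<inter> space ?P = (\<Pi>\<^sub>E i\<in>I. {l $ inv_into UNIV \<kappa> i <..< u $ inv_into UNIV \<kappa> i})"
    proof -
      have "(\<forall>j. l $ j < h (\<kappa> j) \<and> h (\<kappa> j) < u $ j) \<longleftrightarrow>
          (\<forall>i\<in>I. l $ inv_into UNIV \<kappa> i < h i \<and> h i < u $ inv_into UNIV \<kappa> i)" for h
        using inv \<kappa> by (auto simp: bij_betw_def)
      then show ?thesis by (auto simp: space_PiM mem_box_cart PiE_iff)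
    qed
    then have "emeasure (distr ?P borel ?\<Phi>) (box l u)
        = (\<Prod>i\<in>I. emeasure lborel {l $ inv_into UNIV \<kappa> i <..< u $ inv_into UNIV \<kappa> i})"
      using m fin by (simp add: emeasure_distr emeasure_PiM)
    also have "\<dots> = (\<Prod>j\<in>UNIV. emeasure lborel
        {l $ inv_into UNIV \<kappa> (\<kappa> j) <..< u $ inv_into UNIV \<kappa> (\<kappa> j)})"
      by (rule prod.reindex_bij_betw[OF \<kappa>, symmetric])
    also have "\<dots> = (\<Prod>j\<in>UNIV. emeasure lborel {l $ j <..< u $ j})" by (simp only: inv)
    also have "\<dots> = ennreal (\<Prod>j\<in>UNIV. u $ j - l $ j)"
      using lu by (simp add: prod_ennreal)
    also have "(\<Prod>j\<in>UNIV. u $ j - l $ j) = (\<Prod>b\<in>Basis. (u - l) \<bullet> b)"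
    proof -
      have B: "(Basis :: (real ^ 'n) set) = (\<lambda>j. axis j 1) ` UNIV" by (auto simp: Basis_vec_def)
      have "inj (\<lambda>j :: 'n. axis j (1 :: real))" by (auto simp: inj_def axis_eq_axis)
      then have "(\<Prod>b\<in>(\<lambda>j. axis j 1) ` UNIV. (u - l) \<bullet> b) = (\<Prod>j\<in>UNIV. (u - l) \<bullet> axis j 1)"
        by (subst prod.reindex) simp_all
      then show ?thesis unfolding B by (simp add: inner_axis)
    qed
    finally show "emeasure (distr ?P borel ?\<Phi>) (box l u) = (\<Prod>b\<in>Basis. (u - l) \<bullet> b)" .
  qed simp
  then show "distr ?P borel ?\<Phi> = lborel" by simp
qed

text \<open>For empty \<open>I\<close> the space is one point of mass 1, so a single-point
  \<open>L\<close> is covered as well.\<close>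

lemma emeasure_PiM_lborel_space:
  assumes "finite I"
  shows "emeasure (\<Pi>\<^sub>M i\<in>I. (lborel :: real measure)) (space (\<Pi>\<^sub>M i\<in>I. (lborel :: real measure))) \<noteq> 0"
proof -
  interpret product_sigma_finite "\<lambda>_ :: 'a. lborel :: real measure" by standard
  show ?thesis
    using assms by (simp add: space_PiM emeasure_PiM)
qed

lemma not_AE_False:
  assumes "emeasure M (space M) \<noteq> 0"
  shows "\<not> (AE x in M. False)"
  using assms by (simp add: AE_iff_null null_sets_def)

lemma affine_lebesgue_frame:
  fixes L :: "'a::euclidean_space set"
  assumes "affine L" "L \<noteq> {}"
  shows "\<exists>p B. affine_orthonormal_frame L p B \<and>
    affine_lebesgue L = distr (\<Pi>\<^sub>M b\<in>B. lborel) (restrict_space borel L) (frame_map p B)"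
proof -
  let ?Q = "\<lambda>(p, B). affine_orthonormal_frame L p B"
  have "\<exists>pB. ?Q pB" using affine_orthonormal_frame_exists[OF assms] by auto
  then have "?Q (SOME pB. ?Q pB)" by (rule someI_ex)
  moreover obtain p B where pB: "(SOME pB. ?Q pB) = (p, B)" by (cases "SOME pB. ?Q pB")
  ultimately have "affine_orthonormal_frame L p B" by simp
  moreover have "affine_lebesgue L = distr (\<Pi>\<^sub>M b\<in>B. lborel) (restrict_space borel L) (frame_map p B)"
    unfolding affine_lebesgue_def pB by simp
  ultimately show ?thesis by blast
qed

lemma frame_coordinates:
  assumes "affine_orthonormal_frame L p B" "b' \<in> B"
  shows "(frame_map p B t - p) \<bullet> b' = t b'"
proof -
  note fin = affine_orthonormal_frame_finite[OF assms(1)]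
  have orth: "b \<bullet> b' = (if b = b' then 1 else 0)" if "b \<in> B" for b
    using assms that
    unfolding affine_orthonormal_frame_def pairwise_def orthogonal_def by (auto simp: norm_eq_1)
  have "(frame_map p B t - p) \<bullet> b' = (\<Sum>b\<in>B. if b = b' then t b else 0)"
    unfolding frame_map_def inner_sum_left add_diff_cancel_left'
    by (intro sum.cong) (auto simp: orth)
  then show ?thesis using fin assms(2) by simp
qed

lemma frame_map_eq_sum:
  fixes \<kappa> :: "'n::finite \<Rightarrow> 'a::euclidean_space"
  assumes \<kappa>: "bij_betw \<kappa> UNIV (B \<union> K)"
  shows "p + (\<Sum>j\<in>UNIV. h (\<kappa> j) *\<^sub>R (if \<kappa> j \<in> B then \<kappa> j else 0)) = frame_map p B h"
proof -
  have fin: "finite (B \<union> K)" using bij_betw_finite[OF \<kappa>] by simp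
  have "(\<Sum>j\<in>UNIV. h (\<kappa> j) *\<^sub>R (if \<kappa> j \<in> B then \<kappa> j else 0))
      = (\<Sum>i\<in>B \<union> K. h i *\<^sub>R (if i \<in> B then i else 0))"
    by (rule sum.reindex_bij_betw[OF \<kappa>])
  also have "\<dots> = (\<Sum>i\<in>B. h i *\<^sub>R i)"
    using fin by (intro sum.mono_neutral_cong_right) auto
  finally show ?thesis by (simp add: frame_map_def)
qed

text \<open>\<open>L\<close> is parametrized by all of \<open>real ^ 'n\<close>, with surplus
  coordinates, indexed by \<open>K\<close>, that do not move the point. Fubini gives the claim for
  almost every \<open>u\<close> and almost every surplus \<open>v\<close>; as it does not involve
  \<open>v\<close> and the surplus space is not null, it holds for almost every
  \<open>u\<close>.\<close>

lemma AE_frame_of_lborel: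
  fixes p :: "real ^ 'n" and \<kappa> :: "'n \<Rightarrow> real ^ 'n"
  assumes \<kappa>: "bij_betw \<kappa> UNIV (B \<union> K)" and BK: "B \<inter> K = {}"
    and ae: "AE x in lborel. P (p + (\<Sum>j\<in>UNIV. x $ j *\<^sub>R (if \<kappa> j \<in> B then \<kappa> j else 0)))"
  shows "AE u in (\<Pi>\<^sub>M b\<in>B. lborel). P (frame_map p B u)"
proof -
  interpret product_sigma_finite "\<lambda>_ :: real ^ 'n. lborel :: real measure" by standard
  have "finite (B \<union> K)" using bij_betw_finite[OF \<kappa>] by simp
  then have fin: "finite B" "finite K" by auto
  interpret B: finite_product_sigma_finite "\<lambda>_ :: real ^ 'n. lborel :: real measure" B by standard (rule fin)
  interpret K: finite_product_sigma_finite "\<lambda>_ :: real ^ 'n. lborel :: real measure" K by standard (rule fin)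
  let ?PB = "\<Pi>\<^sub>M b\<in>B. (lborel :: real measure)" and ?PK = "\<Pi>\<^sub>M b\<in>K. (lborel :: real measure)"
  interpret BK: pair_sigma_finite ?PB ?PK by standard
  let ?g = "\<lambda>x :: real ^ 'n. p + (\<Sum>j\<in>UNIV. x $ j *\<^sub>R (if \<kappa> j \<in> B then \<kappa> j else 0))"
  have "AE x in distr (\<Pi>\<^sub>M b\<in>B \<union> K. lborel) borel (\<lambda>h. \<chi> j. h (\<kappa> j)). P (?g x)"
    unfolding distr_PiM_lborel_vec(1)[OF \<kappa>] by (rule ae)
  then have "AE h in (\<Pi>\<^sub>M b\<in>B \<union> K. lborel). P (?g (\<chi> j. h (\<kappa> j)))"
    by (rule AE_distrD[OF distr_PiM_lborel_vec(2)[OF \<kappa>]])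
  moreover have "?g (\<chi> j. h (\<kappa> j)) = frame_map p B h" for h
    using frame_map_eq_sum[OF \<kappa>, of p h] by simp
  ultimately have "AE h in (\<Pi>\<^sub>M b\<in>B \<union> K. lborel). P (frame_map p B h)" by simp
  then have "AE h in distr (?PB \<Otimes>\<^sub>M ?PK) (\<Pi>\<^sub>M b\<in>B \<union> K. lborel) (merge B K). P (frame_map p B h)"
    unfolding distr_merge[OF BK fin] .
  then have "AE z in ?PB \<Otimes>\<^sub>M ?PK. P (frame_map p B (merge B K z))"
    by (rule AE_distrD[OF measurable_merge])
  then have "AE u in ?PB. AE v in ?PK. P (frame_map p B (merge B K (u, v)))"
    by (rule BK.AE_pair)
  moreover have "frame_map p B (merge B K (u, v)) = frame_map p B u" for u v
    unfolding frame_map_def by (intro arg_cong2[of _ _ _ _ "(+)"] sum.cong refl) (simp add: merge_def)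
  ultimately have "AE u in ?PB. AE v in ?PK. P (frame_map p B u)" by simp
  then show ?thesis
  proof eventually_elim
    case (elim u)
    then show ?case using not_AE_False[OF emeasure_PiM_lborel_space[OF fin(2)]] by (cases "P (frame_map p B u)") auto
  qed
qed

text \<open>\<open>P\<close> is an arbitrary predicate, so the argument transports a measurable null
  set containing its failures: the coordinate map \<open>\<psi>\<close> is a measurable inverse of
  the frame map, and pulling the set back along it stays measurable.\<close>

lemma AE_affine_lebesgueI:
  fixes L :: "'a::euclidean_space set"
  assumes fr: "affine_orthonormal_frame L p B"
    and ae: "AE u in (\<Pi>\<^sub>M b\<in>B. lborel). P (frame_map p B u)"
  shows "AE y in distr (\<Pi>\<^sub>M b\<in>B. lborel) (restrict_space borel L) (frame_map p B). P y"
proof -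
  let ?PB = "\<Pi>\<^sub>M b\<in>B. (lborel :: real measure)" and ?R = "restrict_space borel L"
  obtain N where N: "{u \<in> space ?PB. \<not> P (frame_map p B u)} \<subseteq> N" "emeasure ?PB N = 0" "N \<in> sets ?PB"
    using ae by (rule AE_E)
  define \<psi> where "\<psi> = (\<lambda>y. \<lambda>b\<in>B. (y - p) \<bullet> b)"
  have \<psi>: "\<psi> \<in> ?R \<rightarrow>\<^sub>M ?PB"
    unfolding \<psi>_def
  proof (rule measurable_restrict)
    fix b assume "b \<in> B"
    have "(\<lambda>y. (y - p) \<bullet> b) \<in> borel \<rightarrow>\<^sub>M lborel" by simp
    then show "(\<lambda>y. (y - p) \<bullet> b) \<in> ?R \<rightarrow>\<^sub>M lborel" by (rule measurable_restrict_space1)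
  qed
  have inv: "\<psi> (frame_map p B u) = u" if "u \<in> space ?PB" for u
    using that frame_coordinates[OF fr, of _ u]
    by (auto simp: \<psi>_def space_PiM PiE_def extensional_def fun_eq_iff)
  define N' where "N' = \<psi> -` N \<inter> space ?R"
  have N': "N' \<in> sets ?R" unfolding N'_def using \<psi> N(3) by (rule measurable_sets)
  have "emeasure (distr ?PB ?R (frame_map p B)) N' = emeasure ?PB (frame_map p B -` N' \<inter> space ?PB)"
    using frame_map_measurable[OF fr] N' by (rule emeasure_distr)
  also have "\<dots> \<le> emeasure ?PB N"
    using inv N(3) by (intro emeasure_mono) (auto simp: N'_def)
  finally have "N' \<in> null_sets (distr ?PB ?R (frame_map p B))" using N(2) N' by auto
  then show ?thesis
  proof (rule AE_I')
    show "{y \<in> space (distr ?PB ?R (frame_map p B)). \<not> P y} \<subseteq> N'"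
    proof
      fix y assume y: "y \<in> {y \<in> space (distr ?PB ?R (frame_map p B)). \<not> P y}"
      then have "y \<in> L" by (simp add: space_restrict_space)
      then obtain u where u: "u \<in> space ?PB" "y = frame_map p B u"
        using frame_map_bij[OF fr] by (auto simp: bij_betw_def space_PiM)
      then have "u \<in> N" using N(1) y by blast
      then show "y \<in> N'" using inv[OF u(1)] u y by (simp add: N'_def)
    qed
  qed
qed

theorem theorem1p2:
  fixes L :: "(real ^ 'n) set"
    and U :: "(real ^ 'd) set"
    and f :: "real ^ 'd \<Rightarrow> real ^ 'n"
  assumes "affine L"
    and "open U" and "U \<noteq> {}"
    and "f ` U \<subseteq> L"
    and "real_analytic_on f U"
    and "\<And>x r M. r > 0 \<Longrightarrow> ball x r \<subseteq> U \<Longrightarrow> affine M \<Longrightarrow> M \<subset> L \<Longrightarrow> \<not> f ` ball x r \<subseteq> M"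
  shows "(AE x in lebesgue_on U. \<not> singular_vector (f x)) \<longleftrightarrow>
         (AE y in affine_lebesgue L. \<not> singular_vector y)"
proof -
  have "L \<noteq> {}" using assms by blast
  then obtain p B where fr: "affine_orthonormal_frame L p B" and leb:
    "affine_lebesgue L = distr (\<Pi>\<^sub>M b\<in>B. lborel) (restrict_space borel L) (frame_map p B)"
    using affine_lebesgue_frame[OF assms(1)] by blast
  note finB = affine_orthonormal_frame_finite[OF fr]
  have nondeg: "\<forall>x r. r > 0 \<longrightarrow> ball x r \<subseteq> U \<longrightarrow> affine hull (f ` ball x r) = L"
  proof (intro allI impI)
    fix x r assume r: "r > (0 :: real)" "ball x r \<subseteq> U"
    have "f ` ball x r \<subseteq> L" using r(2) assms(4) by blast
    then have "affine hull (f ` ball x r) \<subseteq> L" using assms(1) by (rule hull_minimal)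
    moreover have "\<not> affine hull (f ` ball x r) \<subset> L"
    proof
      assume "affine hull (f ` ball x r) \<subset> L"
      from assms(6)[OF r affine_affine_hull this] show False using hull_subset by (rule notE)
    qed
    ultimately show "affine hull (f ` ball x r) = L" by blast
  qed
  have Umeas: "U \<in> sets lebesgue" using assms(2) by (simp add: sets_completionI_sets)
  \<comment> \<open>One nonsingular point of \<open>L\<close> implies both almost-everywhere
    statements. Conversely each of them yields such a point, because neither measure is
    zero.\<close>
  have forward: "AE x in lebesgue_on U. \<not> singular_vector (f x)" if "y0 \<in> L" "\<not> singular_vector y0" for y0
  proof -
    have "negligible {x \<in> U. singular_vector (f x)}"
      using assms(5,2,4,1) nondeg that by (rule singular_negligible)
    then have "{x \<in> U. singular_vector (f x)} \<in> null_sets lebesgue" by (simp add: negligible_iff_null_sets)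
    then have "AE x in lebesgue. x \<in> U \<longrightarrow> \<not> singular_vector (f x)"
      by (rule AE_I') auto
    then show ?thesis using Umeas by (simp add: AE_restrict_space_iff)
  qed
  have backward: "AE y in affine_lebesgue L. \<not> singular_vector y" if y0: "y0 \<in> L" "\<not> singular_vector y0" for y0
  proof -
    have "card B \<le> CARD('n)"
    proof -
      have "0 \<notin> B" using fr by (auto simp: affine_orthonormal_frame_def)
      then have "independent B"
        using fr pairwise_orthogonal_independent by (auto simp: affine_orthonormal_frame_def)
      then have "card B \<le> DIM(real ^ 'n)" by (rule independent_card_le)
      then show ?thesis by simp
    qed
    have "infinite (UNIV - B :: (real ^ 'n) set)"
      using finB infinite_UNIV_char_0[where 'a = real] by (simp add: infinite_UNIV_vec)
    \<comment> \<open>Arbitrary vectors outside \<open>B\<close>, used as names for the surplus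
      coordinates so that exactly \<open>CARD('n)\<close> parameters are available whatever the
      dimension of \<open>L\<close>.\<close>
    then obtain K where K: "finite K" "card K = CARD('n) - card B" "K \<subseteq> UNIV - B"
      using infinite_arbitrarily_large by blast
    have BK: "B \<inter> K = {}" using K by blast
    have "card (B \<union> K) = CARD('n)"
      using finB K BK \<open>card B \<le> CARD('n)\<close> by (simp add: card_Un_disjoint)
    then obtain \<kappa> :: "'n \<Rightarrow> real ^ 'n" where \<kappa>: "bij_betw \<kappa> UNIV (B \<union> K)"
      using finB K finite_same_card_bij[of "UNIV :: 'n set" "B \<union> K"] by auto
    define g where "g = (\<lambda>x :: real ^ 'n. p + (\<Sum>j\<in>UNIV. x $ j *\<^sub>R (if \<kappa> j \<in> B then \<kappa> j else 0)))"
    have g_frame: "g (\<chi> j. h (\<kappa> j)) = frame_map p B h" for h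
      using frame_map_eq_sum[OF \<kappa>, of p h] by (simp add: g_def)
    have range_g: "range g = L"
    proof
      show "range g \<subseteq> L"
      proof
        fix y assume "y \<in> range g"
        then obtain x where x: "y = g x" by blast
        define h where "h = (\<lambda>i. x $ inv_into UNIV \<kappa> i)"
        have "x = (\<chi> j. h (\<kappa> j))" using \<kappa> by (simp add: h_def vec_eq_iff bij_betw_def)
        then have "y = frame_map p B (restrict h B)"
          using g_frame[of h] by (simp add: x frame_map_def)
        moreover have "restrict h B \<in> (\<Pi>\<^sub>E b\<in>B. UNIV)" by simp
        ultimately show "y \<in> L" using frame_map_bij[OF fr] by (auto simp: bij_betw_def)
      qed
      show "L \<subseteq> range g"
      proof
        fix y assume "y \<in> L"
        then obtain h where "y = frame_map p B h" using frame_map_bij[OF fr] by (auto simp: bij_betw_def)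
        then show "y \<in> range g" using g_frame[of h] by (metis rangeI)
      qed
    qed
    have g_affine: "g ((1 - s) *\<^sub>R x + s *\<^sub>R y) = (1 - s) *\<^sub>R g x + s *\<^sub>R g y" for x y s
      by (simp add: g_def algebra_simps sum.distrib scaleR_sum_right sum_subtractf)
    have "\<forall>x r. r > 0 \<longrightarrow> ball x r \<subseteq> UNIV \<longrightarrow> affine hull (g ` ball x r) = L"
      using affine_hull_affine_map_ball[of g, OF g_affine] range_g by blast
    moreover have "real_analytic_on g UNIV" unfolding g_def by (rule real_analytic_on_affine_map)
    moreover have "g ` UNIV \<subseteq> L" using range_g by simp
    ultimately have "negligible {x \<in> UNIV. singular_vector (g x)}"
      using assms(1) y0 by (intro singular_negligible[where U = UNIV and L = L]) auto
    then have "{x. singular_vector (g x)} \<in> null_sets lebesgue" by (simp add: negligible_iff_null_sets)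
    then have "AE x in lebesgue. \<not> singular_vector (g x)" by (rule AE_I') auto
    then have "AE x in lborel. \<not> singular_vector (g x)" by (simp add: AE_completion_iff)
    then have "AE u in (\<Pi>\<^sub>M b\<in>B. lborel). \<not> singular_vector (frame_map p B u)"
      unfolding g_def by (rule AE_frame_of_lborel[OF \<kappa> BK])
    then show ?thesis unfolding leb by (rule AE_affine_lebesgueI[OF fr])
  qed
  show ?thesis
  proof
    assume ae: "AE x in lebesgue_on U. \<not> singular_vector (f x)"
    have "\<exists>x\<in>U. \<not> singular_vector (f x)"
    proof (rule ccontr)
      assume no: "\<not> ?thesis"
      have "AE x in lebesgue_on U. False" using ae by (rule AE_mp) (use no in \<open>auto intro!: AE_I2\<close>)
      moreover have "emeasure (lebesgue_on U) (space (lebesgue_on U)) \<noteq> 0"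
      proof -
        have "\<not> negligible U" using assms(2,3) open_not_negligible by blast
        then show ?thesis
          using Umeas by (auto simp: emeasure_restrict_space negligible_iff_null_sets null_sets_def)
      qed
      ultimately show False using not_AE_False by blast
    qed
    then show "AE y in affine_lebesgue L. \<not> singular_vector y" using backward assms(4) by blast
  next
    assume ae: "AE y in affine_lebesgue L. \<not> singular_vector y"
    have "\<exists>y\<in>L. \<not> singular_vector y"
    proof (rule ccontr)
      assume no: "\<not> ?thesis"
      have "AE u in (\<Pi>\<^sub>M b\<in>B. lborel). \<not> singular_vector (frame_map p B u)"
        using ae unfolding leb by (rule AE_distrD[OF frame_map_measurable[OF fr]])
      then have "AE u in (\<Pi>\<^sub>M b\<in>B. (lborel :: real measure)). False"
      proof (rule AE_mp, intro AE_I2 impI)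
        fix u assume "u \<in> space (\<Pi>\<^sub>M b\<in>B. (lborel :: real measure))" "\<not> singular_vector (frame_map p B u)"
        moreover from this have "frame_map p B u \<in> L"
          using frame_map_bij[OF fr] by (auto simp: bij_betw_def space_PiM)
        ultimately show False using no by blast
      qed
      then show False using not_AE_False[OF emeasure_PiM_lborel_space[OF finB]] by blast
    qed
    then show "AE x in lebesgue_on U. \<not> singular_vector (f x)" using forward by blast
  qed
qed

end
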